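(* Let $\alpha\in\mathbb{R}$ and let $\mathcal D^{\mathsf s}_1(\Delta_T^3;B_\alpha)$ be a critical admissible selection domain for a linear splitting rule $\mathsf s$. Then the dyadic recursion, which assigns to $H$ the selected residual $R^{\mathsf s}(H)$ on dyadic pairs, extends uniquely by continuity to a continuous linear map $$\hat\Lambda^{\mathsf s}_{S,1,\alpha}:\mathcal D^{\mathsf s}_1(\Delta_T^3;B_\alpha)\to C^1_{\log}(\Delta_T^2;B_\alpha),\qquad H\mapsto\hat\Lambda^{\mathsf s}_{S,1,\alpha}H:=R^{\mathsf s}(H),$$ satisfying $\hat\delta\hat\Lambda^{\mathsf s}_{S,1,\alpha}H=H$. Moreover, $$\|\hat\Lambda^{\mathsf s}_{S,1,\alpha}H\|_{1,\log;\alpha}\le C_{T,S,C_\ast,\eta,\mathsf s}\|H\|_{1,\alpha}.$$ For an individual defect $H\in Z\hat C^1(\Delta_T^3;B_\alpha)$ outside a fixed linear domain (with a critical admissible splitting rule with constants $C_H,C_\ast,\eta$, and satisfying the residual continuity criterion), the same estimate holds with the right-hand side replaced by $C_{T,S,C_\ast,\eta}(\|H\|_{1,\alpha}+C_H)$. Consequently, for every $0<\varepsilon<1$ (and $H\in\mathcal D^{\mathsf s}_1(\Delta_T^3;B_\alpha)$), $$\|\hat\Lambda^{\mathsf s}_{S,1,\alpha}H\|_{1-\varepsilon,\alpha}\le C_{\varepsilon,T,S,C_\ast,\eta,\mathsf s}\|H\|_{1,\alpha}.$$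
   Context: Fix $T>0$. $(B_\alpha)_{\alpha\in\mathbb{R}}$ is a Banach scale, i.e. a family of Banach spaces such that for $\alpha\le\beta$ the embedding $B_\beta\hookrightarrow B_\alpha$ is continuous. $S=(S_t)_{t\ge0}$ is an analytic (in particular strongly continuous) semigroup of bounded linear operators acting on this scale, with $S_0=\mathrm{Id}$; for every $\alpha\in\mathbb{R}$, $\varepsilon\in(0,1)$ there is $C_{\alpha,\varepsilon,T}>0$ with $\|S_tx\|_{B_{\alpha+\varepsilon}}\le C_{\alpha,\varepsilon,T}t^{-\varepsilon}\|x\|_{B_\alpha}$ and $\|(S_t-\mathrm{Id})x\|_{B_\alpha}\le C_{\alpha,\varepsilon,T}t^{\varepsilon}\|x\|_{B_{\alpha+\varepsilon}}$ for all $t\in(0,T]$. $\Delta_T^n:=\{(t_1,\dots,t_n)\in[0,T]^n:0\le t_n\le\dots\le t_1\le T\}$; $C(\Delta_T^n;B_\alpha)$ denotes continuous maps; $(\hat\delta g)_{t_1\dots t_{n+1}}:=\sum_{i=1}^{n+1}(-1)^ig_{t_1\dots\hat t_i\dots t_{n+1}}-(S_{t_1-t_2}-\mathrm{Id})g_{t_2\dots t_{n+1}}$; in particular $(\hat\delta g)_{tus}=g_{ts}-g_{tu}-S_{t-u}g_{us}$ for two-increments. For $g\in C(\Delta_T^2;B_\alpha)$: $\|g\|_{\mu,\alpha}:=\sup_{s<t}\|g_{ts}\|_{B_\alpha}/|t-s|^\mu$ and $\|g\|_{1,\log;\alpha}:=\sup_{s<t}\frac{\|g_{ts}\|_{B_\alpha}}{|t-s|(1+|\log|t-s||)}$;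 $C^1_{\log}(\Delta_T^2;B_\alpha)$ is the set where the latter is finite. For $h\in C(\Delta_T^3;B_\alpha)$: $\|h\|_{1,\alpha}:=\inf\{\sum_{j=1}^m\sup_{s<u<t}\frac{\|h_{j,tus}\|_{B_\alpha}}{|t-u|^{\rho_j}|u-s|^{1-\rho_j}}:h=\sum_{j=1}^mh_j,\ m\in\mathbb{N},\ 0<\rho_j<1\}$; $C^1(\Delta_T^3;B_\alpha)$ is the set of finite norm; $Z\hat C^1(\Delta_T^3;B_\alpha):=\ker\hat\delta\cap C^1(\Delta_T^3;B_\alpha)$. Dyadic recursion. Let $\mathcal D_n:=\{kT2^{-n}:0\le k\le2^n\}$, $\mathcal D:=\bigcup_{n\ge0}\mathcal D_n$; a dyadic interval is an interval between consecutive points of some $\mathcal D_n$. For $H\in Z\hat C^1(\Delta_T^3;B_\alpha)$ let $B^H_{ts}:=-H_{ts0}$. A (defect-dependent scale) splitting rule $\mathsf s$ for $H$ assigns to each dyadic interval $[a,c]$ with midpoint $b=(a+c)/2$ carrying a residual $Q_{ca}\in B_\alpha$ generated by the recursion two child residuals $Q^{\mathsf s}_{cb},Q^{\mathsf s}_{ba}\in B_\alpha$ with $$Q_{ca}=Q^{\mathsf s}_{cb}+S_{c-b}Q^{\mathsf s}_{ba}+H_{cba}.\qquad(\ast)$$ The recursion constructs a path $I^{\mathsf s}=I^{\mathsf s}(H):\mathcal D\to B_\alpha$, with $R^{\mathsf s}_{ts}:=B^H_{ts}-I^{\mathsf s}_t+S_{t-s}I^{\mathsf s}_s$ for $s\le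 t$ in $\mathcal D$: set $I^{\mathsf s}_0:=0$, $I^{\mathsf s}_T:=B^H_{T0}$; once $I^{\mathsf s}$ is defined at the endpoints of a dyadic interval $[a,c]$ with midpoint $b$, put $Q_{ca}:=R^{\mathsf s}_{ca}$, apply $\mathsf s$ to get $Q^{\mathsf s}_{cb},Q^{\mathsf s}_{ba}$, and set $I^{\mathsf s}_b:=B^H_{ba}+S_{b-a}I^{\mathsf s}_a-Q^{\mathsf s}_{ba}$. The rule is critical admissible for $H$ if there are $C_H,C_\ast,\eta>0$ such that for every generated residual $Q_{ca}$ on a dyadic interval of length $L=c-a$, $\max\{\|Q^{\mathsf s}_{cb}\|_{B_\alpha},\|Q^{\mathsf s}_{ba}\|_{B_\alpha}\}\le(\tfrac12+C_\ast L^\eta)\|Q_{ca}\|_{B_\alpha}+C_HL$. Residual continuity criterion: $\lim_{h\downarrow0}\sup\{\|(S_h-\mathrm{Id})R^{\mathsf s}_{ts}\|_{B_\alpha}:s\le t,\ s,t\in\mathcal D,\ t+h\le T\}=0$. Critical admissible selection domain (for a fixed linear splitting rule $\mathsf s$, i.e. one for which the generated residuals depend linearly on $H$): a linear subspace $\mathcal D^{\mathsf s}_1(\Delta_T^3;B_\alpha)\subset Z\hat C^1(\Delta_T^3;B_\alpha)$ such that for every $H$ in it the recursion is well defined, $(\ast)$ holds at each step, the critical admissibility estimate holds with fixed $C_\ast,\eta>0$ and $C_H\le C_{\mathsf s}\|H\|_{1,\alpha}$ (with $C_{\mathsf s}$ independent of $H$), and the residual continuity criterion holds. *)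

theory Defs
  imports "HOL-Analysis.Analysis"
begin

section \<open>Banach scales and analytic semigroups\<close>

text \<open>
  A Banach space is a linear subspace \<open>V\<close> of an ambient real vector space together with a
  norm \<open>N\<close> on \<open>V\<close>; values of \<open>N\<close> outside \<open>V\<close> are irrelevant. The members of a scale
  are subspaces of one ambient space, so that the embeddings are inclusions.
\<close>

definition banach_on :: "'a::real_vector set \<Rightarrow> ('a \<Rightarrow> real) \<Rightarrow> bool" where
  "banach_on V N \<longleftrightarrow>
     subspace V \<and>
     (\<forall>x\<in>V. 0 \<le> N x \<and> (N x = 0 \<longleftrightarrow> x = 0)) \<and>
     (\<forall>x\<in>V. \<forall>c. N (c *\<^sub>R x) = \<bar>c\<bar> * N x) \<and>
     (\<forall>x\<in>V. \<forall>y\<in>V. N (x + y) \<le> N x + N y) \<and>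
     (\<forall>X :: nat \<Rightarrow> 'a. range X \<subseteq> V \<and> (\<forall>e>0. \<exists>M. \<forall>m\<ge>M. \<forall>n\<ge>M. N (X m - X n) < e)
        \<longrightarrow> (\<exists>x\<in>V. (\<lambda>n. N (X n - x)) \<longlonglongrightarrow> 0))"

definition banach_scale :: "(real \<Rightarrow> 'a::real_vector set) \<Rightarrow> (real \<Rightarrow> 'a \<Rightarrow> real) \<Rightarrow> bool" where
  "banach_scale B nrm \<longleftrightarrow>
     (\<forall>\<alpha>. banach_on (B \<alpha>) (nrm \<alpha>)) \<and>
     (\<forall>\<alpha> \<beta>. \<alpha> \<le> \<beta> \<longrightarrow> B \<beta> \<subseteq> B \<alpha> \<and> (\<exists>K. \<forall>x\<in>B \<beta>. nrm \<alpha> x \<le> K * nrm \<beta> x))"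

definition bounded_operator_on :: "'a::real_vector set \<Rightarrow> ('a \<Rightarrow> real) \<Rightarrow> ('a \<Rightarrow> 'a) \<Rightarrow> bool" where
  "bounded_operator_on V N L \<longleftrightarrow>
     L ` V \<subseteq> V \<and>
     (\<forall>x\<in>V. \<forall>y\<in>V. L (x + y) = L x + L y) \<and>
     (\<forall>x\<in>V. \<forall>c. L (c *\<^sub>R x) = c *\<^sub>R L x) \<and>
     (\<exists>K. \<forall>x\<in>V. N (L x) \<le> K * N x)"

definition strongly_continuous_semigroup_on ::
    "'a::real_vector set \<Rightarrow> ('a \<Rightarrow> real) \<Rightarrow> (real \<Rightarrow> 'a \<Rightarrow> 'a) \<Rightarrow> bool" where
  "strongly_continuous_semigroup_on V N S \<longleftrightarrow>
     (\<forall>t\<ge>0. bounded_operator_on V N (S t)) \<and>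
     (\<forall>x\<in>V. S 0 x = x) \<and>
     (\<forall>s\<ge>0. \<forall>t\<ge>0. \<forall>x\<in>V. S (s + t) x = S s (S t x)) \<and>
     (\<forall>x\<in>V. ((\<lambda>t. N (S t x - x)) \<longlongrightarrow> 0) (at_right 0))"

text \<open>
  Analyticity means holomorphic extension to a sector. The spaces are real, so the extension
  acts on the complexification \<open>V \<times> V\<close>, where \<open>(x, y)\<close> stands for \<open>x + i y\<close>.
\<close>

definition cscale :: "complex \<Rightarrow> 'a::real_vector \<times> 'a \<Rightarrow> 'a \<times> 'a" where
  "cscale z p = (Re z *\<^sub>R fst p - Im z *\<^sub>R snd p, Re z *\<^sub>R snd p + Im z *\<^sub>R fst p)"

definition cnrm :: "('a \<Rightarrow> real) \<Rightarrow> 'a \<times> 'a \<Rightarrow> real" where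
  "cnrm N p = N (fst p) + N (snd p)"

definition sector :: "real \<Rightarrow> complex set" where
  "sector \<theta> = {z. z \<noteq> 0 \<and> \<bar>Arg z\<bar> < \<theta>}"

definition analytic_semigroup_on ::
    "'a::real_vector set \<Rightarrow> ('a \<Rightarrow> real) \<Rightarrow> (real \<Rightarrow> 'a \<Rightarrow> 'a) \<Rightarrow> bool" where
  "analytic_semigroup_on V N S \<longleftrightarrow>
     strongly_continuous_semigroup_on V N S \<and>
     (\<exists>\<theta> Z. 0 < \<theta> \<and> \<theta> \<le> pi / 2 \<and>
        (\<forall>t>0. \<forall>x\<in>V. \<forall>y\<in>V. Z (complex_of_real t) (x, y) = (S t x, S t y)) \<and>
        (\<forall>z\<in>sector \<theta>. bounded_operator_on (V \<times> V) (cnrm N) (Z z) \<and>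
           (\<forall>w. \<forall>p\<in>V \<times> V. Z z (cscale w p) = cscale w (Z z p))) \<and>
        (\<forall>z\<in>sector \<theta>. \<forall>w\<in>sector \<theta>. \<forall>p\<in>V \<times> V. Z (z + w) p = Z z (Z w p)) \<and>
        (\<forall>z\<in>sector \<theta>. \<forall>p\<in>V \<times> V. \<exists>d\<in>V \<times> V.
           ((\<lambda>w. cnrm N (Z w p - Z z p - cscale (w - z) d) / cmod (w - z)) \<longlongrightarrow> 0) (at z)) \<and>
        (\<forall>\<theta>'. 0 < \<theta>' \<and> \<theta>' < \<theta> \<longrightarrow>
           (\<forall>p\<in>V \<times> V. ((\<lambda>z. cnrm N (Z z p - p)) \<longlongrightarrow> 0) (at 0 within sector \<theta>'))))"

definition analytic_semigroup_on_scale ::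
    "(real \<Rightarrow> 'a::real_vector set) \<Rightarrow> (real \<Rightarrow> 'a \<Rightarrow> real) \<Rightarrow> real \<Rightarrow> (real \<Rightarrow> 'a \<Rightarrow> 'a) \<Rightarrow> bool" where
  "analytic_semigroup_on_scale B nrm T S \<longleftrightarrow>
     (\<forall>\<alpha>. analytic_semigroup_on (B \<alpha>) (nrm \<alpha>) S) \<and>
     (\<forall>\<alpha> \<epsilon>. 0 < \<epsilon> \<and> \<epsilon> < 1 \<longrightarrow>
        (\<exists>C>0. \<forall>t. 0 < t \<and> t \<le> T \<longrightarrow>
           (\<forall>x\<in>B \<alpha>. S t x \<in> B (\<alpha> + \<epsilon>) \<and> nrm (\<alpha> + \<epsilon>) (S t x) \<le> C * t powr (- \<epsilon>) * nrm \<alpha> x) \<and>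
           (\<forall>x\<in>B (\<alpha> + \<epsilon>). nrm \<alpha> (S t x - x) \<le> C * t powr \<epsilon> * nrm (\<alpha> + \<epsilon>) x)))"


section \<open>Increments on simplices\<close>

text \<open>
  Time arguments are listed in decreasing order: \<open>g (t, s)\<close> is $g_{ts}$ and
  \<open>h (t, u, s)\<close> is $h_{tus}$.
\<close>

definition Delta2 :: "real \<Rightarrow> (real \<times> real) set" where
  "Delta2 T = {(t, s). 0 \<le> s \<and> s \<le> t \<and> t \<le> T}"

definition Delta3 :: "real \<Rightarrow> (real \<times> real \<times> real) set" where
  "Delta3 T = {(t, u, s). 0 \<le> s \<and> s \<le> u \<and> u \<le> t \<and> t \<le> T}"

definition Delta4 :: "real \<Rightarrow> (real \<times> real \<times> real \<times> real) set" where
  "Delta4 T = {(t, u, v, s). 0 \<le> s \<and> s \<le> v \<and> v \<le> u \<and> u \<le> t \<and> t \<le> T}"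

text \<open>
  The continuous maps from \<open>X\<close> to \<open>(V, N)\<close>. They are extended by \<open>0\<close> off \<open>X\<close>, so that
  equality of HOL functions is equality of maps on \<open>X\<close>.
\<close>

definition cont_maps ::
    "'b::topological_space set \<Rightarrow> 'a::real_vector set \<Rightarrow> ('a \<Rightarrow> real) \<Rightarrow> ('b \<Rightarrow> 'a) set" where
  "cont_maps X V N =
     {g. (\<forall>p\<in>X. g p \<in> V \<and> ((\<lambda>q. N (g q - g p)) \<longlongrightarrow> 0) (at p within X)) \<and>
         (\<forall>p. p \<notin> X \<longrightarrow> g p = 0)}"

text \<open>
  The operator $\hat\delta$ on increments of two and of three variables: the alternating sum
  $\sum_i (-1)^i g_{t_1 \ldots \hat t_i \ldots t_{n+1}}$ minus
  $(S_{t_1 - t_2} - \mathrm{Id}) g_{t_2 \ldots t_{n+1}}$.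
\<close>

definition hdelta2 ::
    "(real \<Rightarrow> 'a \<Rightarrow> 'a) \<Rightarrow> (real \<times> real \<Rightarrow> 'a::real_vector) \<Rightarrow> real \<times> real \<times> real \<Rightarrow> 'a" where
  "hdelta2 S g = (\<lambda>(t, u, s).
     - g (u, s) + g (t, s) - g (t, u) - (S (t - u) (g (u, s)) - g (u, s)))"

definition hdelta3 ::
    "(real \<Rightarrow> 'a \<Rightarrow> 'a) \<Rightarrow> (real \<times> real \<times> real \<Rightarrow> 'a::real_vector)
       \<Rightarrow> real \<times> real \<times> real \<times> real \<Rightarrow> 'a" where
  "hdelta3 S h = (\<lambda>(t, u, v, s).
     - h (u, v, s) + h (t, v, s) - h (t, u, s) + h (t, u, v)
     - (S (t - u) (h (u, v, s)) - h (u, v, s)))"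

definition norm2 :: "real \<Rightarrow> ('a \<Rightarrow> real) \<Rightarrow> real \<Rightarrow> (real \<times> real \<Rightarrow> 'a) \<Rightarrow> ennreal" where
  "norm2 T N \<mu> g =
     (SUP (t, s) \<in> {(t, s). 0 \<le> s \<and> s < t \<and> t \<le> T}. ennreal (N (g (t, s)) / \<bar>t - s\<bar> powr \<mu>))"

definition norm_log :: "real \<Rightarrow> ('a \<Rightarrow> real) \<Rightarrow> (real \<times> real \<Rightarrow> 'a) \<Rightarrow> ennreal" where
  "norm_log T N g =
     (SUP (t, s) \<in> {(t, s). 0 \<le> s \<and> s < t \<and> t \<le> T}.
        ennreal (N (g (t, s)) / (\<bar>t - s\<bar> * (1 + \<bar>ln \<bar>t - s\<bar>\<bar>))))"

definition C1_log ::
    "real \<Rightarrow> 'a::real_vector set \<Rightarrow> ('a \<Rightarrow> real) \<Rightarrow> (real \<times> real \<Rightarrow> 'a) set" where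
  "C1_log T V N = {g \<in> cont_maps (Delta2 T) V N. norm_log T N g < \<infinity>}"

definition norm3_split ::
    "real \<Rightarrow> ('a \<Rightarrow> real) \<Rightarrow> real \<Rightarrow> (real \<times> real \<times> real \<Rightarrow> 'a) \<Rightarrow> ennreal" where
  "norm3_split T N \<rho> h =
     (SUP (t, u, s) \<in> {(t, u, s). 0 \<le> s \<and> s < u \<and> u < t \<and> t \<le> T}.
        ennreal (N (h (t, u, s)) / (\<bar>t - u\<bar> powr \<rho> * \<bar>u - s\<bar> powr (1 - \<rho>))))"

definition norm3 ::
    "real \<Rightarrow> 'a::real_vector set \<Rightarrow> ('a \<Rightarrow> real) \<Rightarrow> (real \<times> real \<times> real \<Rightarrow> 'a) \<Rightarrow> ennreal" where
  "norm3 T V N H =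
     Inf {(\<Sum>j = 1..m. norm3_split T N (\<rho> j) (h j)) | (m::nat) \<rho> h.
            (\<forall>j\<in>{1..m}. 0 < \<rho> j \<and> \<rho> j < 1 \<and> h j \<in> cont_maps (Delta3 T) V N) \<and>
            (\<forall>p. H p = (\<Sum>j = 1..m. h j p))}"

definition ZC1 ::
    "real \<Rightarrow> (real \<Rightarrow> 'a \<Rightarrow> 'a) \<Rightarrow> 'a::real_vector set \<Rightarrow> ('a \<Rightarrow> real)
       \<Rightarrow> (real \<times> real \<times> real \<Rightarrow> 'a) set" where
  "ZC1 T S V N =
     {h \<in> cont_maps (Delta3 T) V N. norm3 T V N h < \<infinity> \<and> (\<forall>p\<in>Delta4 T. hdelta3 S h p = 0)}"


section \<open>The dyadic recursion\<close>

definition dyadic_level :: "real \<Rightarrow> nat \<Rightarrow> real set" where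
  "dyadic_level T n = {real k * T / 2 ^ n | k. k \<le> 2 ^ n}"

definition dyadic_points :: "real \<Rightarrow> real set" where
  "dyadic_points T = (\<Union>n. dyadic_level T n)"

definition dyadic_intervals :: "real \<Rightarrow> (real \<times> real) set" where
  "dyadic_intervals T = {(real k * T / 2 ^ n, real (Suc k) * T / 2 ^ n) | (n::nat) k. k < 2 ^ n}"

text \<open>
  A splitting rule for a fixed defect \<open>H\<close> maps the endpoints \<open>a < c\<close> of a dyadic interval with
  midpoint \<open>b\<close> and its residual $Q_{ca}$ to the pair of child residuals $(Q_{cb}, Q_{ba})$.
\<close>

type_synonym 'a splitting = "real \<Rightarrow> real \<Rightarrow> 'a \<Rightarrow> 'a \<times> 'a"

definition BH :: "(real \<times> real \<times> real \<Rightarrow> 'a::real_vector) \<Rightarrow> real \<Rightarrow> real \<Rightarrow> 'a" where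
  "BH H t s = - H (t, s, 0)"

definition resid ::
    "(real \<Rightarrow> 'a \<Rightarrow> 'a) \<Rightarrow> (real \<times> real \<times> real \<Rightarrow> 'a::real_vector) \<Rightarrow> (real \<Rightarrow> 'a)
       \<Rightarrow> real \<Rightarrow> real \<Rightarrow> 'a" where
  "resid S H I t s = BH H t s - I t + S (t - s) (I s)"

text \<open>
  \<open>path_at \<dots> n\<close> is the path after \<open>n\<close> rounds of bisection; only its values on
  \<open>dyadic_level T n\<close> are meaningful. A point \<open>b\<close> of level \<open>n + 1\<close> which is not of level \<open>n\<close> is
  the midpoint of the level-\<open>n\<close> interval with endpoints \<open>b - T / 2 ^ (n + 1)\<close> and
  \<open>b + T / 2 ^ (n + 1)\<close>.
\<close>

primrec path_at ::
    "real \<Rightarrow> (real \<Rightarrow> 'a \<Rightarrow> 'a) \<Rightarrow> 'a splitting \<Rightarrow> (real \<times> real \<times> real \<Rightarrow> 'a::real_vector)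
       \<Rightarrow> nat \<Rightarrow> real \<Rightarrow> 'a" where
  "path_at T S \<sigma> H 0 = (\<lambda>b. if b = T then BH H T 0 else 0)"
| "path_at T S \<sigma> H (Suc n) = (\<lambda>b.
     if b \<in> dyadic_level T n then path_at T S \<sigma> H n b
     else (let a = b - T / 2 ^ Suc n;
               c = b + T / 2 ^ Suc n;
               Q = resid S H (path_at T S \<sigma> H n) c a
           in BH H b a + S (b - a) (path_at T S \<sigma> H n a) - snd (\<sigma> a c Q)))"

definition sel_path ::
    "real \<Rightarrow> (real \<Rightarrow> 'a \<Rightarrow> 'a) \<Rightarrow> 'a splitting \<Rightarrow> (real \<times> real \<times> real \<Rightarrow> 'a::real_vector)
       \<Rightarrow> real \<Rightarrow> 'a" where
  "sel_path T S \<sigma> H t = path_at T S \<sigma> H (LEAST n. t \<in> dyadic_level T n) t"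

definition sel_resid ::
    "real \<Rightarrow> (real \<Rightarrow> 'a \<Rightarrow> 'a) \<Rightarrow> 'a splitting \<Rightarrow> (real \<times> real \<times> real \<Rightarrow> 'a::real_vector)
       \<Rightarrow> real \<Rightarrow> real \<Rightarrow> 'a" where
  "sel_resid T S \<sigma> H = resid S H (sel_path T S \<sigma> H)"

definition splitting_rule ::
    "real \<Rightarrow> (real \<Rightarrow> 'a \<Rightarrow> 'a) \<Rightarrow> 'a::real_vector set
       \<Rightarrow> 'a splitting \<Rightarrow> (real \<times> real \<times> real \<Rightarrow> 'a) \<Rightarrow> bool" where
  "splitting_rule T S V \<sigma> H \<longleftrightarrow>
     (\<forall>(a, c)\<in>dyadic_intervals T.
        let b = (a + c) / 2; Q = sel_resid T S \<sigma> H c a; (Qcb, Qba) = \<sigma> a c Q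
        in Qcb \<in> V \<and> Qba \<in> V \<and> Q = Qcb + S (c - b) Qba + H (c, b, a))"

definition critical_estimate ::
    "real \<Rightarrow> (real \<Rightarrow> 'a \<Rightarrow> 'a) \<Rightarrow> ('a::real_vector \<Rightarrow> real) \<Rightarrow> real \<Rightarrow> real \<Rightarrow> real
       \<Rightarrow> 'a splitting \<Rightarrow> (real \<times> real \<times> real \<Rightarrow> 'a) \<Rightarrow> bool" where
  "critical_estimate T S N C_H C_star \<eta> \<sigma> H \<longleftrightarrow>
     (\<forall>(a, c)\<in>dyadic_intervals T.
        let L = c - a; Q = sel_resid T S \<sigma> H c a; (Qcb, Qba) = \<sigma> a c Q
        in max (N Qcb) (N Qba) \<le> (1 / 2 + C_star * L powr \<eta>) * N Q + C_H * L)"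

definition residual_continuity ::
    "real \<Rightarrow> (real \<Rightarrow> 'a \<Rightarrow> 'a) \<Rightarrow> ('a::real_vector \<Rightarrow> real)
       \<Rightarrow> 'a splitting \<Rightarrow> (real \<times> real \<times> real \<Rightarrow> 'a) \<Rightarrow> bool" where
  "residual_continuity T S N \<sigma> H \<longleftrightarrow>
     ((\<lambda>h. SUP (t, s) \<in> {(t, s). t \<in> dyadic_points T \<and> s \<in> dyadic_points T \<and> s \<le> t \<and> t + h \<le> T}.
          ennreal (N (S h (sel_resid T S \<sigma> H t s) - sel_resid T S \<sigma> H t s))) \<longlongrightarrow> 0) (at_right 0)"

definition linear_rule ::
    "real \<Rightarrow> (real \<Rightarrow> 'a \<Rightarrow> 'a) \<Rightarrow> ((real \<times> real \<times> real \<Rightarrow> 'a::real_vector) \<Rightarrow> 'a splitting)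
       \<Rightarrow> (real \<times> real \<times> real \<Rightarrow> 'a) set \<Rightarrow> bool" where
  "linear_rule T S \<sigma> D \<longleftrightarrow>
     (\<forall>H\<in>D. \<forall>K\<in>D. \<forall>(a, c)\<in>dyadic_intervals T.
        sel_resid T S (\<sigma> (\<lambda>p. H p + K p)) (\<lambda>p. H p + K p) c a
          = sel_resid T S (\<sigma> H) H c a + sel_resid T S (\<sigma> K) K c a) \<and>
     (\<forall>H\<in>D. \<forall>r. \<forall>(a, c)\<in>dyadic_intervals T.
        sel_resid T S (\<sigma> (\<lambda>p. r *\<^sub>R H p)) (\<lambda>p. r *\<^sub>R H p) c a
          = r *\<^sub>R sel_resid T S (\<sigma> H) H c a)"

text \<open>
  In a selection domain the constant \<open>C_H\<close> is only required to be nonnegative: since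
  \<open>C_H \<le> C_s \<parallel>H\<parallel>\<close>, it has to vanish for \<open>H = 0\<close>.
\<close>

definition selection_domain ::
    "real \<Rightarrow> (real \<Rightarrow> 'a \<Rightarrow> 'a) \<Rightarrow> 'a::real_vector set \<Rightarrow> ('a \<Rightarrow> real) \<Rightarrow> real \<Rightarrow> real \<Rightarrow> real
       \<Rightarrow> ((real \<times> real \<times> real \<Rightarrow> 'a) \<Rightarrow> 'a splitting) \<Rightarrow> (real \<times> real \<times> real \<Rightarrow> 'a) set \<Rightarrow> bool" where
  "selection_domain T S V N C_star \<eta> C_s \<sigma> D \<longleftrightarrow>
     D \<subseteq> ZC1 T S V N \<and>
     (\<lambda>p. 0) \<in> D \<and>
     (\<forall>H\<in>D. \<forall>K\<in>D. (\<lambda>p. H p + K p) \<in> D) \<and>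
     (\<forall>H\<in>D. \<forall>r. (\<lambda>p. r *\<^sub>R H p) \<in> D) \<and>
     linear_rule T S \<sigma> D \<and>
     (\<forall>H\<in>D.
        splitting_rule T S V (\<sigma> H) H \<and>
        (\<exists>C_H\<ge>0. ennreal C_H \<le> ennreal C_s * norm3 T V N H \<and>
                  critical_estimate T S N C_H C_star \<eta> (\<sigma> H) H) \<and>
        residual_continuity T S N (\<sigma> H) H)"

definition extends_residual ::
    "real \<Rightarrow> (real \<Rightarrow> 'a \<Rightarrow> 'a) \<Rightarrow> 'a::real_vector set \<Rightarrow> ('a \<Rightarrow> real)
       \<Rightarrow> 'a splitting \<Rightarrow> (real \<times> real \<times> real \<Rightarrow> 'a) \<Rightarrow> (real \<times> real \<Rightarrow> 'a) \<Rightarrow> bool" where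
  "extends_residual T S V N \<sigma> H g \<longleftrightarrow>
     g \<in> cont_maps (Delta2 T) V N \<and>
     (\<forall>t\<in>dyadic_points T. \<forall>s\<in>dyadic_points T. s \<le> t \<longrightarrow> g (t, s) = sel_resid T S \<sigma> H t s)"

definition continuous_linear_selection ::
    "real \<Rightarrow> 'a::real_vector set \<Rightarrow> ('a \<Rightarrow> real) \<Rightarrow> (real \<times> real \<times> real \<Rightarrow> 'a) set
       \<Rightarrow> ((real \<times> real \<times> real \<Rightarrow> 'a) \<Rightarrow> (real \<times> real \<Rightarrow> 'a)) \<Rightarrow> bool" where
  "continuous_linear_selection T V N D \<Lambda> \<longleftrightarrow>
     \<Lambda> ` D \<subseteq> C1_log T V N \<and>
     (\<forall>H\<in>D. \<forall>K\<in>D. \<Lambda> (\<lambda>p. H p + K p) = (\<lambda>q. \<Lambda> H q + \<Lambda> K q)) \<and>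
     (\<forall>H\<in>D. \<forall>r. \<Lambda> (\<lambda>p. r *\<^sub>R H p) = (\<lambda>q. r *\<^sub>R \<Lambda> H q)) \<and>
     (\<forall>H\<in>D. \<forall>e>0. \<exists>d>0. \<forall>K\<in>D. norm3 T V N (\<lambda>p. K p - H p) < d
        \<longrightarrow> norm_log T N (\<lambda>q. \<Lambda> K q - \<Lambda> H q) < e)"

end

theory Submission
  imports Defs
begin

text \<open>
  Closedness of \<open>H\<close>, read at base point \<open>0\<close>, says that $B^H$ is a primitive of \<open>H\<close>, and the
  coboundary \<open>- I t + S (t - s) (I s)\<close> of a path is annihilated by $\hat\delta$. Hence the residual
  \<open>R\<close> has defect \<open>H\<close> on dyadic triples whatever the splitting rule does (\<open>R_chain\<close>), and the
  children chosen by the rule are the residuals on the two halves (\<open>R_children\<close>). What remains is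
  an estimate and an extension.

  On dyadic intervals of length \<open>L\<close>, the critical admissibility estimate says that norm divided
  by length grows, from one level to the next, by at most the factor \<open>1 + 2 C L\<^sup>\<eta>\<close> plus a
  constant. The product of these factors converges and the recursion starts from \<open>R T 0 = 0\<close>, so
  at level \<open>n\<close> the residual is at most a multiple of \<open>n L\<close> (\<open>interval_bound\<close>). A general dyadic
  pair is split, around a dyadic point in between, into intervals of geometrically decreasing
  lengths; the chain rule adds their residuals, and the defects it creates form a geometric sum
  because \<open>N (H (t, u, s)) \<le> \<parallel>H\<parallel> (t - s)\<close>. Up to constants, everything is dominated by the coarsest
  level \<open>n\<close>, which is at most a multiple of \<open>1 + \<bar>ln (t - s)\<bar>\<close>: this is the logarithmic loss
  (\<open>pair_bound\<close>, \<open>log_bound\<close>).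

  All this needs one bound \<open>M\<close> for \<open>S t\<close>, \<open>0 \<le> t \<le> T\<close>, on a single space. The smoothing
  estimates of the scale degenerate as \<open>t\<close> tends to \<open>0\<close>, so \<open>M\<close> is obtained from strong continuity
  and the uniform boundedness principle (\<open>semigroup_locally_bounded\<close>).

  By the chain rule, moving the times of a dyadic pair changes \<open>R\<close> by residuals and defects over
  short intervals and by \<open>(S h - Id) R\<close>. The logarithmic bound, the finiteness of the norm of \<open>H\<close>
  and the residual continuity criterion make these uniformly small, so \<open>R\<close> extends to the simplex
  (\<open>dyadic_extension\<close>), uniquely by density, and the bound and $\hat\delta R = H$ pass to the limit.

  Finally, linearity of the rule concerns dyadic intervals only. The difference of the two sides of
  a linearity relation has zero defect and vanishes on dyadic intervals, hence on all dyadic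
  pairs (\<open>dyadic_cocycle_zero\<close>) and by continuity everywhere; the bounds then give continuity of
  the selection operator.
\<close>

section \<open>Banach spaces and semigroups on a subspace\<close>

lemma bounded_operator_on_mem:
  "bounded_operator_on V N L \<Longrightarrow> x \<in> V \<Longrightarrow> L x \<in> V"
  by (auto simp: bounded_operator_on_def)

locale banach_subspace =
  fixes V :: "'a::real_vector set" and N :: "'a \<Rightarrow> real"
  assumes banach: "banach_on V N"
begin

lemma subspace_V: "subspace V"
  using banach by (simp add: banach_on_def)

lemma mem_add [simp, intro]: "x \<in> V \<Longrightarrow> y \<in> V \<Longrightarrow> x + y \<in> V"
  and mem_diff [simp, intro]: "x \<in> V \<Longrightarrow> y \<in> V \<Longrightarrow> x - y \<in> V"
  and mem_minus [simp, intro]: "x \<in> V \<Longrightarrow> - x \<in> V"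
  and mem_scale [simp, intro]: "x \<in> V \<Longrightarrow> c *\<^sub>R x \<in> V"
  and mem_zero [simp, intro]: "0 \<in> V"
  using subspace_V
  by (simp_all add: subspace_add subspace_diff subspace_neg subspace_scale subspace_0)

lemma mem_sum: "(\<And>i. i \<in> I \<Longrightarrow> f i \<in> V) \<Longrightarrow> sum f I \<in> V"
  using subspace_V by (rule subspace_sum)

lemma N_nonneg [simp]: "x \<in> V \<Longrightarrow> 0 \<le> N x"
  and N_eq_0: "x \<in> V \<Longrightarrow> N x = 0 \<longleftrightarrow> x = 0"
  and N_scale: "x \<in> V \<Longrightarrow> N (c *\<^sub>R x) = \<bar>c\<bar> * N x"
  and N_triangle: "x \<in> V \<Longrightarrow> y \<in> V \<Longrightarrow> N (x + y) \<le> N x + N y"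
  using banach by (simp_all add: banach_on_def)

lemma N_zero [simp]: "N 0 = 0"
  by (simp add: N_eq_0)

lemma N_minus: "x \<in> V \<Longrightarrow> N (- x) = N x"
  using N_scale [of x "-1"] by simp

lemma N_diff_commute: "x \<in> V \<Longrightarrow> y \<in> V \<Longrightarrow> N (x - y) = N (y - x)"
  using N_minus [of "x - y"] by simp

lemma N_diff_le: "x \<in> V \<Longrightarrow> y \<in> V \<Longrightarrow> N (x - y) \<le> N x + N y"
  using N_triangle [of x "- y"] by (simp add: N_minus)

lemma N_triangle3:
  "x \<in> V \<Longrightarrow> y \<in> V \<Longrightarrow> z \<in> V \<Longrightarrow> N (x + y + z) \<le> N x + N y + N z"
  using N_triangle [of "x + y" z] N_triangle [of x y] by simp

lemma N_triangle_sub: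
  "x \<in> V \<Longrightarrow> y \<in> V \<Longrightarrow> z \<in> V \<Longrightarrow> N (x - z) \<le> N (x - y) + N (y - z)"
  using N_triangle [of "x - y" "y - z"] by simp

lemma N_le_add_diff: "x \<in> V \<Longrightarrow> y \<in> V \<Longrightarrow> N x \<le> N y + N (x - y)"
  using N_triangle [of y "x - y"] by simp

lemma N_sum: "finite I \<Longrightarrow> (\<And>i. i \<in> I \<Longrightarrow> f i \<in> V) \<Longrightarrow> N (sum f I) \<le> (\<Sum>i\<in>I. N (f i))"
proof (induction I rule: finite_induct)
  case (insert i I)
  have "N (sum f (insert i I)) \<le> N (f i) + N (sum f I)"
    using insert by (simp add: N_triangle mem_sum)
  also have "\<dots> \<le> (\<Sum>i\<in>insert i I. N (f i))"
    using insert by simp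
  finally show ?case .
qed simp

lemma complete_V:
  assumes "\<And>n. X n \<in> V" and "\<And>e. e > 0 \<Longrightarrow> \<exists>M. \<forall>m\<ge>M. \<forall>n\<ge>M. N (X m - X n) < e"
  obtains x where "x \<in> V" "(\<lambda>n. N (X n - x)) \<longlonglongrightarrow> 0"
proof -
  have "range X \<subseteq> V \<and> (\<forall>e>0. \<exists>M. \<forall>m\<ge>M. \<forall>n\<ge>M. N (X m - X n) < e)"
    using assms by auto
  then have "\<exists>x\<in>V. (\<lambda>n. N (X n - x)) \<longlonglongrightarrow> 0"
    using banach unfolding banach_on_def by blast
  with that show thesis by blast
qed

lemma N_tendsto:
  assumes "\<And>n. X n \<in> V" "x \<in> V" "(\<lambda>n. N (X n - x)) \<longlonglongrightarrow> 0"
  shows "(\<lambda>n. N (X n)) \<longlonglongrightarrow> N x"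
proof (rule Lim_transform_bound [where f = "\<lambda>n. N (X n) - N x", THEN LIM_zero_cancel, OF _ assms(3)])
  show "\<forall>\<^sub>F n in sequentially. norm (N (X n) - N x) \<le> norm (N (X n - x))"
  proof (intro always_eventually allI)
    fix n
    have "N (X n) \<le> N x + N (X n - x)" "N x \<le> N (X n) + N (X n - x)"
      using N_le_add_diff [of "X n" x] N_le_add_diff [of x "X n"] assms(1,2)
      by (simp_all add: N_diff_commute)
    then show "norm (N (X n) - N x) \<le> norm (N (X n - x))" by simp
  qed
qed

lemma limit_unique:
  assumes "\<And>n. X n \<in> V" "x \<in> V" "y \<in> V"
    and "(\<lambda>n. N (X n - x)) \<longlonglongrightarrow> 0" "(\<lambda>n. N (X n - y)) \<longlonglongrightarrow> 0"
  shows "x = y"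
proof -
  have "(\<lambda>n. N ((X n - x) - (X n - y))) \<longlonglongrightarrow> 0"
  proof (rule Lim_null_comparison)
    show "\<forall>\<^sub>F n in sequentially. norm (N ((X n - x) - (X n - y))) \<le> N (X n - x) + N (X n - y)"
    proof (intro always_eventually allI)
      fix n
      have "X n - x \<in> V" "X n - y \<in> V" using assms(1-3) by auto
      then show "norm (N ((X n - x) - (X n - y))) \<le> N (X n - x) + N (X n - y)"
        using N_diff_le [of "X n - x" "X n - y"] mem_diff [of "X n - x" "X n - y"]
        by (simp del: add_diff_cancel diff_diff_eq2 diff_diff_add)
    qed
    show "(\<lambda>n. N (X n - x) + N (X n - y)) \<longlonglongrightarrow> 0"
      using tendsto_add [OF assms(4,5)] by simp
  qed
  then have "N (y - x) = 0" by (simp add: tendsto_const_iff)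
  then show ?thesis using assms(2,3) by (auto simp: N_eq_0)
qed

text \<open>
  The sets \<open>{x. \<forall>n. N (L n x) \<le> k}\<close> are closed and cover \<open>V\<close>, so by Baire one of them
  contains a ball, and a bound on a ball scales to a bound on operator norms.
\<close>

lemma uniform_boundedness:
  assumes L: "\<And>n::nat. bounded_operator_on V N (L n)"
    and pointwise: "\<And>x. x \<in> V \<Longrightarrow> \<exists>K. \<forall>n. N (L n x) \<le> K"
  obtains K where "\<And>n x. x \<in> V \<Longrightarrow> N (L n x) \<le> K * N x"
proof -
  define d where "d x y = (if x \<in> V \<and> y \<in> V then N (x - y) else 0)" for x y
  interpret Metric_space V d
    by unfold_locales (auto simp: d_def N_diff_commute N_eq_0 intro: N_triangle_sub)
  have LV: "L n x \<in> V" if "x \<in> V" for n x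
    using L that by (rule bounded_operator_on_mem)
  have L_add: "L n (x + y) = L n x + L n y" if "x \<in> V" "y \<in> V" for n x y
    using L that by (auto simp: bounded_operator_on_def)
  have L_scale: "L n (c *\<^sub>R x) = c *\<^sub>R L n x" if "x \<in> V" for n x c
    using L that by (auto simp: bounded_operator_on_def)
  have L_diff: "L n (x - y) = L n x - L n y" if "x \<in> V" "y \<in> V" for n x y
    using L_add [of x "-1 *\<^sub>R y"] L_scale [of y n "-1"] that by simp
  have complete: mcomplete
    unfolding mcomplete_def
  proof (intro allI impI)
    fix X assume X: "MCauchy X"
    then have XV: "X n \<in> V" for n
      by (auto simp: MCauchy_def)
    have "\<exists>M. \<forall>m\<ge>M. \<forall>n\<ge>M. N (X m - X n) < e" if "e > 0" for e
      using X that XV unfolding MCauchy_def d_def by auto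
    then obtain x where "x \<in> V" "(\<lambda>n. N (X n - x)) \<longlonglongrightarrow> 0"
      using complete_V XV by blast
    then have "limitin mtopology X x sequentially"
      using XV by (auto simp: limit_metric_sequentially d_def LIMSEQ_iff)
    then show "\<exists>x. limitin mtopology X x sequentially" by blast
  qed
  define E where "E k = {x \<in> V. \<forall>n. N (L n x) \<le> real k}" for k :: nat
  have E_closed: "closedin mtopology (E k)" for k
    unfolding closedin_metric
  proof (intro conjI allI impI)
    show "E k \<subseteq> V" by (auto simp: E_def)
    fix x assume "x \<in> V - E k"
    then obtain n where x: "x \<in> V" and n: "real k < N (L n x)"
      by (auto simp: E_def not_le)
    obtain K where "\<forall>y\<in>V. N (L n y) \<le> K * N y"
      using L [of n] unfolding bounded_operator_on_def by blast
    then have K: "\<And>y. y \<in> V \<Longrightarrow> N (L n y) \<le> K * N y" by blast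
    define r where "r = (N (L n x) - real k) / (\<bar>K\<bar> + 1)"
    have "r > 0" using n by (simp add: r_def)
    moreover have "disjnt (E k) (mball x r)"
    proof -
      have False if y: "y \<in> E k" "y \<in> mball x r" for y
      proof -
        have yV: "y \<in> V" and "N (x - y) < r" "N (L n y) \<le> real k"
          using y x by (auto simp: E_def d_def)
        have "N (L n x) \<le> N (L n y) + N (L n (x - y))"
          using x yV N_le_add_diff [of "L n x" "L n y"] by (simp add: L_diff LV)
        also have "N (L n (x - y)) \<le> K * N (x - y)"
          using K x yV by simp
        also have "K * N (x - y) \<le> (\<bar>K\<bar> + 1) * N (x - y)"
          using x yV by (intro mult_right_mono) auto
        also have "\<dots> < (\<bar>K\<bar> + 1) * r"
          using \<open>N (x - y) < r\<close> by (intro mult_strict_left_mono) auto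
        also have "\<dots> = N (L n x) - real k"
          by (simp add: r_def)
        finally show False using \<open>N (L n y) \<le> real k\<close> by simp
      qed
      then show ?thesis unfolding disjnt_def by blast
    qed
    ultimately show "\<exists>r>0. disjnt (E k) (mball x r)" by blast
  qed
  have "\<Union>(range E) = V"
  proof
    show "V \<subseteq> \<Union>(range E)"
    proof
      fix x assume x: "x \<in> V"
      then obtain K where "\<forall>n. N (L n x) \<le> K" using pointwise by blast
      moreover obtain k where "K \<le> real k" using real_arch_simple by blast
      ultimately have "x \<in> E k" using x order_trans by (fastforce simp: E_def)
      then show "x \<in> \<Union>(range E)" by blast
    qed
  qed (auto simp: E_def)
  moreover have "mtopology interior_of V \<noteq> {}"
    by (metis mem_zero empty_iff interior_of_topspace topspace_mtopology)
  ultimately have "\<not> (\<forall>k. mtopology interior_of (E k) = {})"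
    using metric_Baire_category_alt [OF complete, of "range E"] E_closed by auto
  then obtain k x where "x \<in> mtopology interior_of (E k)" by blast
  then obtain r where x: "x \<in> V" and r: "r > 0" and sub: "mcball x r \<subseteq> E k"
    by (auto simp: in_interior_of_mcball)
  have "N (L n y) \<le> (2 * real k / r) * N y" if y: "y \<in> V" for n y
  proof (cases "y = 0")
    case True
    then show ?thesis using L_scale [of 0 n 0] by simp
  next
    case False
    then have Ny: "N y > 0" using y N_eq_0 [of y] N_nonneg [of y] by linarith
    define z where "z = (r / N y) *\<^sub>R y"
    have zV: "z \<in> V" using y by (simp add: z_def)
    have "N z = r" using y Ny r by (simp add: z_def N_scale)
    then have "x + z \<in> mcball x r" "x \<in> mcball x r"
      using x zV r N_minus [OF zV] by (auto simp: d_def)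
    with sub have b: "N (L n (x + z)) \<le> real k" "N (L n x) \<le> real k"
      by (auto simp: E_def)
    have "(r / N y) * N (L n y) = N (L n z)"
      using y r Ny by (simp add: z_def L_scale N_scale LV)
    also have "\<dots> = N (L n (x + z) - L n x)"
      using x zV by (simp add: L_add)
    also have "\<dots> \<le> 2 * real k"
      using b N_diff_le [of "L n (x + z)" "L n x"] x zV by (simp add: LV)
    finally show ?thesis using r Ny by (simp add: field_simps)
  qed
  with that show thesis by blast
qed

end

text \<open>
  If the operators were unbounded near \<open>0\<close>, some sequence \<open>S (t\<^sub>n)\<close> with
  \<open>t\<^sub>n \<longlonglongrightarrow> 0\<close> would have unbounded norms although it converges pointwise, against uniform
  boundedness; the semigroup law then carries a bound near \<open>0\<close> to bounded time intervals.
\<close>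

lemma semigroup_locally_bounded:
  fixes V :: "'a::real_vector set"
  assumes "banach_on V N" and S: "strongly_continuous_semigroup_on V N S"
  obtains M where "M \<ge> 1" "\<And>t x. 0 \<le> t \<Longrightarrow> t \<le> T \<Longrightarrow> x \<in> V \<Longrightarrow> N (S t x) \<le> M * N x"
proof -
  interpret banach_subspace V N by unfold_locales fact
  have op: "bounded_operator_on V N (S t)" if "t \<ge> 0" for t
    using S that by (simp add: strongly_continuous_semigroup_on_def)
  have SV: "S t x \<in> V" if "t \<ge> 0" "x \<in> V" for t x
    using op that bounded_operator_on_mem by blast
  have semigroup: "S (s + t) x = S s (S t x)" if "s \<ge> 0" "t \<ge> 0" "x \<in> V" for s t x
    using S that by (simp add: strongly_continuous_semigroup_on_def)
  have "\<exists>\<delta>>0. \<exists>K. \<forall>t. 0 < t \<and> t < \<delta> \<longrightarrow> (\<forall>x\<in>V. N (S t x) \<le> K * N x)"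
  proof (rule ccontr)
    assume *: "\<not> ?thesis"
    have "\<exists>t x. 0 < t \<and> t < 1 / real (Suc n) \<and> x \<in> V \<and> N (S t x) > real n * N x" for n
    proof -
      have "\<not> (\<exists>K. \<forall>t. 0 < t \<and> t < 1 / real (Suc n) \<longrightarrow> (\<forall>x\<in>V. N (S t x) \<le> K * N x))"
        using * by (metis of_nat_0_less_iff zero_less_Suc zero_less_divide_1_iff)
      then have "\<not> (\<forall>t. 0 < t \<and> t < 1 / real (Suc n) \<longrightarrow> (\<forall>x\<in>V. N (S t x) \<le> real n * N x))"
        by blast
      then show ?thesis by (metis not_le)
    qed
    then obtain \<tau> where \<tau>: "\<And>n. 0 < \<tau> n" "\<And>n. \<tau> n < 1 / real (Suc n)"
      and big: "\<And>n. \<exists>x\<in>V. N (S (\<tau> n) x) > real n * N x"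
      by metis
    have \<tau>0: "\<tau> \<longlonglongrightarrow> 0"
      by (rule tendsto_sandwich [OF _ _ tendsto_const LIMSEQ_inverse_real_of_nat])
        (use \<tau> in \<open>auto simp: inverse_eq_divide less_imp_le intro!: always_eventually\<close>)
    have lim: "filterlim \<tau> (at_right 0) sequentially"
      using \<tau>0 \<tau>(1) by (auto simp: filterlim_at intro!: always_eventually less_imp_neq [THEN not_sym])
    have "\<exists>K. \<forall>n. N (S (\<tau> n) x) \<le> K" if x: "x \<in> V" for x
    proof -
      have "((\<lambda>t. N (S t x - x)) \<longlongrightarrow> 0) (at_right 0)"
        using S x by (simp add: strongly_continuous_semigroup_on_def)
      then have "(\<lambda>n. N (S (\<tau> n) x - x)) \<longlonglongrightarrow> 0"
        using lim by (rule filterlim_compose)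
      then have "(\<lambda>n. N (S (\<tau> n) x)) \<longlonglongrightarrow> N x"
        using x SV \<tau>(1) by (intro N_tendsto) (auto simp: less_imp_le)
      then have "Bseq (\<lambda>n. N (S (\<tau> n) x))" by (intro convergent_imp_Bseq convergentI)
      then show ?thesis by (auto simp: Bseq_def intro: abs_le_D1)
    qed
    then obtain K where K: "\<And>n x. x \<in> V \<Longrightarrow> N (S (\<tau> n) x) \<le> K * N x"
      using uniform_boundedness [of "\<lambda>n. S (\<tau> n)"] op \<tau>(1) less_imp_le by metis
    obtain n where n: "K \<le> real n" using real_arch_simple by blast
    obtain x where "x \<in> V" "N (S (\<tau> n) x) > real n * N x" using big by blast
    moreover from this have "K * N x \<le> real n * N x" using n by (intro mult_right_mono) auto
    ultimately show False using K [of x n] by simp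
  qed
  then obtain \<delta> K where \<delta>: "\<delta> > 0" and K: "\<And>t x. 0 < t \<Longrightarrow> t < \<delta> \<Longrightarrow> x \<in> V \<Longrightarrow> N (S t x) \<le> K * N x"
    by blast
  define K' where "K' = max 1 K"
  have K': "N (S t x) \<le> K' * N x" if "0 \<le> t" "t < \<delta>" "x \<in> V" for t x
  proof (cases "t = 0")
    case True
    then have "S t x = x" using S that by (simp add: strongly_continuous_semigroup_on_def)
    then show ?thesis using that mult_right_mono [of 1 K' "N x"] by (simp add: K'_def)
  next
    case False
    then have "N (S t x) \<le> K * N x" using K that by simp
    also have "\<dots> \<le> K' * N x" using that by (intro mult_right_mono) (auto simp: K'_def)
    finally show ?thesis .
  qed
  have iter: "N (S (real m * t) x) \<le> K' ^ m * N x" if "0 \<le> t" "t < \<delta>" "x \<in> V" for t x m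
  proof (induction m)
    case 0
    show ?case using that S by (simp add: strongly_continuous_semigroup_on_def)
  next
    case (Suc m)
    have "S (real (Suc m) * t) x = S t (S (real m * t) x)"
      using semigroup [of t "real m * t" x] that by (simp add: algebra_simps)
    also have "N \<dots> \<le> K' * N (S (real m * t) x)"
      using that SV by (intro K') auto
    also have "\<dots> \<le> K' * (K' ^ m * N x)"
      using Suc by (intro mult_left_mono) (auto simp: K'_def)
    finally show ?case by (simp add: mult.assoc)
  qed
  obtain m where m: "T / \<delta> < real m" using reals_Archimedean2 by blast
  have bound: "N (S t x) \<le> K' ^ m * N x" if t: "0 \<le> t" "t \<le> T" and x: "x \<in> V" for t x
  proof -
    have "0 \<le> T / \<delta>" using t \<delta> by simp
    then have m0: "0 < real m" using m by linarith
    have "t < \<delta> * real m" using m \<delta> t by (simp add: field_simps)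
    then have "t / real m < \<delta>" using m0 by (simp add: field_simps)
    then show ?thesis using iter [of "t / real m" x m] t x m0 by simp
  qed
  have "K' ^ m \<ge> 1" by (simp add: K'_def)
  from that [OF this bound] show thesis by blast
qed

section \<open>Dyadic points\<close>

locale time_interval =
  fixes T :: real
  assumes T_pos: "0 < T"
begin

lemma level_le: "x \<in> dyadic_level T n \<Longrightarrow> 0 \<le> x" "x \<in> dyadic_level T n \<Longrightarrow> x \<le> T"
proof -
  assume "x \<in> dyadic_level T n"
  then obtain k where k: "x = real k * T / 2 ^ n" "k \<le> 2 ^ n"
    by (auto simp: dyadic_level_def)
  have "real k \<le> 2 ^ n" using k(2) by (metis of_nat_le_iff of_nat_numeral of_nat_power)
  then have "real k * T \<le> 2 ^ n * T" using T_pos by (intro mult_right_mono) auto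
  then show "x \<le> T" unfolding k by (simp add: divide_le_eq mult.commute)
  show "0 \<le> x" unfolding k using T_pos by simp
qed

lemma level_bottom: "0 \<in> dyadic_level T n"
  unfolding dyadic_level_def by (auto intro!: exI [of _ 0])

lemma level_top: "T \<in> dyadic_level T n"
  unfolding dyadic_level_def by (auto intro!: exI [of _ "2 ^ n"])

lemma level_0: "dyadic_level T 0 = {0, T}"
  unfolding dyadic_level_def by (auto simp: le_Suc_eq intro: exI [of _ 0] exI [of _ 1])

lemma level_Suc: "dyadic_level T n \<subseteq> dyadic_level T (Suc n)"
proof
  fix x assume "x \<in> dyadic_level T n"
  then obtain k where "x = real k * T / 2 ^ n" "k \<le> 2 ^ n"
    by (auto simp: dyadic_level_def)
  then have "x = real (2 * k) * T / 2 ^ Suc n" "2 * k \<le> 2 ^ Suc n" by auto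
  then show "x \<in> dyadic_level T (Suc n)" unfolding dyadic_level_def by blast
qed

lemma level_mono: "m \<le> n \<Longrightarrow> dyadic_level T m \<subseteq> dyadic_level T n"
  by (rule lift_Suc_mono_le [of "dyadic_level T"]) (use level_Suc in auto)

lemma points_common_level:
  assumes "finite X" "X \<subseteq> dyadic_points T"
  obtains n where "X \<subseteq> dyadic_level T n"
proof -
  have "\<exists>n. X \<subseteq> dyadic_level T n"
    using assms
  proof (induction X rule: finite_induct)
    case (insert x X)
    then obtain m n where "X \<subseteq> dyadic_level T m" "x \<in> dyadic_level T n"
      by (auto simp: dyadic_points_def)
    then have "insert x X \<subseteq> dyadic_level T (max m n)"
      using level_mono [of m "max m n"] level_mono [of n "max m n"] by auto
    then show ?case by blast
  qed auto
  with that show thesis by blast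
qed

lemma level_subset_points: "dyadic_level T n \<subseteq> dyadic_points T"
  by (auto simp: dyadic_points_def)

lemma points_le: "x \<in> dyadic_points T \<Longrightarrow> 0 \<le> x" "x \<in> dyadic_points T \<Longrightarrow> x \<le> T"
  by (auto simp: dyadic_points_def intro: level_le)

lemma level_neighbours:
  assumes "x \<in> dyadic_level T n" "y \<in> dyadic_level T n" "x < y"
  shows "x + T / 2 ^ n \<in> dyadic_level T n" "y - T / 2 ^ n \<in> dyadic_level T n"
    and "x + T / 2 ^ n \<le> y"
    and "(x, x + T / 2 ^ n) \<in> dyadic_intervals T" "(y - T / 2 ^ n, y) \<in> dyadic_intervals T"
proof -
  obtain j k where j: "x = real j * T / 2 ^ n" "j \<le> 2 ^ n"
    and k: "y = real k * T / 2 ^ n" "k \<le> 2 ^ n"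
    using assms by (auto simp: dyadic_level_def)
  have jk: "j < k"
    using assms(3) T_pos unfolding j k by (simp add: divide_less_cancel)
  then obtain i where i: "k = Suc i" "j \<le> i" by (cases k) auto
  have x: "x + T / 2 ^ n = real (Suc j) * T / 2 ^ n"
    unfolding j by (simp add: field_simps)
  have y: "y - T / 2 ^ n = real i * T / 2 ^ n"
    unfolding k i by (simp add: field_simps)
  show "x + T / 2 ^ n \<in> dyadic_level T n"
    unfolding x dyadic_level_def using jk k(2) by (auto intro!: exI [of _ "Suc j"])
  show "y - T / 2 ^ n \<in> dyadic_level T n"
    unfolding y dyadic_level_def using i k(2) by (auto intro!: exI [of _ i])
  show "x + T / 2 ^ n \<le> y"
    unfolding x k i using i T_pos by (intro divide_right_mono mult_right_mono) auto
  show "(x, x + T / 2 ^ n) \<in> dyadic_intervals T"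
  proof -
    have "j < 2 ^ n" using jk k(2) by simp
    then show ?thesis unfolding x unfolding j dyadic_intervals_def by blast
  qed
  show "(y - T / 2 ^ n, y) \<in> dyadic_intervals T"
  proof -
    have "i < 2 ^ n" using i k(2) by simp
    then show ?thesis unfolding y unfolding k i dyadic_intervals_def by blast
  qed
qed

lemma intervalsE:
  assumes "(a, c) \<in> dyadic_intervals T"
  obtains n where "a \<in> dyadic_level T n" "c \<in> dyadic_level T n" "c = a + T / 2 ^ n"
    "(a + c) / 2 \<in> dyadic_level T (Suc n)" "(a + c) / 2 \<notin> dyadic_level T n"
    "(a + c) / 2 = a + T / 2 ^ Suc n" "(a + c) / 2 = c - T / 2 ^ Suc n"
proof -
  obtain n k where k: "a = real k * T / 2 ^ n" "c = real (Suc k) * T / 2 ^ n" "k < 2 ^ n"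
    using assms by (auto simp: dyadic_intervals_def)
  have mid: "(a + c) / 2 = real (2 * k + 1) * T / 2 ^ Suc n"
    unfolding k by (simp add: field_simps)
  have "(a + c) / 2 \<notin> dyadic_level T n"
  proof
    assume "(a + c) / 2 \<in> dyadic_level T n"
    then obtain j where "real (2 * k + 1) * T / 2 ^ Suc n = real j * T / 2 ^ n"
      unfolding mid by (auto simp: dyadic_level_def)
    moreover have "real j * T / 2 ^ n = real (2 * j) * T / 2 ^ Suc n"
      by simp
    ultimately have "real (2 * k + 1) * T / 2 ^ Suc n = real (2 * j) * T / 2 ^ Suc n"
      by (simp only:)
    then have "real (2 * k + 1) * T = real (2 * j) * T"
      by (subst (asm) divide_cancel_right) auto
    then have "real (2 * k + 1) = real (2 * j)"
      using T_pos by (simp only: mult_right_cancel)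
    then have "2 * k + 1 = 2 * j" by (simp only: of_nat_eq_iff)
    then show False by presburger
  qed
  moreover have "(a + c) / 2 \<in> dyadic_level T (Suc n)"
    unfolding mid dyadic_level_def using k(3) by (auto intro!: exI [of _ "2 * k + 1"])
  moreover have "a \<in> dyadic_level T n" "c \<in> dyadic_level T n"
  proof -
    have "k \<le> 2 ^ n" "Suc k \<le> 2 ^ n" using k(3) by auto
    then show "a \<in> dyadic_level T n" "c \<in> dyadic_level T n"
      unfolding k dyadic_level_def by blast+
  qed
  moreover have "c = a + T / 2 ^ n" "(a + c) / 2 = a + T / 2 ^ Suc n" "(a + c) / 2 = c - T / 2 ^ Suc n"
    unfolding k by (simp_all add: field_simps)
  ultimately show thesis using that by blast
qed

lemma level_refine:
  assumes "b \<in> dyadic_level T (Suc n)" "b \<notin> dyadic_level T n"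
  shows "(b - T / 2 ^ Suc n, b + T / 2 ^ Suc n) \<in> dyadic_intervals T"
    and "b - T / 2 ^ Suc n \<in> dyadic_level T n" "b + T / 2 ^ Suc n \<in> dyadic_level T n"
proof -
  obtain k where k: "b = real k * T / 2 ^ Suc n" "k \<le> 2 ^ Suc n"
    using assms by (auto simp: dyadic_level_def)
  have "odd k"
  proof
    assume "even k"
    then obtain j where "k = 2 * j" by blast
    then have "b = real j * T / 2 ^ n" "j \<le> 2 ^ n" using k by auto
    then show False using assms(2) by (auto simp: dyadic_level_def)
  qed
  then obtain j where j: "k = 2 * j + 1" by (metis oddE)
  then have a: "b - T / 2 ^ Suc n = real j * T / 2 ^ n"
    and c: "b + T / 2 ^ Suc n = real (Suc j) * T / 2 ^ n"
    using k by (simp_all add: field_simps)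
  have "j < 2 ^ n" using j k(2) by simp
  then show "(b - T / 2 ^ Suc n, b + T / 2 ^ Suc n) \<in> dyadic_intervals T"
    and "b - T / 2 ^ Suc n \<in> dyadic_level T n" "b + T / 2 ^ Suc n \<in> dyadic_level T n"
    unfolding a c dyadic_intervals_def dyadic_level_def by (auto simp del: of_nat_Suc)
qed

lemma level_ceiling:
  assumes "0 \<le> s" "s \<le> T"
  obtains v where "v \<in> dyadic_level T n" "s \<le> v" "v < s + T / 2 ^ n"
proof -
  define k where "k = nat \<lceil>s * 2 ^ n / T\<rceil>"
  have nonneg: "0 \<le> s * 2 ^ n / T" using assms T_pos by simp
  have "real k < s * 2 ^ n / T + 1" "s * 2 ^ n / T \<le> real k"
    unfolding k_def using nonneg by linarith+
  then have "real k * T < s * 2 ^ n + T" "s * 2 ^ n \<le> real k * T"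
    using T_pos by (simp_all add: field_simps)
  then have "s \<le> real k * T / 2 ^ n" "real k * T / 2 ^ n < s + T / 2 ^ n"
    by (simp_all add: field_simps)
  moreover have "k \<le> 2 ^ n"
  proof -
    have "s * 2 ^ n / T \<le> 2 ^ n" using assms T_pos by (simp add: field_simps)
    then show ?thesis unfolding k_def by (simp add: nat_le_iff ceiling_le_iff)
  qed
  ultimately show thesis using that [of "real k * T / 2 ^ n"] by (auto simp: dyadic_level_def)
qed

definition dfloor :: "nat \<Rightarrow> real \<Rightarrow> real" where
  "dfloor n t = real (nat \<lfloor>t * 2 ^ n / T\<rfloor>) * T / 2 ^ n"

lemma dfloor_mem: "t \<le> T \<Longrightarrow> dfloor n t \<in> dyadic_points T"
proof -
  assume t: "t \<le> T"
  have "t * 2 ^ n / T \<le> 2 ^ n" using t T_pos by (simp add: field_simps)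
  then have "nat \<lfloor>t * 2 ^ n / T\<rfloor> \<le> 2 ^ n" by (simp add: nat_le_iff floor_le_iff)
  then show ?thesis
    unfolding dfloor_def by (intro subsetD [OF level_subset_points [of n]]) (auto simp: dyadic_level_def)
qed

lemma dfloor_mono: "s \<le> t \<Longrightarrow> dfloor n s \<le> dfloor n t"
  unfolding dfloor_def using T_pos
  by (intro divide_right_mono mult_right_mono of_nat_mono nat_mono floor_mono) auto

lemma dfloor_close: "0 \<le> t \<Longrightarrow> \<bar>dfloor n t - t\<bar> \<le> T / 2 ^ n"
proof -
  assume t: "0 \<le> t"
  have "0 \<le> t * 2 ^ n / T" using t T_pos by simp
  then have "real (nat \<lfloor>t * 2 ^ n / T\<rfloor>) \<le> t * 2 ^ n / T"
    "t * 2 ^ n / T < real (nat \<lfloor>t * 2 ^ n / T\<rfloor>) + 1" by linarith+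
  then have "real (nat \<lfloor>t * 2 ^ n / T\<rfloor>) * T \<le> t * 2 ^ n"
    "t * 2 ^ n < real (nat \<lfloor>t * 2 ^ n / T\<rfloor>) * T + T"
    using T_pos by (simp_all add: field_simps)
  then have "dfloor n t \<le> t" "t \<le> dfloor n t + T / 2 ^ n"
    unfolding dfloor_def by (simp_all add: divide_le_eq le_divide_eq flip: add_divide_distrib)
  then show ?thesis by (simp add: abs_le_iff)
qed

lemma mesh_tendsto: "(\<lambda>n. T / 2 ^ n) \<longlonglongrightarrow> 0"
proof -
  have "(\<lambda>n. T * (1 / 2) ^ n) \<longlonglongrightarrow> T * 0"
    by (intro tendsto_mult tendsto_const LIMSEQ_power_zero) simp
  then show ?thesis by (simp add: power_divide)
qed

lemma dfloor_tendsto: "0 \<le> t \<Longrightarrow> (\<lambda>n. dfloor n t) \<longlonglongrightarrow> t"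
proof -
  assume "0 \<le> t"
  then have "\<forall>\<^sub>F n in sequentially. norm (dfloor n t - t) \<le> T / 2 ^ n"
    by (intro always_eventually allI) (simp add: dfloor_close)
  then have "(\<lambda>n. dfloor n t - t) \<longlonglongrightarrow> 0"
    by (rule Lim_null_comparison [OF _ mesh_tendsto])
  then show ?thesis by (rule LIM_zero_cancel)
qed

lemma mesh_comparable:
  assumes "0 < x" "x \<le> T"
  obtains n where "T / 2 ^ n \<le> x" "x < 2 * (T / 2 ^ n)"
proof -
  have "\<exists>n. T / 2 ^ n \<le> x"
    using eventually_happens [OF order_tendstoD(2) [OF mesh_tendsto assms(1)]]
    by (auto intro: less_imp_le)
  define n where "n = (LEAST n. T / 2 ^ n \<le> x)"
  have n: "T / 2 ^ n \<le> x" unfolding n_def using \<open>\<exists>n. T / 2 ^ n \<le> x\<close> by (rule LeastI_ex)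
  have "x < 2 * (T / 2 ^ n)"
  proof (cases n)
    case 0
    then show ?thesis using assms T_pos by simp
  next
    case (Suc m)
    then have "\<not> T / 2 ^ m \<le> x" unfolding n_def by (intro not_less_Least) simp
    then show ?thesis using Suc by simp
  qed
  with n that show thesis by blast
qed

end

section \<open>Defects of critical order\<close>

lemma (in banach_subspace) cont_maps_mem: "g \<in> cont_maps X V N \<Longrightarrow> p \<in> X \<Longrightarrow> g p \<in> V"
  by (simp add: cont_maps_def)

lemma (in banach_subspace) cont_maps_seq:
  fixes X :: "'b::t2_space set"
  assumes g: "g \<in> cont_maps X V N" and "\<And>n. q n \<in> X" "p \<in> X" "q \<longlonglongrightarrow> p"
  shows "(\<lambda>n. N (g (q n) - g p)) \<longlonglongrightarrow> 0"
proof -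
  have "continuous (at p within X) (\<lambda>q. N (g q - g p))"
    using g assms(3) by (simp add: cont_maps_def continuous_within)
  then have "(\<lambda>n. N (g (q n) - g p)) \<longlonglongrightarrow> N (g p - g p)"
    using assms by (intro continuous_within_tendsto_compose [where f = "\<lambda>q. N (g q - g p)"]) auto
  then show ?thesis by simp
qed

locale banach_interval = banach_subspace V N + time_interval T
  for V :: "'a::real_vector set" and N :: "'a \<Rightarrow> real" and T :: real
begin

text \<open>
  The seminorm only sees \<open>s < u < t\<close>. Every point of the closed simplex is a limit of such
  points, and the weight \<open>(t - u)\<^sup>\<rho> (u - s)\<^sup>1\<^sup>-\<^sup>\<rho>\<close> is continuous and vanishes on the boundary,
  so the bound extends and forces the increment to vanish for \<open>u \<in> {s, t}\<close>.
\<close>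

lemma norm3_split_bound:
  assumes h: "h \<in> cont_maps (Delta3 T) V N" and \<rho>: "0 < \<rho>" "\<rho> < 1"
    and fin: "norm3_split T N \<rho> h < \<infinity>" and p: "(t, u, s) \<in> Delta3 T"
  shows "N (h (t, u, s)) \<le> enn2real (norm3_split T N \<rho> h) * ((t - u) powr \<rho> * (u - s) powr (1 - \<rho>))"
    (is "_ \<le> ?c * _")
proof -
  have inner: "N (h (t, u, s)) \<le> ?c * ((t - u) powr \<rho> * (u - s) powr (1 - \<rho>))"
    if "0 \<le> s" "s < u" "u < t" "t \<le> T" for t u s
  proof -
    have "ennreal (N (h (t, u, s)) / (\<bar>t - u\<bar> powr \<rho> * \<bar>u - s\<bar> powr (1 - \<rho>))) \<le> norm3_split T N \<rho> h"
      unfolding norm3_split_def by (rule SUP_upper2 [of "(t, u, s)"]) (use that in auto)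
    also have "\<dots> = ennreal ?c"
      using fin by simp
    finally have "N (h (t, u, s)) / (\<bar>t - u\<bar> powr \<rho> * \<bar>u - s\<bar> powr (1 - \<rho>)) \<le> ?c"
      by (simp add: ennreal_le_iff)
    then show ?thesis using that by (simp add: divide_le_eq)
  qed
  \<comment> \<open>Moving towards the interior point \<open>(T, T / 2, 0)\<close> separates the three times.\<close>
  define l where "l n = inverse (real (Suc n))" for n
  have l: "0 < l n" "l n \<le> 1" for n by (auto simp: l_def field_simps)
  have l0: "l \<longlonglongrightarrow> 0" unfolding l_def by (rule LIMSEQ_inverse_real_of_nat)
  define t' where "t' n = t + l n * (T - t)" for n
  define u' where "u' n = u + l n * (T / 2 - u)" for n
  define s' where "s' n = s - l n * s" for n
  have lim: "t' \<longlonglongrightarrow> t" "u' \<longlonglongrightarrow> u" "s' \<longlonglongrightarrow> s"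
  proof -
    have "t' \<longlonglongrightarrow> t + 0 * (T - t)" "u' \<longlonglongrightarrow> u + 0 * (T / 2 - u)" "s' \<longlonglongrightarrow> s - 0 * s"
      unfolding t'_def u'_def s'_def by (intro tendsto_intros l0)+
    then show "t' \<longlonglongrightarrow> t" "u' \<longlonglongrightarrow> u" "s' \<longlonglongrightarrow> s" by simp_all
  qed
  have pts: "0 \<le> s' n" "s' n < u' n" "u' n < t' n" "t' n \<le> T" for n
  proof -
    have sut: "0 \<le> s" "s \<le> u" "u \<le> t" "t \<le> T" using p by (auto simp: Delta3_def)
    have "s' n = (1 - l n) * s" "u' n = (1 - l n) * u + l n * T / 2" "t' n = (1 - l n) * t + l n * T"
      by (auto simp: s'_def u'_def t'_def algebra_simps)
    moreover have "0 \<le> (1 - l n) * s" "(1 - l n) * s \<le> (1 - l n) * u" "(1 - l n) * u \<le> (1 - l n) * t"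
      "(1 - l n) * t \<le> (1 - l n) * T" using l [of n] sut by (auto intro: mult_left_mono)
    moreover have "(1 - l n) * T + l n * T = T" by (simp add: algebra_simps)
    moreover have "0 < l n * T" using l T_pos by simp
    ultimately show "0 \<le> s' n" "s' n < u' n" "u' n < t' n" "t' n \<le> T" by linarith+
  qed
  have mem: "(t' n, u' n, s' n) \<in> Delta3 T" for n
    using pts [of n] by (auto simp: Delta3_def)
  have "(\<lambda>n. N (h (t' n, u' n, s' n))) \<longlonglongrightarrow> N (h (t, u, s))"
    using mem p by (intro N_tendsto cont_maps_seq [OF h] cont_maps_mem [OF h] tendsto_Pair lim)
  moreover have "(\<lambda>n. ?c * ((t' n - u' n) powr \<rho> * (u' n - s' n) powr (1 - \<rho>)))
      \<longlonglongrightarrow> ?c * ((t - u) powr \<rho> * (u - s) powr (1 - \<rho>))"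
    using \<rho> pts by (intro tendsto_mult tendsto_const tendsto_powr' tendsto_diff lim)
      (auto intro!: always_eventually simp: less_imp_le)
  ultimately show ?thesis
    by (rule LIMSEQ_le) (auto intro!: inner pts)
qed

lemma weight_le:
  fixes x y :: real
  assumes "0 \<le> x" "0 \<le> y" "0 < \<rho>" "\<rho> < 1"
  shows "x powr \<rho> * y powr (1 - \<rho>) \<le> x + y"
proof -
  have "x powr \<rho> * y powr (1 - \<rho>) \<le> (x + y) powr \<rho> * (x + y) powr (1 - \<rho>)"
    using assms by (intro mult_mono powr_mono2) auto
  also have "\<dots> = x + y"
    using assms by (cases "x + y = 0") (simp_all flip: powr_add)
  finally show ?thesis .
qed

lemma norm3_decomposition_bound:
  fixes m :: nat and \<rho> :: "nat \<Rightarrow> real"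
  assumes h: "\<And>j. j \<in> {1..m} \<Longrightarrow> 0 < \<rho> j \<and> \<rho> j < 1 \<and> h j \<in> cont_maps (Delta3 T) V N"
    and H: "\<And>p. H p = (\<Sum>j = 1..m. h j p)"
    and fin: "(\<Sum>j = 1..m. norm3_split T N (\<rho> j) (h j)) < \<infinity>"
    and p: "(t, u, s) \<in> Delta3 T"
  shows "N (H (t, u, s)) \<le>
    (\<Sum>j = 1..m. enn2real (norm3_split T N (\<rho> j) (h j)) * ((t - u) powr \<rho> j * (u - s) powr (1 - \<rho> j)))"
proof -
  have "N (H (t, u, s)) \<le> (\<Sum>j = 1..m. N (h j (t, u, s)))"
    unfolding H using h p by (intro N_sum) (auto intro: cont_maps_mem)
  also have "\<dots> \<le> (\<Sum>j = 1..m. enn2real (norm3_split T N (\<rho> j) (h j)) *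
      ((t - u) powr \<rho> j * (u - s) powr (1 - \<rho> j)))"
  proof (rule sum_mono)
    fix j assume j: "j \<in> {1..m}"
    have "norm3_split T N (\<rho> j) (h j) < \<infinity>"
      using fin j by simp
    then show "N (h j (t, u, s)) \<le> enn2real (norm3_split T N (\<rho> j) (h j)) *
        ((t - u) powr \<rho> j * (u - s) powr (1 - \<rho> j))"
      using h [OF j] p by (intro norm3_split_bound) auto
  qed
  finally show ?thesis .
qed

lemma norm3_decomposition:
  assumes "norm3 T V N H < \<infinity>"
  obtains m :: nat and \<rho> h where
    "\<And>j. j \<in> {1..m} \<Longrightarrow> 0 < \<rho> j \<and> \<rho> j < 1 \<and> h j \<in> cont_maps (Delta3 T) V N"
    "\<And>p. H p = (\<Sum>j = 1..m. h j p)" "(\<Sum>j = 1..m. norm3_split T N (\<rho> j) (h j)) < \<infinity>"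
proof -
  obtain w where w: "w < \<infinity>" "w \<in> {(\<Sum>j = 1..m. norm3_split T N (\<rho> j) (h j)) | (m::nat) \<rho> h.
            (\<forall>j\<in>{1..m}. 0 < \<rho> j \<and> \<rho> j < 1 \<and> h j \<in> cont_maps (Delta3 T) V N) \<and>
            (\<forall>p. H p = (\<Sum>j = 1..m. h j p))}"
    using assms unfolding norm3_def Inf_less_iff by blast
  then obtain m :: nat and \<rho> h where
    "\<forall>j\<in>{1..m}. 0 < \<rho> j \<and> \<rho> j < 1 \<and> h j \<in> cont_maps (Delta3 T) V N"
    "\<forall>p. H p = (\<Sum>j = 1..m. h j p)" "w = (\<Sum>j = 1..m. norm3_split T N (\<rho> j) (h j))"
    by blast
  with w(1) that show thesis by blast
qed

text \<open>
  Each weight is at most \<open>t - s\<close>, whatever its exponent; this scale invariant consequence is the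
  only quantitative information on the defect that enters the estimates.
\<close>

lemma norm3_bound:
  assumes "norm3 T V N H < \<infinity>" and p: "(t, u, s) \<in> Delta3 T"
  shows "N (H (t, u, s)) \<le> enn2real (norm3 T V N H) * (t - s)"
proof -
  have sut: "0 \<le> s" "s \<le> u" "u \<le> t" "t \<le> T" using p by (auto simp: Delta3_def)
  have each: "N (H (t, u, s)) \<le> enn2real (\<Sum>j = 1..m. norm3_split T N (\<rho> j) (h j)) * (t - s)"
    if h: "\<And>j. j \<in> {1..m} \<Longrightarrow> 0 < \<rho> j \<and> \<rho> j < 1 \<and> h j \<in> cont_maps (Delta3 T) V N"
      and H: "\<And>p. H p = (\<Sum>j = 1..m. h j p)"
      and fin: "(\<Sum>j = 1..m. norm3_split T N (\<rho> j) (h j)) < \<infinity>" for m :: nat and \<rho> h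
  proof -
    have "N (H (t, u, s)) \<le> (\<Sum>j = 1..m. enn2real (norm3_split T N (\<rho> j) (h j)) *
        ((t - u) powr \<rho> j * (u - s) powr (1 - \<rho> j)))"
      using h H fin p by (rule norm3_decomposition_bound)
    also have "\<dots> \<le> (\<Sum>j = 1..m. enn2real (norm3_split T N (\<rho> j) (h j)) * (t - s))"
    proof (intro sum_mono mult_left_mono)
      fix j assume "j \<in> {1..m}"
      then show "(t - u) powr \<rho> j * (u - s) powr (1 - \<rho> j) \<le> t - s"
        using weight_le [of "t - u" "u - s" "\<rho> j"] h [of j] sut by simp
    qed auto
    also have "\<dots> = enn2real (\<Sum>j = 1..m. norm3_split T N (\<rho> j) (h j)) * (t - s)"
      using fin by (subst enn2real_sum) (auto simp: sum_distrib_right)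
    finally show ?thesis .
  qed
  show ?thesis
  proof (cases "t = s")
    case True
    obtain m :: nat and \<rho> h where
      "\<And>j. j \<in> {1..m} \<Longrightarrow> 0 < \<rho> j \<and> \<rho> j < 1 \<and> h j \<in> cont_maps (Delta3 T) V N"
      "\<And>p. H p = (\<Sum>j = 1..m. h j p)" "(\<Sum>j = 1..m. norm3_split T N (\<rho> j) (h j)) < \<infinity>"
      using norm3_decomposition [OF assms(1)] by blast
    from each [OF this] True show ?thesis by simp
  next
    case False
    then have ts: "0 < t - s" using sut by simp
    have "ennreal (N (H (t, u, s)) / (t - s)) \<le> norm3 T V N H"
      unfolding norm3_def
    proof (rule Inf_greatest, clarify)
      fix m :: nat and \<rho> :: "nat \<Rightarrow> real" and h
      assume h: "\<forall>j\<in>{1..m}. 0 < \<rho> j \<and> \<rho> j < 1 \<and> h j \<in> cont_maps (Delta3 T) V N"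
        and H: "\<forall>p. H p = (\<Sum>j = 1..m. h j p)"
      show "ennreal (N (H (t, u, s)) / (t - s)) \<le> (\<Sum>j = 1..m. norm3_split T N (\<rho> j) (h j))" (is "_ \<le> ?w")
      proof (cases "?w < \<infinity>")
        case True
        then have "N (H (t, u, s)) / (t - s) \<le> enn2real ?w"
          using each [of m \<rho> h] h H ts by (simp add: divide_le_eq)
        then have "ennreal (N (H (t, u, s)) / (t - s)) \<le> ennreal (enn2real ?w)"
          by (rule ennreal_leI)
        also have "\<dots> = ?w" using True by simp
        finally show ?thesis .
      next
        case False
        then have "?w = top" by (metis infinity_ennreal_def less_top)
        then show ?thesis by (simp only: top_greatest)
      qed
    qed
    also have "\<dots> = ennreal (enn2real (norm3 T V N H))" using assms(1) by simp
    finally show ?thesis using ts by (simp add: ennreal_le_iff divide_le_eq)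
  qed
qed

text \<open>
  The seminorms in any one finite decomposition make the defect small once one of the two
  adjacent intervals is short, uniformly in the other.
\<close>

lemma norm3_small:
  assumes "norm3 T V N H < \<infinity>" and "e > 0"
  obtains d where "d > 0"
    "\<And>t u s. (t, u, s) \<in> Delta3 T \<Longrightarrow> t - u < d \<or> u - s < d \<Longrightarrow> N (H (t, u, s)) < e"
proof -
  obtain m :: nat and \<rho> h where
    h: "\<And>j. j \<in> {1..m} \<Longrightarrow> 0 < \<rho> j \<and> \<rho> j < 1 \<and> h j \<in> cont_maps (Delta3 T) V N"
    and H: "\<And>p. H p = (\<Sum>j = 1..m. h j p)" and fin: "(\<Sum>j = 1..m. norm3_split T N (\<rho> j) (h j)) < \<infinity>"
    using norm3_decomposition [OF assms(1)] by blast
  define c where "c j = enn2real (norm3_split T N (\<rho> j) (h j))" for j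
  define \<omega> where "\<omega> d = (\<Sum>j = 1..m. c j * (d powr \<rho> j * T powr (1 - \<rho> j) + T powr \<rho> j * d powr (1 - \<rho> j)))"
    for d
  have "(\<omega> \<longlongrightarrow> (\<Sum>j = 1..m. c j * (0 powr \<rho> j * T powr (1 - \<rho> j) + T powr \<rho> j * 0 powr (1 - \<rho> j)))) (at_right 0)"
    unfolding \<omega>_def
  proof (intro tendsto_sum tendsto_mult tendsto_add tendsto_const tendsto_powr' tendsto_ident_at)
    fix j assume "j \<in> {1..m}"
    from h [OF this] show "0 \<noteq> (0::real) \<or> 0 < \<rho> j \<and> (\<forall>\<^sub>F x in at_right 0. 0 \<le> (x::real))"
      "0 \<noteq> (0::real) \<or> 0 < 1 - \<rho> j \<and> (\<forall>\<^sub>F x in at_right 0. 0 \<le> (x::real))"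
      by (auto simp: eventually_at_filter)
  qed
  then have "(\<omega> \<longlongrightarrow> 0) (at_right 0)" by simp
  then have "\<forall>\<^sub>F d in at_right 0. \<omega> d < e"
    using assms(2) by (rule order_tendstoD)
  then have "\<forall>\<^sub>F d in at_right 0. \<omega> d < e \<and> 0 < d"
    by (intro eventually_conj eventually_at_right_less)
  then obtain d where d: "\<omega> d < e" "0 < d"
    using eventually_happens trivial_limit_at_right_real by blast
  have "N (H (t, u, s)) < e" if p: "(t, u, s) \<in> Delta3 T" and close: "t - u < d \<or> u - s < d" for t u s
  proof -
    have sut: "0 \<le> s" "s \<le> u" "u \<le> t" "t \<le> T" using p by (auto simp: Delta3_def)
    have "N (H (t, u, s)) \<le> (\<Sum>j = 1..m. c j * ((t - u) powr \<rho> j * (u - s) powr (1 - \<rho> j)))"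
      unfolding c_def using h H fin p by (rule norm3_decomposition_bound)
    also have "\<dots> \<le> \<omega> d"
      unfolding \<omega>_def
    proof (intro sum_mono mult_left_mono)
      fix j assume "j \<in> {1..m}"
      then have \<rho>: "0 < \<rho> j" "\<rho> j < 1" using h by auto
      show "(t - u) powr \<rho> j * (u - s) powr (1 - \<rho> j)
          \<le> d powr \<rho> j * T powr (1 - \<rho> j) + T powr \<rho> j * d powr (1 - \<rho> j)"
        using close
      proof
        assume "t - u < d"
        then have "(t - u) powr \<rho> j * (u - s) powr (1 - \<rho> j) \<le> d powr \<rho> j * T powr (1 - \<rho> j)"
          using sut \<rho> by (intro mult_mono powr_mono2) auto
        then show ?thesis by (rule order_trans) simp
      next
        assume "u - s < d"
        then have "(t - u) powr \<rho> j * (u - s) powr (1 - \<rho> j) \<le> T powr \<rho> j * d powr (1 - \<rho> j)"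
          using sut \<rho> by (intro mult_mono powr_mono2) auto
        then show ?thesis by (rule order_trans) simp
      qed
    qed (simp add: c_def)
    also note d(1)
    finally show ?thesis .
  qed
  with d(2) that show thesis by blast
qed

end

section \<open>The selected residual on dyadic pairs\<close>

locale semigroup_interval = banach_interval V N T
  for V :: "'a::real_vector set" and N :: "'a \<Rightarrow> real" and T :: real +
  fixes S :: "real \<Rightarrow> 'a \<Rightarrow> 'a" and M :: real
  assumes semigroup: "strongly_continuous_semigroup_on V N S"
    and M_ge_1: "1 \<le> M"
    and S_bound: "\<And>t x. 0 \<le> t \<Longrightarrow> t \<le> T \<Longrightarrow> x \<in> V \<Longrightarrow> N (S t x) \<le> M * N x"
begin

lemma S_mem [simp, intro]: "0 \<le> t \<Longrightarrow> x \<in> V \<Longrightarrow> S t x \<in> V"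
  and S_add: "0 \<le> t \<Longrightarrow> x \<in> V \<Longrightarrow> y \<in> V \<Longrightarrow> S t (x + y) = S t x + S t y"
  and S_scale: "0 \<le> t \<Longrightarrow> x \<in> V \<Longrightarrow> S t (c *\<^sub>R x) = c *\<^sub>R S t x"
  and S_0 [simp]: "x \<in> V \<Longrightarrow> S 0 x = x"
  and S_semigroup: "0 \<le> s \<Longrightarrow> 0 \<le> t \<Longrightarrow> x \<in> V \<Longrightarrow> S (s + t) x = S s (S t x)"
  and S_right_continuous: "x \<in> V \<Longrightarrow> ((\<lambda>t. N (S t x - x)) \<longlongrightarrow> 0) (at_right 0)"
  using semigroup bounded_operator_on_mem [of V N "S t"]
  by (auto simp: strongly_continuous_semigroup_on_def bounded_operator_on_def)

lemma S_zero [simp]: "0 \<le> t \<Longrightarrow> S t 0 = 0"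
  using S_scale [of t 0 0] by simp

lemma S_minus: "0 \<le> t \<Longrightarrow> x \<in> V \<Longrightarrow> S t (- x) = - S t x"
  using S_scale [of t x "-1"] by simp

lemma S_diff: "0 \<le> t \<Longrightarrow> x \<in> V \<Longrightarrow> y \<in> V \<Longrightarrow> S t (x - y) = S t x - S t y"
  using S_add [of t x "- y"] by (simp add: S_minus)

lemma ZC1_props:
  assumes "H \<in> ZC1 T S V N"
  shows "H \<in> cont_maps (Delta3 T) V N" "norm3 T V N H < \<infinity>"
    and "\<And>p. p \<in> Delta3 T \<Longrightarrow> H p \<in> V"
  using assms by (auto simp: ZC1_def intro: cont_maps_mem)

text \<open>The closedness of the defect at base point \<open>0\<close> says that \<open>BH H\<close> is a primitive of \<open>H\<close>.\<close>

lemma BH_chain: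
  assumes H: "H \<in> ZC1 T S V N" and sut: "0 \<le> s" "s \<le> u" "u \<le> t" "t \<le> T"
  shows "BH H t s = BH H t u + S (t - u) (BH H u s) + H (t, u, s)"
proof -
  have "(t, u, s, 0) \<in> Delta4 T" using sut by (simp add: Delta4_def)
  with H have "hdelta3 S H (t, u, s, 0) = 0"
    unfolding ZC1_def by blast
  then have "H (t, s, 0) - H (t, u, 0) + H (t, u, s) - S (t - u) (H (u, s, 0)) = 0"
    by (simp add: hdelta3_def)
  moreover have "S (t - u) (- H (u, s, 0)) = - S (t - u) (H (u, s, 0))"
    using sut ZC1_props(3) [OF H] by (intro S_minus) (auto simp: Delta3_def)
  ultimately show ?thesis
    unfolding BH_def by (simp add: algebra_simps)
qed

end

locale selected_residual = semigroup_interval V N T S M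
  for V :: "'a::real_vector set" and N :: "'a \<Rightarrow> real" and T :: real
    and S :: "real \<Rightarrow> 'a \<Rightarrow> 'a" and M :: real +
  fixes H :: "real \<times> real \<times> real \<Rightarrow> 'a" and \<sigma> :: "'a splitting"
  assumes H: "H \<in> ZC1 T S V N" and rule: "splitting_rule T S V \<sigma> H"
begin

definition I :: "real \<Rightarrow> 'a" where "I = sel_path T S \<sigma> H"
definition R :: "real \<Rightarrow> real \<Rightarrow> 'a" where "R = sel_resid T S \<sigma> H"

lemma R_eq: "R t s = BH H t s - I t + S (t - s) (I s)"
  by (simp add: R_def I_def sel_resid_def resid_def)

lemma H_mem: "0 \<le> s \<Longrightarrow> s \<le> u \<Longrightarrow> u \<le> t \<Longrightarrow> t \<le> T \<Longrightarrow> H (t, u, s) \<in> V"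
  using ZC1_props(3) [OF H] by (simp add: Delta3_def)

lemma BH_mem: "0 \<le> s \<Longrightarrow> s \<le> t \<Longrightarrow> t \<le> T \<Longrightarrow> BH H t s \<in> V"
  by (simp add: BH_def H_mem)

lemma path_at_stable: "t \<in> dyadic_level T n \<Longrightarrow> path_at T S \<sigma> H (n + k) t = path_at T S \<sigma> H n t"
proof (induction k)
  case (Suc k)
  have "t \<in> dyadic_level T (n + k)"
    using Suc.prems level_mono [of n "n + k"] by auto
  with Suc show ?case by simp
qed simp

lemma path_at_eq_I: "t \<in> dyadic_level T n \<Longrightarrow> path_at T S \<sigma> H n t = I t"
proof -
  assume t: "t \<in> dyadic_level T n"
  define m where "m = (LEAST n. t \<in> dyadic_level T n)"
  have "t \<in> dyadic_level T m" unfolding m_def using t by (rule LeastI)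
  moreover have "m \<le> n" unfolding m_def using t by (rule Least_le)
  ultimately show ?thesis
    using path_at_stable [of t m "n - m"] by (simp add: I_def sel_path_def m_def)
qed

lemma I_midpoint:
  assumes "(a, c) \<in> dyadic_intervals T" and b: "b = (a + c) / 2"
  shows "I b = BH H b a + S (b - a) (I a) - snd (\<sigma> a c (R c a))"
proof -
  obtain n where n: "a \<in> dyadic_level T n" "c \<in> dyadic_level T n" "b \<in> dyadic_level T (Suc n)"
    "b \<notin> dyadic_level T n" "b = a + T / 2 ^ Suc n" "b = c - T / 2 ^ Suc n"
    using intervalsE [OF assms(1)] unfolding b by metis
  have a: "b - T / 2 ^ Suc n = a" and c: "b + T / 2 ^ Suc n = c" using n by auto
  have "I b = path_at T S \<sigma> H (Suc n) b" by (rule path_at_eq_I [OF n(3), symmetric])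
  also have "\<dots> = BH H b a + S (b - a) (path_at T S \<sigma> H n a)
      - snd (\<sigma> a c (resid S H (path_at T S \<sigma> H n) c a))"
    using n(4) unfolding path_at.simps Let_def a c by simp
  also have "\<dots> = BH H b a + S (b - a) (I a) - snd (\<sigma> a c (R c a))"
    using n by (simp add: path_at_eq_I resid_def R_eq)
  finally show ?thesis .
qed

lemma rule_children:
  assumes "(a, c) \<in> dyadic_intervals T" and b: "b = (a + c) / 2"
  shows "fst (\<sigma> a c (R c a)) \<in> V" "snd (\<sigma> a c (R c a)) \<in> V"
    "R c a = fst (\<sigma> a c (R c a)) + S (c - b) (snd (\<sigma> a c (R c a))) + H (c, b, a)"
  using bspec [OF rule [unfolded splitting_rule_def] assms(1)]
  by (simp_all add: b Let_def case_prod_unfold flip: R_def)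

lemma I_mem_level: "b \<in> dyadic_level T n \<Longrightarrow> I b \<in> V"
proof (induction n arbitrary: b)
  case 0
  then have "b = 0 \<or> b = T" by (simp add: level_0)
  then show ?case
    using path_at_eq_I [OF 0] T_pos by (auto simp flip: path_at_eq_I [OF 0] intro: BH_mem)
next
  case (Suc n)
  show ?case
  proof (cases "b \<in> dyadic_level T n")
    case False
    note ac = level_refine [OF Suc.prems False]
    define a c where "a = b - T / 2 ^ Suc n" and "c = b + T / 2 ^ Suc n"
    have b: "b = (a + c) / 2" by (simp add: a_def c_def)
    have "a \<le> b" using T_pos by (simp add: a_def)
    moreover have "0 \<le> a" "b \<le> T"
      using level_le(1) [OF ac(2)] level_le(2) [OF Suc.prems] by (simp_all add: a_def)
    moreover have "I a \<in> V" using Suc.IH ac(2) by (simp add: a_def)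
    moreover have int: "(a, c) \<in> dyadic_intervals T" using ac(1) by (simp add: a_def c_def)
    ultimately show ?thesis
      unfolding I_midpoint [OF int b] by (intro mem_diff mem_add S_mem BH_mem rule_children(2) [OF int b]) auto
  qed (rule Suc.IH)
qed

lemma I_mem: "b \<in> dyadic_points T \<Longrightarrow> I b \<in> V"
  by (auto simp: dyadic_points_def intro: I_mem_level)

lemma R_mem: "t \<in> dyadic_points T \<Longrightarrow> s \<in> dyadic_points T \<Longrightarrow> s \<le> t \<Longrightarrow> R t s \<in> V"
  unfolding R_eq by (intro mem_diff mem_add S_mem BH_mem I_mem) (auto intro: points_le)

text \<open>
  The coboundary \<open>- I t + S (t - s) (I s)\<close> of the path is annihilated by $\hat\delta$, so \<open>R\<close>
  has the same defect as \<open>BH H\<close>.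
\<close>

lemma R_chain:
  assumes "s \<in> dyadic_points T" "u \<in> dyadic_points T" "t \<in> dyadic_points T" "s \<le> u" "u \<le> t"
  shows "R t s = R t u + S (t - u) (R u s) + H (t, u, s)"
proof -
  have pts: "0 \<le> s" "t \<le> T" using assms by (auto intro: points_le)
  have mem: "I u \<in> V" "I s \<in> V" "BH H u s \<in> V"
    using assms pts by (auto intro: I_mem BH_mem)
  have "S (t - u) (R u s) = S (t - u) (BH H u s) - S (t - u) (I u) + S (t - s) (I s)"
    using assms mem S_semigroup [of "t - u" "u - s" "I s"]
    unfolding R_eq by (simp add: S_add S_diff)
  moreover have "BH H t s = BH H t u + S (t - u) (BH H u s) + H (t, u, s)"
    using assms pts by (intro BH_chain [OF H]) auto
  ultimately show ?thesis unfolding R_eq by simp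
qed

lemma R_top: "R T 0 = 0"
  using path_at_eq_I [of 0 0] path_at_eq_I [of T 0] T_pos level_0 by (simp add: R_eq)

lemma R_children:
  assumes int: "(a, c) \<in> dyadic_intervals T" and b: "b = (a + c) / 2"
  shows "R b a = snd (\<sigma> a c (R c a))" "R c b = fst (\<sigma> a c (R c a))"
proof -
  show left: "R b a = snd (\<sigma> a c (R c a))"
    using I_midpoint [OF int b] by (simp add: R_eq)
  obtain n where n: "a \<in> dyadic_level T n" "c \<in> dyadic_level T n" "b \<in> dyadic_level T (Suc n)"
    "c = a + T / 2 ^ n"
    using intervalsE [OF assms(1)] unfolding b by metis
  define L where "L = T / 2 ^ n"
  have "0 < L" "c = a + L" using T_pos n(4) by (simp_all add: L_def)
  then have "a \<le> b" "b \<le> c" unfolding b by simp_all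
  moreover have "a \<in> dyadic_points T" "b \<in> dyadic_points T" "c \<in> dyadic_points T"
    using n level_subset_points by blast+
  ultimately have "R c a = R c b + S (c - b) (R b a) + H (c, b, a)" by (intro R_chain)
  then show "R c b = fst (\<sigma> a c (R c a))"
    using rule_children(3) [OF assms] unfolding left by (metis add_right_cancel)
qed

end

section \<open>Dyadic intervals: linear growth in the level\<close>

definition critical_factor :: "real \<Rightarrow> real \<Rightarrow> real \<Rightarrow> nat \<Rightarrow> real" where
  "critical_factor T C \<eta> n = (\<Prod>i<n. 1 + 2 * C * (T / 2 ^ i) powr \<eta>)"

definition growth_const :: "real \<Rightarrow> real \<Rightarrow> real \<Rightarrow> real" where
  "growth_const T C \<eta> = exp (2 * C * T powr \<eta> / (1 - 2 powr (- \<eta>)))"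

lemma critical_factor_ge_1: "0 \<le> C \<Longrightarrow> 1 \<le> critical_factor T C \<eta> n"
  unfolding critical_factor_def by (intro prod_ge_1) auto

lemma critical_factor_bounded:
  assumes "0 \<le> C" "0 < \<eta>" "0 < T"
  shows "critical_factor T C \<eta> n \<le> growth_const T C \<eta>"
proof -
  define q where "q = 2 powr (- \<eta>)"
  have "q < 2 powr 0" unfolding q_def using assms by (intro powr_less_mono) auto
  then have q: "0 < q" "q < 1" by (auto simp: q_def)
  have pw: "(T / 2 ^ i) powr \<eta> = T powr \<eta> * q ^ i" for i
  proof -
    have "(2 ^ i :: real) powr \<eta> = 2 powr (real i * \<eta>)"
      by (simp add: powr_powr flip: powr_realpow)
    moreover have "q ^ i = 2 powr (- (real i * \<eta>))"
      using q(1) by (simp add: q_def powr_powr mult.commute flip: powr_realpow)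
    ultimately show ?thesis
      using assms by (simp add: powr_divide powr_minus) (simp add: divide_inverse)
  qed
  have geo: "(\<Sum>i<n. q ^ i) \<le> 1 / (1 - q)"
    using q by (subst sum_gp_strict) (auto intro!: divide_right_mono)
  have "critical_factor T C \<eta> n \<le> (\<Prod>i<n. exp (2 * C * (T / 2 ^ i) powr \<eta>))"
    unfolding critical_factor_def using assms by (intro prod_mono) auto
  also have "\<dots> = exp (2 * C * T powr \<eta> * (\<Sum>i<n. q ^ i))"
    by (simp add: exp_sum pw sum_distrib_left mult.assoc)
  also have "\<dots> \<le> exp (2 * C * T powr \<eta> * (1 / (1 - q)))"
    using assms geo by (intro exp_le_cancel_iff [THEN iffD2] mult_left_mono) auto
  finally show ?thesis by (simp add: q_def growth_const_def)
qed

context selected_residual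
begin

text \<open>
  The total residual \<open>R T 0\<close> vanishes. One bisection halves the length, hence the rescaled
  residual (norm divided by length) grows by a factor \<open>1 + 2 C L\<^sup>\<eta>\<close> plus a fixed increment
  \<open>2 C\<^sub>H\<close>. The factors have a convergent product because the lengths are geometric, so that at
  level \<open>n\<close> the rescaled residual is at most a multiple of \<open>n\<close>.
\<close>

lemma interval_bound:
  assumes est: "critical_estimate T S N C_H C \<eta> \<sigma> H" and C: "0 \<le> C" "0 \<le> C_H"
    and x: "x \<in> dyadic_level T n" and y: "y \<in> dyadic_level T n" "y = x + T / 2 ^ n"
  shows "N (R y x) \<le> 2 * critical_factor T C \<eta> n * C_H * real n * (T / 2 ^ n)"
  using x y
proof (induction n arbitrary: x y)
  case 0
  then have "x = 0" "y = T" using T_pos by (auto simp: level_0)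
  then show ?case by (simp add: R_top)
next
  case (Suc n)
  define L where "L = T / 2 ^ n"
  define F where "F = critical_factor T C \<eta>"
  have L: "0 < L" using T_pos by (simp add: L_def)
  have xy: "y = x + L / 2" using Suc.prems by (simp add: L_def)
  have halve: "max (N (R c b)) (N (R b a)) \<le> 2 * F (Suc n) * C_H * real (Suc n) * (L / 2)"
    if int: "(a, c) \<in> dyadic_intervals T" and ac: "a \<in> dyadic_level T n" "c \<in> dyadic_level T n"
      and len: "c = a + L" and b: "b = (a + c) / 2" for a b c
  proof -
    have "max (N (R c b)) (N (R b a)) \<le> (1 / 2 + C * (c - a) powr \<eta>) * N (R c a) + C_H * (c - a)"
      using bspec [OF est [unfolded critical_estimate_def] int] R_children [OF int b]
      by (simp add: Let_def case_prod_unfold flip: R_def)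
    also have "\<dots> \<le> (1 / 2 + C * (c - a) powr \<eta>) * (2 * F n * C_H * real n * L) + C_H * (c - a)"
      using Suc.IH [OF ac] C len by (intro add_right_mono mult_left_mono) (auto simp: L_def F_def)
    also have "\<dots> = (1 + 2 * C * L powr \<eta>) * F n * C_H * real n * L + 1 * (C_H * L)"
      by (simp add: len algebra_simps)
    also have "\<dots> = F (Suc n) * C_H * real n * L + 1 * (C_H * L)"
      by (simp add: F_def critical_factor_def L_def mult.commute)
    also have "\<dots> \<le> F (Suc n) * C_H * real n * L + F (Suc n) * (C_H * L)"
      using critical_factor_ge_1 [OF C(1), of T \<eta> "Suc n"] C L
      by (intro add_left_mono mult_right_mono) (auto simp: F_def)
    also have "\<dots> = 2 * F (Suc n) * C_H * real (Suc n) * (L / 2)"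
      by (simp add: algebra_simps)
    finally show ?thesis .
  qed
  have Suc_L: "T / 2 ^ Suc n = L / 2" by (simp add: L_def)
  show ?case
  proof (cases "x \<in> dyadic_level T n")
    case True
    have "y \<notin> dyadic_level T n"
      using level_neighbours(3) [of x n y] True xy L by (auto simp: L_def)
    note ac = level_refine [OF Suc.prems(2) this, unfolded Suc_L]
    show ?thesis
      using halve [OF ac, of y] unfolding xy Suc_L by (simp add: F_def)
  next
    case False
    note ac = level_refine [OF Suc.prems(1) this, unfolded Suc_L]
    show ?thesis
      using halve [OF ac, of x] unfolding xy Suc_L by (simp add: F_def)
  qed
qed

end

section \<open>Arbitrary dyadic pairs: the logarithmic bound\<close>

text \<open>
  A dyadic pair is covered by dyadic intervals whose lengths decrease geometrically away from a
  point in the middle, with at most two of each length. The residuals of the pieces are summed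
  with the chain rule; the defects that it produces are controlled by the total length of what
  is still to be split, so they form geometric sums.
\<close>

context selected_residual
begin

text \<open>
  A bound for what remains to one side of a point of level \<open>n\<close>, when pieces of level \<open>n\<close> cost
  \<open>A n T / 2\<^sup>n\<close> and defects cost \<open>K\<close> times the length. The coefficients are chosen so that one
  step of the decomposition reproduces the same expression at level \<open>n + 1\<close>.
\<close>

definition tail :: "real \<Rightarrow> real \<Rightarrow> nat \<Rightarrow> real" where
  "tail A K n = M * (2 * A * real n + 2 * A + 4 * K) * (T / 2 ^ n)"

context
  fixes A K :: real
  assumes A: "0 \<le> A" and K: "0 \<le> K"
    and piece: "\<And>x y n. x \<in> dyadic_level T n \<Longrightarrow> y \<in> dyadic_level T n \<Longrightarrow> y = x + T / 2 ^ n
      \<Longrightarrow> N (R y x) \<le> A * real n * (T / 2 ^ n)"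
    and defect: "\<And>t u s. (t, u, s) \<in> Delta3 T \<Longrightarrow> N (H (t, u, s)) \<le> K * (t - s)"
begin

lemma tail_nonneg: "0 \<le> tail A K n"
  using A K M_ge_1 T_pos by (simp add: tail_def)

lemma tail_step: "tail A K (Suc n) + M * (A * real n * (T / 2 ^ n) + 2 * K * (T / 2 ^ n)) = tail A K n"
  by (simp add: tail_def field_simps)

text \<open>The defect vanishes on the diagonal, so the chain rule at three equal times reads \<open>R t t = R t t + R t t\<close>.\<close>

lemma R_refl_0: "t \<in> dyadic_points T \<Longrightarrow> R t t = 0"
proof -
  assume t: "t \<in> dyadic_points T"
  then have "N (H (t, t, t)) \<le> 0" "H (t, t, t) \<in> V"
    using defect [of t t t] by (auto simp: Delta3_def intro: points_le H_mem)
  then have "H (t, t, t) = 0"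
    by (metis N_eq_0 N_nonneg antisym)
  moreover have "R t t = R t t + S 0 (R t t) + H (t, t, t)"
    using R_chain [of t t t] t by simp
  ultimately show ?thesis using R_mem [of t t] t by simp
qed

lemma step_cost:
  assumes "0 \<le> r" "r \<le> A * real n * (T / 2 ^ n)" "0 \<le> h" "h \<le> K * (2 * (T / 2 ^ n))" "g \<le> tail A K (Suc n)"
  shows "g + (M * r + M * h) \<le> tail A K n"
proof -
  have "M * r + M * h = M * (r + h)" by (simp add: algebra_simps)
  also have "\<dots> \<le> M * (A * real n * (T / 2 ^ n) + 2 * K * (T / 2 ^ n))"
    using assms M_ge_1 by (intro mult_left_mono) (auto simp: algebra_simps)
  finally show ?thesis using tail_step [of n] assms by linarith
qed

lemma tail_decreasing: "tail A K (Suc n) \<le> tail A K n"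
  using step_cost [of 0 n 0 "tail A K (Suc n)"] A K T_pos by simp

lemma M_ge: "0 \<le> x \<Longrightarrow> x \<le> M * x"
  using mult_right_mono [OF M_ge_1, of x] by simp

text \<open>
  The interval of level \<open>n\<close> at \<open>v\<close> is split off whenever \<open>t\<close> lies beyond it. Allowing twice the
  length of such an interval makes the hypothesis reproduce itself at level \<open>n + 1\<close> in both cases.
\<close>

lemma right_tail:
  assumes "v \<in> dyadic_level T n" "t \<in> dyadic_level T (n + k)" "v \<le> t" "t < v + 2 * (T / 2 ^ n)"
  shows "N (R t v) \<le> tail A K n"
  using assms
proof (induction k arbitrary: n v)
  case 0
  show ?case
  proof (cases "t = v")
    case True
    then show ?thesis
      using R_refl_0 [of v] subsetD [OF level_subset_points 0(1)] tail_nonneg by simp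
  next
    case False
    then have "v + T / 2 ^ n \<le> t" using level_neighbours(3) [of v n t] 0 by simp
    moreover have "\<not> v + T / 2 ^ n < t"
      using level_neighbours(3) [of "v + T / 2 ^ n" n t] level_neighbours(1) [of v n t] 0 False
      by auto
    ultimately have "t = v + T / 2 ^ n" by simp
    then have "N (R t v) \<le> A * real n * (T / 2 ^ n)" using 0 by (intro piece) auto
    also have "\<dots> \<le> M * (A * real n * (T / 2 ^ n))"
      using A T_pos by (intro M_ge) auto
    also have "\<dots> \<le> tail A K n"
      using step_cost [of "A * real n * (T / 2 ^ n)" n 0 0] A K T_pos tail_nonneg by simp
    finally show ?thesis .
  qed
next
  case (Suc k)
  define v' where "v' = v + T / 2 ^ n"
  have L: "0 < T / 2 ^ n" using T_pos by simp
  have half: "2 * (T / 2 ^ Suc n) = T / 2 ^ n" by simp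
  have t: "t \<in> dyadic_level T (Suc n + k)" "t \<in> dyadic_points T"
    using Suc.prems(2) level_subset_points by auto
  have up: "x \<in> dyadic_level T (Suc n)" if "x \<in> dyadic_level T n" for x
    using that level_Suc by blast
  show ?case
  proof (cases "v' \<le> t")
    case False
    then have "N (R t v) \<le> tail A K (Suc n)"
      using Suc.prems up t half by (intro Suc.IH) (auto simp: v'_def)
    then show ?thesis using tail_decreasing [of n] by linarith
  next
    case True
    have "t \<le> T" using t points_le by blast
    then have "v < T" using True L by (simp add: v'_def)
    then have v': "v' \<in> dyadic_level T n"
      unfolding v'_def using Suc.prems(1) level_top by (intro level_neighbours(1))
    have v0: "0 \<le> v" using Suc.prems(1) level_le by blast
    have pts: "v \<in> dyadic_points T" "v' \<in> dyadic_points T"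
      using v' Suc.prems(1) level_subset_points by blast+
    have le: "v \<le> v'" using L by (simp add: v'_def)
    have mem: "R t v' \<in> V" "R v' v \<in> V" "H (t, v', v) \<in> V"
      using pts t True le v0 \<open>t \<le> T\<close> by (auto intro: R_mem H_mem)
    have "N (R t v) \<le> N (R t v') + N (S (t - v') (R v' v)) + N (H (t, v', v))"
      using R_chain [of v v' t] pts t True le mem N_triangle3 by simp
    moreover have "N (R t v') \<le> tail A K (Suc n)"
    proof (rule Suc.IH)
      show "v' \<in> dyadic_level T (Suc n)" using v' by (rule up)
      show "t < v' + 2 * (T / 2 ^ Suc n)" using Suc.prems(4) unfolding half by (simp add: v'_def)
    qed (use t True in auto)
    moreover have "N (S (t - v') (R v' v)) \<le> M * N (R v' v)"
      using mem True le v0 \<open>t \<le> T\<close> by (intro S_bound) auto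
    moreover have "N (R v' v) \<le> A * real n * (T / 2 ^ n)"
      using v' Suc.prems(1) by (intro piece) (auto simp: v'_def)
    moreover have "N (H (t, v', v)) \<le> M * N (H (t, v', v))"
      using mem by (intro M_ge) simp
    moreover have "N (H (t, v', v)) \<le> K * (2 * (T / 2 ^ n))"
    proof -
      have "N (H (t, v', v)) \<le> K * (t - v)"
        using True le v0 \<open>t \<le> T\<close> by (intro defect) (auto simp: Delta3_def)
      also have "\<dots> \<le> K * (2 * (T / 2 ^ n))"
        using Suc.prems(4) K by (intro mult_left_mono) auto
      finally show ?thesis .
    qed
    ultimately show ?thesis
      using step_cost [of "N (R v' v)" n "N (H (t, v', v))" "N (R t v')"] mem by simp
  qed
qed

text \<open>
  On the left side the chain rule applies the semigroup to the remainder at every step. To avoid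
  a factor \<open>M\<close> per level, the induction carries an extra \<open>S \<tau>\<close>, and the semigroup law merges the
  operators before the bound \<open>M\<close> is used.
\<close>

lemma left_tail:
  assumes "v \<in> dyadic_level T n" "s \<in> dyadic_level T (n + k)" "s \<le> v" "v < s + 2 * (T / 2 ^ n)"
    and "0 \<le> \<tau>" "\<tau> + v \<le> T"
  shows "N (S \<tau> (R v s)) \<le> tail A K n"
  using assms
proof (induction k arbitrary: n v \<tau>)
  case 0
  have pts: "v \<in> dyadic_points T" "s \<in> dyadic_points T" and s0: "0 \<le> s"
    using 0 level_subset_points level_le by auto
  show ?case
  proof (cases "s = v")
    case True
    then show ?thesis
      using R_refl_0 [of v] pts tail_nonneg 0 by simp
  next
    case False
    then have "s + T / 2 ^ n \<le> v" using level_neighbours(3) [of s n v] 0 by simp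
    moreover have "\<not> s + T / 2 ^ n < v"
      using level_neighbours(3) [of "s + T / 2 ^ n" n v] level_neighbours(1) [of s n v] 0 False
      by auto
    ultimately have "v = s + T / 2 ^ n" by simp
    then have "N (R v s) \<le> A * real n * (T / 2 ^ n)" using 0 by (intro piece) auto
    moreover have "N (S \<tau> (R v s)) \<le> M * N (R v s)"
      using 0 s0 pts by (intro S_bound R_mem) auto
    ultimately show ?thesis
      using step_cost [of "N (R v s)" n 0 0] R_mem [of v s] 0 pts K T_pos tail_nonneg by simp
  qed
next
  case (Suc k)
  define v' where "v' = v - T / 2 ^ n"
  have L: "0 < T / 2 ^ n" using T_pos by simp
  have half: "2 * (T / 2 ^ Suc n) = T / 2 ^ n" by simp
  have s: "s \<in> dyadic_level T (Suc n + k)" "s \<in> dyadic_points T"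
    using Suc.prems(2) level_subset_points by auto
  then have s0: "0 \<le> s" using points_le by blast
  have up: "x \<in> dyadic_level T (Suc n)" if "x \<in> dyadic_level T n" for x
    using that level_Suc by blast
  show ?case
  proof (cases "s \<le> v'")
    case False
    then have "N (S \<tau> (R v s)) \<le> tail A K (Suc n)"
      using Suc.prems up s half by (intro Suc.IH) (auto simp: v'_def)
    then show ?thesis using tail_decreasing [of n] by linarith
  next
    case True
    have "0 < v" using True L s0 by (simp add: v'_def)
    then have v': "v' \<in> dyadic_level T n"
      unfolding v'_def using Suc.prems(1) level_bottom by (intro level_neighbours(2))
    have pts: "v \<in> dyadic_points T" "v' \<in> dyadic_points T"
      using v' Suc.prems(1) level_subset_points by blast+
    have le: "v' \<le> v" "v \<le> T" using L Suc.prems by (auto simp: v'_def)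
    have mem: "R v v' \<in> V" "R v' s \<in> V" "H (v, v', s) \<in> V"
      using pts s True le s0 by (auto intro: R_mem H_mem)
    have "S \<tau> (R v s) = S \<tau> (R v v') + S \<tau> (S (v - v') (R v' s)) + S \<tau> (H (v, v', s))"
      using R_chain [of s v' v] pts s True le mem Suc.prems(5) by (simp add: S_add)
    also have "S \<tau> (S (v - v') (R v' s)) = S (\<tau> + (v - v')) (R v' s)"
      using mem le Suc.prems(5) by (simp add: S_semigroup)
    finally have "N (S \<tau> (R v s)) \<le> N (S \<tau> (R v v')) + N (S (\<tau> + (v - v')) (R v' s)) + N (S \<tau> (H (v, v', s)))"
      using mem Suc.prems(5) le by (simp add: N_triangle3)
    moreover have "N (S (\<tau> + (v - v')) (R v' s)) \<le> tail A K (Suc n)"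
    proof (rule Suc.IH)
      show "v' \<in> dyadic_level T (Suc n)" using v' by (rule up)
      show "v' < s + 2 * (T / 2 ^ Suc n)" using Suc.prems(4) unfolding half by (simp add: v'_def)
    qed (use s True Suc.prems le in auto)
    moreover have "N (S \<tau> (R v v')) \<le> M * N (R v v')" "N (S \<tau> (H (v, v', s))) \<le> M * N (H (v, v', s))"
      using mem Suc.prems True s0 le by (auto intro!: S_bound)
    moreover have "N (R v v') \<le> A * real n * (T / 2 ^ n)"
      using v' Suc.prems(1) by (intro piece) (auto simp: v'_def)
    moreover have "N (H (v, v', s)) \<le> K * (2 * (T / 2 ^ n))"
    proof -
      have "N (H (v, v', s)) \<le> K * (v - s)"
        using True le s0 by (intro defect) (auto simp: Delta3_def)
      also have "\<dots> \<le> K * (2 * (T / 2 ^ n))"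
        using Suc.prems(4) K by (intro mult_left_mono) auto
      finally show ?thesis .
    qed
    ultimately show ?thesis
      using step_cost [of "N (R v v')" n "N (H (v, v', s))" "N (S (\<tau> + (v - v')) (R v' s))"] mem by simp
  qed
qed

lemma pair_bound:
  assumes s: "s \<in> dyadic_points T" and t: "t \<in> dyadic_points T" and st: "s < t"
    and n: "T / 2 ^ n \<le> t - s" "t - s < 2 * (T / 2 ^ n)"
  shows "N (R t s) \<le> 2 * tail A K n + K * (t - s)"
proof -
  have "0 \<le> s" "t \<le> T" using s t points_le by auto
  then obtain v where v: "v \<in> dyadic_level T n" "s \<le> v" "v < s + T / 2 ^ n"
    using level_ceiling [of s n] st by auto
  have vp: "v \<in> dyadic_points T" using v(1) level_subset_points by blast
  have vt: "v \<le> t" using v(3) n(1) by simp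
  have "{s, t} \<subseteq> dyadic_points T" using s t by simp
  then obtain m where m: "{s, t} \<subseteq> dyadic_level T m"
    using points_common_level [of "{s, t}"] by blast
  then have mn: "s \<in> dyadic_level T (n + m)" "t \<in> dyadic_level T (n + m)"
    using level_mono [of m "n + m"] by auto
  have L: "0 < T / 2 ^ n" using T_pos by simp
  have mem: "R t v \<in> V" "R v s \<in> V" "H (t, v, s) \<in> V"
    using s t vp v vt \<open>0 \<le> s\<close> \<open>t \<le> T\<close> by (auto intro: R_mem H_mem)
  have "N (R t s) \<le> N (R t v) + N (S (t - v) (R v s)) + N (H (t, v, s))"
    using R_chain [of s v t] s t vp v vt mem N_triangle3 by simp
  moreover have "N (R t v) \<le> tail A K n"
    using v mn vt n by (intro right_tail [of v n t m]) auto
  moreover have "N (S (t - v) (R v s)) \<le> tail A K n"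
    using v mn vt L \<open>t \<le> T\<close> by (intro left_tail [of v n s m]) auto
  moreover have "N (H (t, v, s)) \<le> K * (t - s)"
    using v vt \<open>0 \<le> s\<close> \<open>t \<le> T\<close> by (intro defect) (auto simp: Delta3_def)
  ultimately show ?thesis by linarith
qed

end

end

definition log_const :: "real \<Rightarrow> real \<Rightarrow> real" where
  "log_const T M = 12 * M * (1 + \<bar>ln (2 * T)\<bar>)"

context selected_residual
begin

text \<open>
  The level \<open>n\<close> comparable with \<open>t - s\<close> is at most logarithmic in \<open>t - s\<close>, which turns the
  linear growth in \<open>n\<close> into the logarithm.
\<close>

lemma log_bound:
  assumes A: "0 \<le> A" and K: "0 \<le> K"
    and piece: "\<And>x y n. x \<in> dyadic_level T n \<Longrightarrow> y \<in> dyadic_level T n \<Longrightarrow> y = x + T / 2 ^ n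
      \<Longrightarrow> N (R y x) \<le> A * real n * (T / 2 ^ n)"
    and defect: "\<And>t u s. (t, u, s) \<in> Delta3 T \<Longrightarrow> N (H (t, u, s)) \<le> K * (t - s)"
    and s: "s \<in> dyadic_points T" and t: "t \<in> dyadic_points T" and st: "s < t"
  shows "N (R t s) \<le> log_const T M * (A + K) * ((t - s) * (1 + \<bar>ln (t - s)\<bar>))"
proof -
  define x where "x = t - s"
  have x: "0 < x" "x \<le> T" using points_le(1) [OF s] points_le(2) [OF t] st by (auto simp: x_def)
  obtain n where n: "T / 2 ^ n \<le> x" "x < 2 * (T / 2 ^ n)" using mesh_comparable [OF x] .
  define b where "b = 1 + \<bar>ln (2 * T)\<bar>"
  define l where "l = 1 + \<bar>ln x\<bar>"
  have bl: "1 \<le> b" "1 \<le> l" by (auto simp: b_def l_def)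
  then have "0 \<le> (b - 1) * (l - 1)" by simp
  then have bl': "b + l - 1 \<le> b * l" by (simp add: algebra_simps)
  have "2 ^ n * x < 2 * T" using n(2) by (simp add: field_simps)
  then have "ln (2 ^ n * x) < ln (2 * T)" using x T_pos by (subst ln_less_cancel_iff) auto
  then have "real n * ln 2 < ln (2 * T) - ln x" using x by (simp add: ln_mult ln_realpow)
  also have "\<dots> \<le> b * l" using bl' by (simp add: b_def l_def)
  finally have "real n * ln 2 \<le> b * l" by simp
  moreover have "real n * (1 / 2) \<le> real n * ln 2"
    using ln_2_less_1 ln2_ge_two_thirds by (intro mult_left_mono) auto
  ultimately have nbl: "real n \<le> 2 * (b * l)" by simp
  have one: "1 \<le> b * l" using bl mult_mono [of 1 b 1 l] by simp
  have "N (R t s) \<le> 2 * tail A K n + K * (t - s)"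
    by (rule pair_bound [OF A K piece defect s t st]) (use n in \<open>simp_all add: x_def\<close>)
  also have "tail A K n \<le> M * (2 * A * real n + 2 * A + 4 * K) * x"
    unfolding tail_def using n(1) A K M_ge_1 by (intro mult_left_mono) auto
  also have "2 * (M * (2 * A * real n + 2 * A + 4 * K) * x) + K * (t - s)
      = (M * (4 * A * real n + 4 * A * 1 + 8 * K * 1) + 1 * (K * 1)) * x"
    by (simp add: x_def algebra_simps)
  also have "\<dots> \<le> (M * (4 * A * (2 * (b * l)) + 4 * A * (b * l) + 8 * K * (b * l)) + M * (K * (b * l))) * x"
    using nbl one A K M_ge_1 x by (intro mult_right_mono add_mono mult_left_mono mult_mono) auto
  also have "\<dots> = (12 * A + 9 * K) * (M * b * l * x)"
    by (simp add: algebra_simps)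
  also have "\<dots> \<le> (12 * A + 12 * K) * (M * b * l * x)"
    using K M_ge_1 bl x by (intro mult_right_mono) auto
  also have "\<dots> = log_const T M * (A + K) * (x * l)"
    by (simp add: log_const_def b_def algebra_simps)
  finally show ?thesis by (simp add: x_def l_def)
qed

end

section \<open>Extension from dyadic pairs to the simplex\<close>

context banach_interval
begin

lemma dfloor_pair: "(t, s) \<in> Delta2 T \<Longrightarrow> (dfloor n t, dfloor n s) \<in> Delta2 T"
  using dfloor_mem [of t n] dfloor_mem [of s n] by (auto simp: Delta2_def intro: dfloor_mono points_le)

lemma dfloor_pair_tendsto:
  "(t, s) \<in> Delta2 T \<Longrightarrow> (\<lambda>n. (dfloor n t, dfloor n s)) \<longlonglongrightarrow> (t, s)"
  by (intro tendsto_Pair dfloor_tendsto) (auto simp: Delta2_def)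

lemma cont_maps_dyadic_unique:
  assumes g: "g \<in> cont_maps (Delta2 T) V N" and g': "g' \<in> cont_maps (Delta2 T) V N"
    and eq: "\<And>t s. t \<in> dyadic_points T \<Longrightarrow> s \<in> dyadic_points T \<Longrightarrow> s \<le> t \<Longrightarrow> g (t, s) = g' (t, s)"
  shows "g = g'"
proof
  fix p show "g p = g' p"
  proof (cases "p \<in> Delta2 T")
    case False
    then have "g p = 0" "g' p = 0" using g g' unfolding cont_maps_def by blast+
    then show ?thesis by simp
  next
    case True
    obtain t s where p: "p = (t, s)" by (cases p)
    with True have ts: "(t, s) \<in> Delta2 T" by simp
    have same: "g (dfloor n t, dfloor n s) = g' (dfloor n t, dfloor n s)" for n
      using ts by (intro eq dfloor_mem dfloor_mono) (auto simp: Delta2_def)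
    have "(\<lambda>n. N (g (dfloor n t, dfloor n s) - g (t, s))) \<longlonglongrightarrow> 0"
      using ts by (intro cont_maps_seq [OF g] dfloor_pair dfloor_pair_tendsto)
    moreover have "(\<lambda>n. N (g (dfloor n t, dfloor n s) - g' (t, s))) \<longlonglongrightarrow> 0"
      unfolding same using ts by (intro cont_maps_seq [OF g'] dfloor_pair dfloor_pair_tendsto)
    ultimately have "g (t, s) = g' (t, s)"
      using ts dfloor_pair g g' by (intro limit_unique [of "\<lambda>n. g (dfloor n t, dfloor n s)"])
        (auto intro: cont_maps_mem)
    then show ?thesis by (simp add: p)
  qed
qed

text \<open>
  The value at \<open>(t, s)\<close> is the limit along the dyadic approximations from below. These are monotone
  in the time, so they keep \<open>s \<le> t\<close> and stay in the domain of \<open>F\<close>.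
\<close>

lemma dyadic_extension:
  fixes F :: "real \<Rightarrow> real \<Rightarrow> 'a"
  assumes F: "\<And>t s. t \<in> dyadic_points T \<Longrightarrow> s \<in> dyadic_points T \<Longrightarrow> s \<le> t \<Longrightarrow> F t s \<in> V"
    and uc: "\<And>e. 0 < e \<Longrightarrow> \<exists>d>0. \<forall>t\<in>dyadic_points T. \<forall>s\<in>dyadic_points T.
      \<forall>t'\<in>dyadic_points T. \<forall>s'\<in>dyadic_points T. s \<le> t \<longrightarrow> s' \<le> t' \<longrightarrow> \<bar>t - t'\<bar> < d \<longrightarrow> \<bar>s - s'\<bar> < d
      \<longrightarrow> N (F t s - F t' s') < e"
  obtains g where "g \<in> cont_maps (Delta2 T) V N"
    "\<And>t s. t \<in> dyadic_points T \<Longrightarrow> s \<in> dyadic_points T \<Longrightarrow> s \<le> t \<Longrightarrow> g (t, s) = F t s"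
proof -
  define X where "X p n = F (dfloor n (fst p)) (dfloor n (snd p))" for p n
  have dmem: "dfloor n (fst p) \<in> dyadic_points T" "dfloor n (snd p) \<in> dyadic_points T"
    "dfloor n (snd p) \<le> dfloor n (fst p)" if "p \<in> Delta2 T" for p n
    using that by (auto simp: Delta2_def intro!: dfloor_mem dfloor_mono)
  have near: "\<exists>d>0. \<forall>t\<in>dyadic_points T. \<forall>s\<in>dyadic_points T. \<forall>p\<in>Delta2 T. \<forall>n.
      s \<le> t \<longrightarrow> \<bar>t - dfloor n (fst p)\<bar> < d \<longrightarrow> \<bar>s - dfloor n (snd p)\<bar> < d \<longrightarrow> N (F t s - X p n) < e"
    if e: "e > 0" for e
  proof -
    from uc [OF that] obtain d where "d > 0" and d: "\<And>t s t' s'. t \<in> dyadic_points T \<Longrightarrow> s \<in> dyadic_points T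
        \<Longrightarrow> t' \<in> dyadic_points T \<Longrightarrow> s' \<in> dyadic_points T \<Longrightarrow> s \<le> t \<Longrightarrow> s' \<le> t' \<Longrightarrow> \<bar>t - t'\<bar> < d
        \<Longrightarrow> \<bar>s - s'\<bar> < d \<Longrightarrow> N (F t s - F t' s') < e"
      by metis
    have "N (F t s - X p n) < e" if "t \<in> dyadic_points T" "s \<in> dyadic_points T" "p \<in> Delta2 T" "s \<le> t"
      "\<bar>t - dfloor n (fst p)\<bar> < d" "\<bar>s - dfloor n (snd p)\<bar> < d" for t s p n
      unfolding X_def using that dmem [OF that(3)] by (intro d) auto
    with \<open>d > 0\<close> show ?thesis by blast
  qed
  have XV: "X p n \<in> V" if "p \<in> Delta2 T" for p n
    unfolding X_def using that by (intro F dfloor_mem dfloor_mono) (auto simp: Delta2_def)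
  have lim: "(\<lambda>n. dfloor n (fst p)) \<longlonglongrightarrow> fst p" "(\<lambda>n. dfloor n (snd p)) \<longlonglongrightarrow> snd p"
    if "p \<in> Delta2 T" for p
    using that by (auto simp: Delta2_def intro!: dfloor_tendsto)
  have "\<exists>x\<in>V. (\<lambda>n. N (X p n - x)) \<longlonglongrightarrow> 0" if p: "p \<in> Delta2 T" for p
  proof -
    have "\<exists>M. \<forall>m\<ge>M. \<forall>n\<ge>M. N (X p m - X p n) < e" if e: "e > 0" for e
    proof -
      obtain d where d: "d > 0" "\<And>t s q n. t \<in> dyadic_points T \<Longrightarrow> s \<in> dyadic_points T \<Longrightarrow> q \<in> Delta2 T \<Longrightarrow>
          s \<le> t \<Longrightarrow> \<bar>t - dfloor n (fst q)\<bar> < d \<Longrightarrow> \<bar>s - dfloor n (snd q)\<bar> < d \<Longrightarrow> N (F t s - X q n) < e"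
        using near [OF e] by metis
      obtain M1 where "\<forall>m\<ge>M1. \<forall>n\<ge>M1. norm (dfloor m (fst p) - dfloor n (fst p)) < d"
        using CauchyD [OF LIMSEQ_imp_Cauchy [OF lim(1) [OF p]] d(1)] by blast
      moreover obtain M2 where "\<forall>m\<ge>M2. \<forall>n\<ge>M2. norm (dfloor m (snd p) - dfloor n (snd p)) < d"
        using CauchyD [OF LIMSEQ_imp_Cauchy [OF lim(2) [OF p]] d(1)] by blast
      ultimately have "N (X p m - X p n) < e" if "m \<ge> max M1 M2" "n \<ge> max M1 M2" for m n
        using d(2) [OF dmem(1,2) [OF p, of m] p dmem(3) [OF p, of m], of n] that
        by (simp add: X_def [of p m])
      then show ?thesis by blast
    qed
    then show ?thesis using complete_V [of "X p"] XV [OF p] by metis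
  qed
  then obtain G where G: "\<And>p. p \<in> Delta2 T \<Longrightarrow> G p \<in> V"
    and Glim: "\<And>p. p \<in> Delta2 T \<Longrightarrow> (\<lambda>n. N (X p n - G p)) \<longlonglongrightarrow> 0"
    by metis
  define g where "g p = (if p \<in> Delta2 T then G p else 0)" for p
  have close: "\<exists>d>0. \<forall>p\<in>Delta2 T. \<forall>q\<in>Delta2 T. \<bar>fst q - fst p\<bar> < d \<longrightarrow> \<bar>snd q - snd p\<bar> < d
      \<longrightarrow> N (G q - G p) \<le> e" if e: "e > 0" for e
  proof -
    obtain d where d: "d > 0" "\<And>t s q n. t \<in> dyadic_points T \<Longrightarrow> s \<in> dyadic_points T \<Longrightarrow> q \<in> Delta2 T \<Longrightarrow>
        s \<le> t \<Longrightarrow> \<bar>t - dfloor n (fst q)\<bar> < d \<Longrightarrow> \<bar>s - dfloor n (snd q)\<bar> < d \<Longrightarrow> N (F t s - X q n) < e"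
      using near [OF e] by metis
    have "N (G q - G p) \<le> e" if p: "p \<in> Delta2 T" and q: "q \<in> Delta2 T"
      and "\<bar>fst q - fst p\<bar> < d" "\<bar>snd q - snd p\<bar> < d" for p q
    proof -
      have mem: "X q n \<in> V" "X p n \<in> V" "G q \<in> V" "G p \<in> V" for n
        using p q XV G by auto
      have "(\<lambda>n. N ((X q n - X p n) - (G q - G p))) \<longlonglongrightarrow> 0"
      proof (rule Lim_null_comparison)
        show "\<forall>\<^sub>F n in sequentially. norm (N ((X q n - X p n) - (G q - G p)))
            \<le> N (X q n - G q) + N (X p n - G p)"
        proof (intro always_eventually allI)
          fix n
          have "(X q n - X p n) - (G q - G p) = (X q n - G q) - (X p n - G p)"
            by (simp add: algebra_simps)
          moreover have "X q n - G q \<in> V" "X p n - G p \<in> V" using mem by auto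
          ultimately show "norm (N ((X q n - X p n) - (G q - G p))) \<le> N (X q n - G q) + N (X p n - G p)"
            using N_diff_le [of "X q n - G q" "X p n - G p"]
              N_nonneg [OF mem_diff, of "X q n - G q" "X p n - G p"] by (simp only: real_norm_def abs_of_nonneg)
        qed
        show "(\<lambda>n. N (X q n - G q) + N (X p n - G p)) \<longlonglongrightarrow> 0"
          using tendsto_add [OF Glim [OF q] Glim [OF p]] by simp
      qed
      then have "(\<lambda>n. N (X q n - X p n)) \<longlonglongrightarrow> N (G q - G p)"
        using mem by (intro N_tendsto) auto
      moreover have "\<forall>\<^sub>F n in sequentially. N (X q n - X p n) \<le> e"
      proof -
        have "(\<lambda>n. \<bar>dfloor n (fst q) - dfloor n (fst p)\<bar>) \<longlonglongrightarrow> \<bar>fst q - fst p\<bar>"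
          "(\<lambda>n. \<bar>dfloor n (snd q) - dfloor n (snd p)\<bar>) \<longlonglongrightarrow> \<bar>snd q - snd p\<bar>"
          by (intro tendsto_intros lim p q)+
        then have "\<forall>\<^sub>F n in sequentially. \<bar>dfloor n (fst q) - dfloor n (fst p)\<bar> < d"
          "\<forall>\<^sub>F n in sequentially. \<bar>dfloor n (snd q) - dfloor n (snd p)\<bar> < d"
          using that by (auto elim: order_tendstoD)
        then show ?thesis
        proof eventually_elim
          case (elim n)
          then show ?case
            using d(2) [OF dmem(1,2) [OF q, of n] p dmem(3) [OF q], of n] by (simp add: X_def [of q])
        qed
      qed
      ultimately show ?thesis by (rule tendsto_upperbound) simp
    qed
    with d(1) show ?thesis by blast
  qed
  have "g \<in> cont_maps (Delta2 T) V N"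
    unfolding cont_maps_def
  proof (intro CollectI conjI ballI allI impI)
    fix p assume p: "p \<in> Delta2 T"
    show "g p \<in> V" using p G by (simp add: g_def)
    show "((\<lambda>q. N (g q - g p)) \<longlongrightarrow> 0) (at p within Delta2 T)"
    proof (rule tendstoI)
      fix e :: real assume "e > 0"
      then obtain d where d: "d > 0" "\<And>q. q \<in> Delta2 T \<Longrightarrow> \<bar>fst q - fst p\<bar> < d \<Longrightarrow> \<bar>snd q - snd p\<bar> < d
          \<Longrightarrow> N (G q - G p) \<le> e / 2"
        using close [of "e / 2"] p by auto
      have "dist (N (g q - g p)) 0 < e" if "q \<in> Delta2 T" "dist q p < d" for q
      proof -
        have "\<bar>fst q - fst p\<bar> < d" "\<bar>snd q - snd p\<bar> < d"
          using that dist_fst_le [of q p] dist_snd_le [of q p] by (auto simp: dist_real_def)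
        then have "N (G q - G p) \<le> e / 2" using d(2) that by blast
        moreover have "0 \<le> N (G q - G p)" using G that p by simp
        ultimately show ?thesis using that p \<open>e > 0\<close> by (simp add: g_def)
      qed
      then show "\<forall>\<^sub>F q in at p within Delta2 T. dist (N (g q - g p)) 0 < e"
        unfolding eventually_at using d(1) by blast
    qed
  qed (simp add: g_def)
  moreover have "g (t, s) = F t s" if t: "t \<in> dyadic_points T" and s: "s \<in> dyadic_points T" and st: "s \<le> t" for t s
  proof -
    have p: "(t, s) \<in> Delta2 T" using points_le s t st by (auto simp: Delta2_def)
    have "(\<lambda>n. N (X (t, s) n - F t s)) \<longlonglongrightarrow> 0"
    proof (rule tendstoI)
      fix e :: real assume "e > 0"
      then obtain d where d: "d > 0" "\<And>n. \<bar>t - dfloor n t\<bar> < d \<Longrightarrow> \<bar>s - dfloor n s\<bar> < d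
          \<Longrightarrow> N (F t s - X (t, s) n) < e"
        using near [OF \<open>e > 0\<close>] t s st p by fastforce
      have "\<forall>\<^sub>F n in sequentially. dist (dfloor n t) t < d" "\<forall>\<^sub>F n in sequentially. dist (dfloor n s) s < d"
        using lim [OF p] d(1) by (auto intro: tendstoD)
      then show "\<forall>\<^sub>F n in sequentially. dist (N (X (t, s) n - F t s)) 0 < e"
      proof eventually_elim
        case (elim n)
        then have "N (F t s - X (t, s) n) < e" using d(2) by (simp add: dist_real_def abs_minus_commute)
        then show ?case using XV [OF p, of n] F [OF t s st] by (simp add: N_diff_commute)
      qed
    qed
    then have "G (t, s) = F t s"
      using XV [OF p] G [OF p] F [OF t s st] Glim [OF p] limit_unique by metis
    then show ?thesis using p by (simp add: g_def)
  qed
  ultimately show thesis using that by blast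
qed

end

context semigroup_interval
begin

lemma S_lipschitz:
  assumes "0 \<le> a" "0 \<le> b" "a \<le> T" "b \<le> T" "y \<in> V"
  shows "N (S a y - S b y) \<le> M * N (S \<bar>a - b\<bar> y - y)"
  using assms
proof (induction a b rule: linorder_wlog)
  case (le a b)
  have "S b y = S a (S (b - a) y)" using S_semigroup [of a "b - a" y] le by simp
  then have "S a y - S b y = - S a (S (b - a) y - y)" using le by (simp add: S_diff)
  then have "N (S a y - S b y) = N (S a (S (b - a) y - y))" using le by (simp add: N_minus)
  also have "\<dots> \<le> M * N (S (b - a) y - y)" using le by (intro S_bound) auto
  finally show ?case using le by simp
next
  case (sym a b)
  then show ?case using N_diff_commute [of "S a y" "S b y"] by (simp add: abs_minus_commute)
qed

lemma S_tendsto: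
  assumes \<tau>: "\<And>n. 0 \<le> \<tau> n" "\<And>n. \<tau> n \<le> T" "\<tau> \<longlonglongrightarrow> a" and a: "0 \<le> a" "a \<le> T"
    and y: "\<And>n. y n \<in> V" "x \<in> V" "(\<lambda>n. N (y n - x)) \<longlonglongrightarrow> 0"
  shows "(\<lambda>n. N (S (\<tau> n) (y n) - S a x)) \<longlonglongrightarrow> 0"
proof (rule Lim_null_comparison)
  show "\<forall>\<^sub>F n in sequentially. norm (N (S (\<tau> n) (y n) - S a x))
      \<le> M * N (y n - x) + M * N (S \<bar>\<tau> n - a\<bar> x - x)"
  proof (intro always_eventually allI)
    fix n
    have "N (S (\<tau> n) (y n) - S a x) \<le> N (S (\<tau> n) (y n) - S (\<tau> n) x) + N (S (\<tau> n) x - S a x)"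
      using \<tau> a y by (intro N_triangle_sub) auto
    also have "N (S (\<tau> n) (y n) - S (\<tau> n) x) = N (S (\<tau> n) (y n - x))"
      using \<tau> y by (simp add: S_diff)
    also have "\<dots> \<le> M * N (y n - x)" using \<tau> y by (intro S_bound) auto
    also have "N (S (\<tau> n) x - S a x) \<le> M * N (S \<bar>\<tau> n - a\<bar> x - x)"
      using \<tau> a y by (intro S_lipschitz) auto
    finally show "norm (N (S (\<tau> n) (y n) - S a x)) \<le> M * N (y n - x) + M * N (S \<bar>\<tau> n - a\<bar> x - x)"
      using \<tau> a y by simp
  qed
  have "continuous (at 0 within {0..}) (\<lambda>h. N (S h x - x))"
    using S_right_continuous [OF y(2)] y(2) by (simp add: continuous_within at_within_Ici_at_right)
  moreover have "(\<lambda>n. \<bar>\<tau> n - a\<bar>) \<longlonglongrightarrow> 0"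
    using \<tau>(3) by (simp add: LIM_zero tendsto_rabs_zero)
  ultimately have "(\<lambda>n. N (S \<bar>\<tau> n - a\<bar> x - x)) \<longlonglongrightarrow> N (S 0 x - x)"
    by (intro continuous_within_tendsto_compose [where f = "\<lambda>h. N (S h x - x)"]) auto
  then have "(\<lambda>n. M * N (y n - x) + M * N (S \<bar>\<tau> n - a\<bar> x - x)) \<longlonglongrightarrow> M * 0 + M * 0"
    using y by (intro tendsto_intros) auto
  then show "(\<lambda>n. M * N (y n - x) + M * N (S \<bar>\<tau> n - a\<bar> x - x)) \<longlonglongrightarrow> 0" by simp
qed

end

section \<open>The selected residual on the simplex\<close>

text \<open>A positive power of \<open>x\<close> absorbs the logarithm near \<open>0\<close>; on bounded intervals only that end matters.\<close>

lemma log_weight_le: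
  fixes x :: real
  assumes x: "0 < x" "x \<le> T" and \<epsilon>: "0 < \<epsilon>"
  shows "x * (1 + \<bar>ln x\<bar>) \<le> (T powr \<epsilon> + 1 / \<epsilon> + T * T powr \<epsilon>) * x powr (1 - \<epsilon>)"
proof -
  have xT: "x powr \<epsilon> \<le> T powr \<epsilon>" using assms by (intro powr_mono2) auto
  have "\<bar>ln x\<bar> * x powr \<epsilon> \<le> 1 / \<epsilon> + T * T powr \<epsilon>"
  proof (cases "x \<le> 1")
    case True
    have "\<bar>ln x\<bar> = ln (1 / x)" using True x by (simp add: ln_div)
    also have "\<dots> \<le> (1 / x) powr \<epsilon> / \<epsilon>" using True x \<epsilon> by (intro ln_powr_bound) auto
    finally have "\<bar>ln x\<bar> * x powr \<epsilon> \<le> (1 / x) powr \<epsilon> / \<epsilon> * x powr \<epsilon>"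
      by (intro mult_right_mono) auto
    also have "\<dots> = 1 / \<epsilon>" using x by (simp add: powr_divide)
    also have "\<dots> \<le> 1 / \<epsilon> + T * T powr \<epsilon>" using x by simp
    finally show ?thesis .
  next
    case False
    then have "\<bar>ln x\<bar> \<le> T" using ln_le_minus_one [of x] x by simp
    then have "\<bar>ln x\<bar> * x powr \<epsilon> \<le> T * T powr \<epsilon>" using xT x by (intro mult_mono) auto
    also have "\<dots> \<le> 1 / \<epsilon> + T * T powr \<epsilon>" using \<epsilon> by simp
    finally show ?thesis .
  qed
  with xT have "(1 + \<bar>ln x\<bar>) * x powr \<epsilon> \<le> T powr \<epsilon> + 1 / \<epsilon> + T * T powr \<epsilon>"
    by (simp add: algebra_simps)
  then have "(1 + \<bar>ln x\<bar>) * x powr \<epsilon> * x powr (1 - \<epsilon>) \<le> (T powr \<epsilon> + 1 / \<epsilon> + T * T powr \<epsilon>) * x powr (1 - \<epsilon>)"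
    by (intro mult_right_mono) auto
  moreover have "(1 + \<bar>ln x\<bar>) * x powr \<epsilon> * x powr (1 - \<epsilon>) = x * (1 + \<bar>ln x\<bar>)"
    using x by (simp add: mult.assoc flip: powr_add)
  ultimately show ?thesis by simp
qed

context selected_residual
begin

context
  fixes c :: real
  assumes c: "0 \<le> c"
    and log: "\<And>t s. t \<in> dyadic_points T \<Longrightarrow> s \<in> dyadic_points T \<Longrightarrow> s < t
      \<Longrightarrow> N (R t s) \<le> c * ((t - s) * (1 + \<bar>ln (t - s)\<bar>))"
    and diag: "\<And>t. t \<in> dyadic_points T \<Longrightarrow> R t t = 0"
    and rescont: "residual_continuity T S N \<sigma> H"
begin

lemma R_small:
  assumes "e > 0"
  obtains d where "d > 0"
    "\<And>t s. t \<in> dyadic_points T \<Longrightarrow> s \<in> dyadic_points T \<Longrightarrow> s \<le> t \<Longrightarrow> t - s < d \<Longrightarrow> N (R t s) < e"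
proof -
  \<comment> \<open>The logarithmic bound is at most \<open>k\<close> times the square root of the length.\<close>
  define k where "k = c * (T powr (1 / 2) + 2 + T * T powr (1 / 2)) + 1"
  have k: "0 < k" using c T_pos by (simp add: k_def add_nonneg_pos)
  have "N (R t s) < e" if ts: "t \<in> dyadic_points T" "s \<in> dyadic_points T" "s \<le> t" "t - s < (e / k)\<^sup>2" for t s
  proof (cases "s = t")
    case True
    then show ?thesis using diag ts assms by simp
  next
    case False
    define x where "x = t - s"
    have x: "0 < x" "x \<le> T" using False ts points_le(1) [of s] points_le(2) [of t] by (auto simp: x_def)
    have "N (R t s) \<le> c * (x * (1 + \<bar>ln x\<bar>))" unfolding x_def using ts False by (intro log) auto
    also have "\<dots> \<le> c * ((T powr (1 / 2) + 2 + T * T powr (1 / 2)) * x powr (1 / 2))"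
      using log_weight_le [OF x, of "1 / 2"] c by (intro mult_left_mono) auto
    also have "\<dots> \<le> k * x powr (1 / 2)" by (simp add: k_def algebra_simps)
    also have "x powr (1 / 2) = sqrt x" using x by (simp add: powr_half_sqrt)
    also have "k * sqrt x < k * (e / k)"
    proof (intro mult_strict_left_mono k)
      show "sqrt x < e / k"
        using ts(4) assms k by (intro real_less_lsqrt) (auto simp: x_def)
    qed
    also have "\<dots> = e" using k by simp
    finally show ?thesis .
  qed
  moreover have "0 < (e / k)\<^sup>2" using assms k by simp
  ultimately show thesis using that by blast
qed

lemma S_minus_Id_small:
  assumes "e > 0"
  obtains d where "d > 0"
    "\<And>h t s. 0 < h \<Longrightarrow> h < d \<Longrightarrow> t \<in> dyadic_points T \<Longrightarrow> s \<in> dyadic_points T \<Longrightarrow> s \<le> t \<Longrightarrow> t + h \<le> T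
      \<Longrightarrow> N (S h (R t s) - R t s) < e"
proof -
  define w where "w h = (SUP (t, s) \<in> {(t, s). t \<in> dyadic_points T \<and> s \<in> dyadic_points T \<and> s \<le> t \<and> t + h \<le> T}.
      ennreal (N (S h (R t s) - R t s)))" for h
  have "(w \<longlongrightarrow> 0) (at_right 0)"
    using rescont unfolding residual_continuity_def w_def R_def .
  then have "\<forall>\<^sub>F h in at_right 0. w h < ennreal e"
    using assms by (intro order_tendstoD) auto
  then obtain d where d: "d > 0" "\<And>h. 0 < h \<Longrightarrow> h < d \<Longrightarrow> w h < ennreal e"
    unfolding eventually_at_right_field by auto
  have "N (S h (R t s) - R t s) < e"
    if "0 < h" "h < d" "t \<in> dyadic_points T" "s \<in> dyadic_points T" "s \<le> t" "t + h \<le> T" for h t s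
  proof -
    have "ennreal (N (S h (R t s) - R t s)) \<le> w h"
      unfolding w_def by (rule SUP_upper2 [of "(t, s)"]) (use that in auto)
    also have "\<dots> < ennreal e" using d(2) that by simp
    finally show ?thesis
      using that R_mem [of t s] assms by (subst (asm) ennreal_less_iff) auto
  qed
  with d(1) that show thesis by blast
qed

text \<open>
  Moving the later time by \<open>h\<close> changes \<open>R\<close> by a residual and a defect over a short interval,
  and by \<open>(S h - Id) R\<close>; nothing but the residual continuity criterion controls the last term.
  Moving the earlier time only produces terms over short intervals.
\<close>

lemma R_uniformly_continuous:
  assumes "e > 0"
  shows "\<exists>d>0. \<forall>t\<in>dyadic_points T. \<forall>s\<in>dyadic_points T.
      \<forall>t'\<in>dyadic_points T. \<forall>s'\<in>dyadic_points T. s \<le> t \<longrightarrow> s' \<le> t' \<longrightarrow> \<bar>t - t'\<bar> < d \<longrightarrow> \<bar>s - s'\<bar> < d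
      \<longrightarrow> N (R t s - R t' s') < e"
proof -
  define \<epsilon> where "\<epsilon> = e / (12 * M)"
  have \<epsilon>: "0 < \<epsilon>" "M * \<epsilon> = e / 12" "\<epsilon> \<le> e / 12" using assms M_ge_1 by (auto simp: \<epsilon>_def field_simps)
  obtain d1 where d1: "d1 > 0" "\<And>t s. t \<in> dyadic_points T \<Longrightarrow> s \<in> dyadic_points T \<Longrightarrow> s \<le> t \<Longrightarrow> t - s < d1
      \<Longrightarrow> N (R t s) < \<epsilon>"
    using R_small [OF \<epsilon>(1)] by metis
  obtain d2 where d2: "d2 > 0" "\<And>h t s. 0 < h \<Longrightarrow> h < d2 \<Longrightarrow> t \<in> dyadic_points T \<Longrightarrow> s \<in> dyadic_points T
      \<Longrightarrow> s \<le> t \<Longrightarrow> t + h \<le> T \<Longrightarrow> N (S h (R t s) - R t s) < \<epsilon>"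
    using S_minus_Id_small [OF \<epsilon>(1)] by metis
  obtain d3 where d3: "d3 > 0" "\<And>t u s. (t, u, s) \<in> Delta3 T \<Longrightarrow> t - u < d3 \<or> u - s < d3 \<Longrightarrow> N (H (t, u, s)) < \<epsilon>"
    using norm3_small [OF ZC1_props(2) [OF H] \<epsilon>(1)] by metis
  define d where "d = min d1 (min d2 d3)"
  have later: "N (R t' s - R t s) < e / 4"
    if ts: "t \<in> dyadic_points T" "t' \<in> dyadic_points T" "s \<in> dyadic_points T" "s \<le> t" "t \<le> t'" "t' - t < d" for t t' s
  proof (cases "t = t'")
    case True
    then show ?thesis using assms by simp
  next
    case False
    have pts: "0 \<le> s" "t' \<le> T" using ts points_le by auto
    have mem: "R t' t \<in> V" "R t s \<in> V" "H (t', t, s) \<in> V" "S (t' - t) (R t s) \<in> V"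
      using ts pts by (auto intro: R_mem H_mem)
    have "R t' s - R t s = R t' t + (S (t' - t) (R t s) - R t s) + H (t', t, s)"
      using R_chain [of s t t'] ts by simp
    also have "N \<dots> \<le> N (R t' t) + N (S (t' - t) (R t s) - R t s) + N (H (t', t, s))"
      using mem by (intro N_triangle3) auto
    also have "N (R t' t) < \<epsilon>" using ts by (intro d1) (auto simp: d_def)
    also have "N (S (t' - t) (R t s) - R t s) < \<epsilon>"
      using ts False pts by (intro d2) (auto simp: d_def)
    also have "N (H (t', t, s)) < \<epsilon>" using ts pts by (intro d3) (auto simp: d_def Delta3_def)
    finally show ?thesis using \<epsilon> by simp
  qed
  have earlier: "N (R t s - R t s') < e / 4"
    if ts: "t \<in> dyadic_points T" "s \<in> dyadic_points T" "s' \<in> dyadic_points T" "s \<le> s'" "s' \<le> t" "s' - s < d" for t s s'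
  proof -
    have pts: "0 \<le> s" "t \<le> T" using ts points_le by auto
    have mem: "R t s' \<in> V" "R s' s \<in> V" "H (t, s', s) \<in> V"
      using ts pts by (auto intro: R_mem H_mem)
    have "R t s - R t s' = S (t - s') (R s' s) + H (t, s', s)"
      using R_chain [of s s' t] ts by simp
    also have "N \<dots> \<le> N (S (t - s') (R s' s)) + N (H (t, s', s))"
      using mem ts by (intro N_triangle) auto
    also have "N (S (t - s') (R s' s)) \<le> M * N (R s' s)"
      using mem ts pts by (intro S_bound) auto
    also have "M * N (R s' s) \<le> M * \<epsilon>"
      using d1(2) [of s' s] ts M_ge_1 by (intro mult_left_mono) (auto simp: d_def)
    also have "N (H (t, s', s)) < \<epsilon>" using ts pts by (intro d3) (auto simp: d_def Delta3_def)
    finally show ?thesis using \<epsilon> assms by simp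
  qed
  have "N (R t s - R t' s') < e"
    if ts: "t \<in> dyadic_points T" "s \<in> dyadic_points T" "t' \<in> dyadic_points T" "s' \<in> dyadic_points T"
      "s \<le> t" "s' \<le> t'" and close: "\<bar>t - t'\<bar> < d" "\<bar>s - s'\<bar> < d" for t s t' s'
  proof -
    \<comment> \<open>Both pairs are compared with the pair \<open>(b, a)\<close> of the larger and the smaller time.\<close>
    define b where "b = max t t'"
    define a where "a = min s s'"
    have half: "N (R b a - R u v) < e / 2"
      if "u \<in> dyadic_points T" "v \<in> dyadic_points T" "v \<le> u" "u \<le> b" "b - u < d" "a \<le> v" "v - a < d" for u v
    proof -
      have ba: "b \<in> dyadic_points T" "a \<in> dyadic_points T" using ts by (auto simp: a_def b_def max_def min_def)
      have "N (R b a - R u v) \<le> N (R b a - R b v) + N (R b v - R u v)"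
        using that ba by (intro N_triangle_sub R_mem) auto
      also have "N (R b a - R b v) < e / 4" using that ba by (intro earlier) auto
      also have "N (R b v - R u v) < e / 4" using that ba by (intro later) auto
      finally show ?thesis by simp
    qed
    have mem: "R t s \<in> V" "R t' s' \<in> V" "R b a \<in> V"
      using ts by (auto simp: a_def b_def max_def min_def intro: R_mem)
    have "N (R t s - R t' s') \<le> N (R t s - R b a) + N (R b a - R t' s')"
      using mem by (intro N_triangle_sub)
    also have "N (R t s - R b a) = N (R b a - R t s)" using mem by (intro N_diff_commute)
    also have "N (R b a - R t s) < e / 2" using ts close by (intro half) (auto simp: a_def b_def)
    also have "N (R b a - R t' s') < e / 2" using ts close by (intro half) (auto simp: a_def b_def)
    finally show ?thesis by simp
  qed
  moreover have "d > 0" using d1 d2 d3 by (simp add: d_def)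
  ultimately show ?thesis by blast
qed

lemma residual_extension:
  obtains g where "extends_residual T S V N \<sigma> H g"
    "\<And>t s. 0 \<le> s \<Longrightarrow> s < t \<Longrightarrow> t \<le> T \<Longrightarrow> N (g (t, s)) \<le> c * ((t - s) * (1 + \<bar>ln (t - s)\<bar>))"
    "\<And>p. p \<in> Delta3 T \<Longrightarrow> hdelta2 S g p = H p"
proof -
  obtain g where g: "g \<in> cont_maps (Delta2 T) V N"
    and gR: "\<And>t s. t \<in> dyadic_points T \<Longrightarrow> s \<in> dyadic_points T \<Longrightarrow> s \<le> t \<Longrightarrow> g (t, s) = R t s"
    using dyadic_extension [OF R_mem R_uniformly_continuous] by blast
  have gseq: "(\<lambda>n. N (g (dfloor n t, dfloor n s) - g (t, s))) \<longlonglongrightarrow> 0"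
    and gmem: "g (t, s) \<in> V" "\<And>n. g (dfloor n t, dfloor n s) \<in> V"
    and gd: "\<And>n. g (dfloor n t, dfloor n s) = R (dfloor n t) (dfloor n s)" if "(t, s) \<in> Delta2 T" for t s
    using that cont_maps_seq [OF g dfloor_pair _ dfloor_pair_tendsto] cont_maps_mem [OF g] dfloor_pair
    by (auto intro!: gR dfloor_mem dfloor_mono simp: Delta2_def)
  have "extends_residual T S V N \<sigma> H g"
    using g gR by (simp add: extends_residual_def R_def)
  moreover have "N (g (t, s)) \<le> c * ((t - s) * (1 + \<bar>ln (t - s)\<bar>))" if ts: "0 \<le> s" "s < t" "t \<le> T" for t s
  proof -
    have p: "(t, s) \<in> Delta2 T" using ts by (simp add: Delta2_def)
    have lim: "(\<lambda>n. dfloor n t - dfloor n s) \<longlonglongrightarrow> t - s"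
      using ts by (intro tendsto_diff dfloor_tendsto) auto
    have "(\<lambda>n. N (g (dfloor n t, dfloor n s))) \<longlonglongrightarrow> N (g (t, s))"
      using gmem [OF p] gseq [OF p] by (intro N_tendsto) auto
    moreover have "(\<lambda>n. c * ((dfloor n t - dfloor n s) * (1 + \<bar>ln (dfloor n t - dfloor n s)\<bar>)))
        \<longlonglongrightarrow> c * ((t - s) * (1 + \<bar>ln (t - s)\<bar>))"
      using ts by (intro tendsto_intros lim) auto
    moreover have "\<forall>\<^sub>F n in sequentially. N (g (dfloor n t, dfloor n s))
        \<le> c * ((dfloor n t - dfloor n s) * (1 + \<bar>ln (dfloor n t - dfloor n s)\<bar>))"
    proof -
      have "\<forall>\<^sub>F n in sequentially. 0 < dfloor n t - dfloor n s"
        using lim ts by (intro order_tendstoD(1)) auto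
      then show ?thesis
        by eventually_elim (use ts gd [OF p] in \<open>auto intro!: log dfloor_mem\<close>)
    qed
    ultimately show ?thesis by (intro tendsto_le [OF _ _ _ _ ]) auto
  qed
  moreover have "hdelta2 S g p = H p" if p: "p \<in> Delta3 T" for p
  proof -
    obtain t u s where p_eq: "p = (t, u, s)" by (cases p)
    have sut: "0 \<le> s" "s \<le> u" "u \<le> t" "t \<le> T" using p by (auto simp: p_eq Delta3_def)
    then have P: "(t, s) \<in> Delta2 T" "(t, u) \<in> Delta2 T" "(u, s) \<in> Delta2 T" by (auto simp: Delta2_def)
    define \<tau> where "\<tau> n = dfloor n t - dfloor n u" for n
    have pts: "dfloor n s \<in> dyadic_points T" "dfloor n u \<in> dyadic_points T" "dfloor n t \<in> dyadic_points T"
      "dfloor n s \<le> dfloor n u" "dfloor n u \<le> dfloor n t" for n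
      using sut by (auto intro: dfloor_mem dfloor_mono)
    have \<tau>: "0 \<le> \<tau> n" "\<tau> n \<le> T" for n
      using pts [of n] points_le(2) [of "dfloor n t"] points_le(1) [of "dfloor n u"] by (auto simp: \<tau>_def)
    have \<tau>lim: "\<tau> \<longlonglongrightarrow> t - u"
      unfolding \<tau>_def using sut by (intro tendsto_diff dfloor_tendsto) auto
    have mem3: "(dfloor n t, dfloor n u, dfloor n s) \<in> Delta3 T" for n
      using pts [of n] points_le(1) [of "dfloor n s"] points_le(2) [of "dfloor n t"] by (simp add: Delta3_def)
    define a where "a n = g (dfloor n t, dfloor n s)" for n
    define b where "b n = g (dfloor n t, dfloor n u)" for n
    define y where "y n = S (\<tau> n) (g (dfloor n u, dfloor n s))" for n
    let ?y = "S (t - u) (g (u, s))"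
    have mem: "a n \<in> V" "b n \<in> V" "y n \<in> V" "g (t, s) \<in> V" "g (t, u) \<in> V" "?y \<in> V" for n
      using gmem P \<tau> sut by (auto simp: a_def b_def y_def)
    have eq: "a n - b n - y n = H (dfloor n t, dfloor n u, dfloor n s)" for n
      using R_chain [OF pts(1,2,3,4,5)] gd P by (simp add: a_def b_def y_def \<tau>_def)
    have "(\<lambda>n. N (a n - g (t, s))) \<longlonglongrightarrow> 0" "(\<lambda>n. N (b n - g (t, u))) \<longlonglongrightarrow> 0"
      unfolding a_def b_def using gseq P by auto
    moreover have "(\<lambda>n. N (y n - ?y)) \<longlonglongrightarrow> 0"
      unfolding y_def using \<tau> \<tau>lim sut gmem P gseq by (intro S_tendsto) auto
    ultimately have sum0: "(\<lambda>n. N (a n - g (t, s)) + N (b n - g (t, u)) + N (y n - ?y)) \<longlonglongrightarrow> 0 + 0 + 0"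
      by (intro tendsto_add)
    have "(\<lambda>n. N ((a n - b n - y n) - (g (t, s) - g (t, u) - ?y))) \<longlonglongrightarrow> 0"
    proof (rule Lim_null_comparison)
      show "\<forall>\<^sub>F n in sequentially. norm (N ((a n - b n - y n) - (g (t, s) - g (t, u) - ?y)))
          \<le> N (a n - g (t, s)) + N (b n - g (t, u)) + N (y n - ?y)"
      proof (intro always_eventually allI)
        fix n
        define x1 x2 x3 where "x1 = a n - g (t, s)" and "x2 = b n - g (t, u)" and "x3 = y n - ?y"
        have x: "x1 \<in> V" "x2 \<in> V" "x3 \<in> V" using mem by (auto simp: x1_def x2_def x3_def)
        have "(a n - b n - y n) - (g (t, s) - g (t, u) - ?y) = (x1 - x2) - x3"
          by (simp add: x1_def x2_def x3_def algebra_simps)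
        moreover have "N ((x1 - x2) - x3) \<le> N x1 + N x2 + N x3" "0 \<le> N ((x1 - x2) - x3)"
          using x N_diff_le [of "x1 - x2" x3] N_diff_le [of x1 x2] mem_diff [OF mem_diff [OF x(1,2)] x(3)]
            N_nonneg [of "x1 - x2 - x3"] by auto
        ultimately show "norm (N ((a n - b n - y n) - (g (t, s) - g (t, u) - ?y)))
            \<le> N (a n - g (t, s)) + N (b n - g (t, u)) + N (y n - ?y)"
          by (simp only: real_norm_def abs_of_nonneg flip: x1_def x2_def x3_def)
      qed
      show "(\<lambda>n. N (a n - g (t, s)) + N (b n - g (t, u)) + N (y n - ?y)) \<longlonglongrightarrow> 0"
        using sum0 by simp
    qed
    moreover have "(\<lambda>n. N ((a n - b n - y n) - H (t, u, s))) \<longlonglongrightarrow> 0"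
      unfolding eq
    proof (rule cont_maps_seq [OF ZC1_props(1) [OF H]])
      show "(\<lambda>n. (dfloor n t, dfloor n u, dfloor n s)) \<longlonglongrightarrow> (t, u, s)"
        using sut by (intro tendsto_Pair dfloor_tendsto) auto
    qed (use mem3 p in \<open>auto simp: p_eq\<close>)
    ultimately have "g (t, s) - g (t, u) - ?y = H (t, u, s)"
      using mem sut by (intro limit_unique [of "\<lambda>n. a n - b n - y n"]) (auto intro!: H_mem)
    then show ?thesis by (simp add: hdelta2_def p_eq)
  qed
  ultimately show thesis using that by blast
qed

end

text \<open>
  The two constants enter at different places: \<open>C\<^sub>H\<close> through the residuals on dyadic intervals, the
  norm of \<open>H\<close> through the defects created when those intervals are put together.
\<close>

lemma critical_sewing:
  assumes est: "critical_estimate T S N C_H C \<eta> \<sigma> H" and C: "0 \<le> C" "0 \<le> C_H" "0 < \<eta>"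
    and rescont: "residual_continuity T S N \<sigma> H"
  obtains g where "extends_residual T S V N \<sigma> H g"
    "\<And>t s. 0 \<le> s \<Longrightarrow> s < t \<Longrightarrow> t \<le> T \<Longrightarrow> N (g (t, s))
      \<le> log_const T M * (2 * growth_const T C \<eta> + 1) * (C_H + enn2real (norm3 T V N H))
        * ((t - s) * (1 + \<bar>ln (t - s)\<bar>))"
    "\<And>p. p \<in> Delta3 T \<Longrightarrow> hdelta2 S g p = H p"
proof -
  define G where "G = growth_const T C \<eta>"
  define K where "K = enn2real (norm3 T V N H)"
  define A where "A = 2 * G * C_H"
  have G: "0 < G" by (simp add: G_def growth_const_def)
  have AK: "0 \<le> A" "0 \<le> K" using G C by (auto simp: A_def K_def)
  have piece: "N (R y x) \<le> A * real n * (T / 2 ^ n)"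
    if "x \<in> dyadic_level T n" "y \<in> dyadic_level T n" "y = x + T / 2 ^ n" for x y n
  proof -
    have "N (R y x) \<le> 2 * critical_factor T C \<eta> n * C_H * real n * (T / 2 ^ n)"
      using est C that by (intro interval_bound)
    also have "\<dots> \<le> A * real n * (T / 2 ^ n)"
      unfolding A_def G_def using C T_pos
      by (intro mult_right_mono mult_left_mono critical_factor_bounded) auto
    finally show ?thesis .
  qed
  have defect: "N (H (t, u, s)) \<le> K * (t - s)" if "(t, u, s) \<in> Delta3 T" for t u s
    unfolding K_def using ZC1_props(2) [OF H] that by (rule norm3_bound)
  have refl0: "R t t = 0" if "t \<in> dyadic_points T" for t
    by (rule R_refl_0 [OF AK piece defect that])
  define c where "c = log_const T M * (2 * G + 1) * (C_H + K)"
  have lc: "0 \<le> log_const T M" using M_ge_1 by (simp add: log_const_def)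
  have c: "0 \<le> c" using lc G C AK by (simp add: c_def)
  have "N (R t s) \<le> c * ((t - s) * (1 + \<bar>ln (t - s)\<bar>))"
    if ts: "t \<in> dyadic_points T" "s \<in> dyadic_points T" "s < t" for t s
  proof -
    have "N (R t s) \<le> log_const T M * (A + K) * ((t - s) * (1 + \<bar>ln (t - s)\<bar>))"
      by (rule log_bound [OF AK piece defect ts(2,1,3)])
    also have "\<dots> \<le> log_const T M * ((2 * G + 1) * (C_H + K)) * ((t - s) * (1 + \<bar>ln (t - s)\<bar>))"
    proof (intro mult_right_mono mult_left_mono lc)
      have "0 \<le> G * K" using G AK by simp
      then show "A + K \<le> (2 * G + 1) * (C_H + K)" using C by (simp add: A_def algebra_simps)
      show "0 \<le> (t - s) * (1 + \<bar>ln (t - s)\<bar>)" using ts by (intro mult_nonneg_nonneg) auto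
    qed
    finally show ?thesis by (simp add: c_def mult.assoc)
  qed
  then obtain g where "extends_residual T S V N \<sigma> H g"
    "\<And>t s. 0 \<le> s \<Longrightarrow> s < t \<Longrightarrow> t \<le> T \<Longrightarrow> N (g (t, s)) \<le> c * ((t - s) * (1 + \<bar>ln (t - s)\<bar>))"
    "\<And>p. p \<in> Delta3 T \<Longrightarrow> hdelta2 S g p = H p"
    using residual_extension [OF c _ refl0 rescont] by metis
  then show thesis using that by (simp add: c_def G_def K_def)
qed

end

section \<open>Linearity and the selection operator\<close>

context banach_interval
begin

lemma cont_maps_add:
  assumes g: "g \<in> cont_maps X V N" and h: "h \<in> cont_maps X V N"
  shows "(\<lambda>q. g q + h q) \<in> cont_maps X V N"
  unfolding cont_maps_def
proof (intro CollectI conjI ballI allI impI)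
  fix p assume p: "p \<in> X"
  then show "g p + h p \<in> V" using g h by (auto intro: cont_maps_mem)
  have "((\<lambda>q. N (g q - g p) + N (h q - h p)) \<longlongrightarrow> 0 + 0) (at p within X)"
    using g h p by (intro tendsto_add) (auto simp: cont_maps_def)
  then have lim: "((\<lambda>q. N (g q - g p) + N (h q - h p)) \<longlongrightarrow> 0) (at p within X)" by simp
  have "norm (N (g q + h q - (g p + h p))) \<le> N (g q - g p) + N (h q - h p)" if "q \<in> X" for q
  proof -
    have mem: "g q - g p \<in> V" "h q - h p \<in> V" using g h p that by (auto intro: cont_maps_mem)
    have "g q + h q - (g p + h p) = (g q - g p) + (h q - h p)" by simp
    then show ?thesis using N_triangle [OF mem] N_nonneg [OF mem_add [OF mem]]
      by (simp only: real_norm_def abs_of_nonneg)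
  qed
  then have "\<forall>\<^sub>F q in at p within X. norm (N (g q + h q - (g p + h p))) \<le> N (g q - g p) + N (h q - h p)"
    by (simp add: eventually_at_filter)
  then show "((\<lambda>q. N (g q + h q - (g p + h p))) \<longlongrightarrow> 0) (at p within X)"
    using lim by (rule Lim_null_comparison)
next
  fix p assume "p \<notin> X"
  then have "g p = 0" "h p = 0" using g h unfolding cont_maps_def by blast+
  then show "g p + h p = 0" by simp
qed

lemma cont_maps_scale:
  assumes g: "g \<in> cont_maps X V N"
  shows "(\<lambda>q. r *\<^sub>R g q) \<in> cont_maps X V N"
  unfolding cont_maps_def
proof (intro CollectI conjI ballI allI impI)
  fix p assume p: "p \<in> X"
  then show "r *\<^sub>R g p \<in> V" using g by (auto intro: cont_maps_mem)
  have "((\<lambda>q. N (g q - g p)) \<longlongrightarrow> 0) (at p within X)"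
    using g p by (auto simp: cont_maps_def)
  then have "((\<lambda>q. \<bar>r\<bar> * N (g q - g p)) \<longlongrightarrow> 0) (at p within X)"
    by (rule tendsto_mult_right_zero)
  moreover have "\<forall>\<^sub>F q in at p within X. \<bar>r\<bar> * N (g q - g p) = N (r *\<^sub>R g q - r *\<^sub>R g p)"
    using g p by (auto simp: eventually_at_filter N_scale cont_maps_mem simp flip: scaleR_diff_right)
  ultimately show "((\<lambda>q. N (r *\<^sub>R g q - r *\<^sub>R g p)) \<longlongrightarrow> 0) (at p within X)"
    by (rule Lim_transform_eventually)
next
  fix p assume "p \<notin> X"
  then have "g p = 0" using g unfolding cont_maps_def by blast
  then show "r *\<^sub>R g p = 0" by simp
qed

end

text \<open>
  A family with vanishing defect is determined by its values on dyadic intervals: intervals of a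
  common level are removed one at a time from the right end of \<open>[s, t]\<close>.
\<close>

lemma (in semigroup_interval) dyadic_cocycle_zero:
  assumes mem: "\<And>t s. t \<in> dyadic_points T \<Longrightarrow> s \<in> dyadic_points T \<Longrightarrow> s \<le> t \<Longrightarrow> E t s \<in> V"
    and chain: "\<And>t u s. s \<in> dyadic_points T \<Longrightarrow> u \<in> dyadic_points T \<Longrightarrow> t \<in> dyadic_points T
      \<Longrightarrow> s \<le> u \<Longrightarrow> u \<le> t \<Longrightarrow> E t s = E t u + S (t - u) (E u s)"
    and zero: "\<And>a c. (a, c) \<in> dyadic_intervals T \<Longrightarrow> E c a = 0"
    and s: "s \<in> dyadic_points T" and t: "t \<in> dyadic_points T" and st: "s \<le> t"
  shows "E t s = 0"
proof -
  have refl: "E x x = 0" if "x \<in> dyadic_points T" for x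
    using chain [of x x x] mem [of x x] that by simp
  have "{s, t} \<subseteq> dyadic_points T" using s t by simp
  then obtain n where n: "{s, t} \<subseteq> dyadic_level T n"
    using points_common_level [of "{s, t}"] by blast
  have "E t s = 0" if "t \<in> dyadic_level T n" "s \<le> t" "t \<le> s + real j * (T / 2 ^ n)" for t j
    using that
  proof (induction j arbitrary: t)
    case 0
    then show ?case using refl s by simp
  next
    case (Suc j)
    show ?case
    proof (cases "s = t")
      case False
      define u where "u = t - T / 2 ^ n"
      have u: "u \<in> dyadic_level T n" "s \<le> u" "(u, t) \<in> dyadic_intervals T"
        using level_neighbours(2,3,5) [of s n t] n Suc.prems False by (auto simp: u_def)
      have ut: "u \<le> t" using T_pos by (simp add: u_def)
      have "u \<le> s + real j * (T / 2 ^ n)" using Suc.prems(3) by (simp add: u_def distrib_right add_divide_distrib)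
      then have "E u s = 0" using u by (intro Suc.IH)
      moreover have "E t s = E t u + S (t - u) (E u s)"
        using u ut Suc.prems(1) s level_subset_points by (intro chain) auto
      ultimately show ?thesis using zero [OF u(3)] ut by simp
    qed (use refl s in simp)
  qed
  moreover obtain j where "(t - s) / (T / 2 ^ n) \<le> real j" using real_arch_simple by blast
  then have "t - s \<le> real j * (T / 2 ^ n)"
    using T_pos by (subst (asm) pos_divide_le_eq) auto
  then have "t \<le> s + real j * (T / 2 ^ n)" by simp
  ultimately show ?thesis using n st by blast
qed

context banach_interval
begin

lemma norm_log_leI:
  assumes c: "0 \<le> c" and g: "\<And>t s. 0 \<le> s \<Longrightarrow> s < t \<Longrightarrow> t \<le> T
    \<Longrightarrow> N (g (t, s)) \<le> c * ((t - s) * (1 + \<bar>ln (t - s)\<bar>))"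
  shows "norm_log T N g \<le> ennreal c"
  unfolding norm_log_def
proof (rule SUP_least, clarify)
  fix t s :: real assume ts: "0 \<le> s" "s < t" "t \<le> T"
  then have "0 < (t - s) * (1 + \<bar>ln (t - s)\<bar>)"
    by (intro mult_pos_pos) auto
  then show "ennreal (N (g (t, s)) / (\<bar>t - s\<bar> * (1 + \<bar>ln \<bar>t - s\<bar>\<bar>))) \<le> ennreal c"
    using g [OF ts] ts by (intro ennreal_leI) (simp add: divide_le_eq)
qed

lemma norm2_leI:
  assumes c: "0 \<le> c" and \<epsilon>: "0 < \<epsilon>" and g: "\<And>t s. 0 \<le> s \<Longrightarrow> s < t \<Longrightarrow> t \<le> T
    \<Longrightarrow> N (g (t, s)) \<le> c * ((t - s) * (1 + \<bar>ln (t - s)\<bar>))"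
  shows "norm2 T N (1 - \<epsilon>) g \<le> ennreal (c * (T powr \<epsilon> + 1 / \<epsilon> + T * T powr \<epsilon>))"
  unfolding norm2_def
proof (rule SUP_least, clarify)
  fix t s :: real assume ts: "0 \<le> s" "s < t" "t \<le> T"
  have "N (g (t, s)) \<le> c * ((t - s) * (1 + \<bar>ln (t - s)\<bar>))" using g [OF ts] .
  also have "\<dots> \<le> c * ((T powr \<epsilon> + 1 / \<epsilon> + T * T powr \<epsilon>) * (t - s) powr (1 - \<epsilon>))"
    using ts \<epsilon> c by (intro mult_left_mono log_weight_le) auto
  finally show "ennreal (N (g (t, s)) / \<bar>t - s\<bar> powr (1 - \<epsilon>))
      \<le> ennreal (c * (T powr \<epsilon> + 1 / \<epsilon> + T * T powr \<epsilon>))"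
    using ts by (intro ennreal_leI) (simp add: divide_le_eq mult.assoc)
qed

lemma extends_residual_unique:
  assumes "extends_residual T S V N \<sigma> H g" "extends_residual T S V N \<sigma> H g'"
  shows "g = g'"
  using assms unfolding extends_residual_def by (intro cont_maps_dyadic_unique) auto

end

context semigroup_interval
begin

lemma sel_resid_add:
  assumes HK: "H \<in> ZC1 T S V N" "K \<in> ZC1 T S V N" "(\<lambda>p. H p + K p) \<in> ZC1 T S V N"
    and rules: "splitting_rule T S V \<sigma>\<^sub>H H" "splitting_rule T S V \<sigma>\<^sub>K K" "splitting_rule T S V \<sigma> (\<lambda>p. H p + K p)"
    and lin: "\<And>a c. (a, c) \<in> dyadic_intervals T \<Longrightarrow>
      sel_resid T S \<sigma> (\<lambda>p. H p + K p) c a = sel_resid T S \<sigma>\<^sub>H H c a + sel_resid T S \<sigma>\<^sub>K K c a"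
    and ts: "t \<in> dyadic_points T" "s \<in> dyadic_points T" "s \<le> t"
  shows "sel_resid T S \<sigma> (\<lambda>p. H p + K p) t s = sel_resid T S \<sigma>\<^sub>H H t s + sel_resid T S \<sigma>\<^sub>K K t s"
proof -
  interpret H: selected_residual V N T S M H \<sigma>\<^sub>H using HK rules by unfold_locales
  interpret K: selected_residual V N T S M K \<sigma>\<^sub>K using HK rules by unfold_locales
  interpret HK: selected_residual V N T S M "\<lambda>p. H p + K p" \<sigma> using HK rules by unfold_locales
  have "HK.R t s - (H.R t s + K.R t s) = 0"
  proof (rule dyadic_cocycle_zero [where E = "\<lambda>t s. HK.R t s - (H.R t s + K.R t s)", OF _ _ _ ts(2,1,3)])
    fix t u s assume p: "s \<in> dyadic_points T" "u \<in> dyadic_points T" "t \<in> dyadic_points T" "s \<le> u" "u \<le> t"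
    have "H.R u s \<in> V" "K.R u s \<in> V" "HK.R u s \<in> V"
      using p H.R_mem K.R_mem HK.R_mem by auto
    then show "HK.R t s - (H.R t s + K.R t s)
        = HK.R t u - (H.R t u + K.R t u) + S (t - u) (HK.R u s - (H.R u s + K.R u s))"
      using p H.R_chain [OF p] K.R_chain [OF p] HK.R_chain [OF p] by (simp add: S_diff S_add)
  qed (use H.R_mem K.R_mem HK.R_mem lin in \<open>auto simp: H.R_def K.R_def HK.R_def\<close>)
  then show ?thesis by (simp add: H.R_def K.R_def HK.R_def)
qed

lemma sel_resid_scale:
  assumes H: "H \<in> ZC1 T S V N" "(\<lambda>p. r *\<^sub>R H p) \<in> ZC1 T S V N"
    and rules: "splitting_rule T S V \<sigma>\<^sub>H H" "splitting_rule T S V \<sigma> (\<lambda>p. r *\<^sub>R H p)"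
    and lin: "\<And>a c. (a, c) \<in> dyadic_intervals T \<Longrightarrow>
      sel_resid T S \<sigma> (\<lambda>p. r *\<^sub>R H p) c a = r *\<^sub>R sel_resid T S \<sigma>\<^sub>H H c a"
    and ts: "t \<in> dyadic_points T" "s \<in> dyadic_points T" "s \<le> t"
  shows "sel_resid T S \<sigma> (\<lambda>p. r *\<^sub>R H p) t s = r *\<^sub>R sel_resid T S \<sigma>\<^sub>H H t s"
proof -
  interpret H: selected_residual V N T S M H \<sigma>\<^sub>H using H rules by unfold_locales
  interpret rH: selected_residual V N T S M "\<lambda>p. r *\<^sub>R H p" \<sigma> using H rules by unfold_locales
  have "rH.R t s - r *\<^sub>R H.R t s = 0"
  proof (rule dyadic_cocycle_zero [where E = "\<lambda>t s. rH.R t s - r *\<^sub>R H.R t s", OF _ _ _ ts(2,1,3)])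
    fix t u s assume p: "s \<in> dyadic_points T" "u \<in> dyadic_points T" "t \<in> dyadic_points T" "s \<le> u" "u \<le> t"
    have "H.R u s \<in> V" "rH.R u s \<in> V"
      using p H.R_mem rH.R_mem by auto
    then show "rH.R t s - r *\<^sub>R H.R t s
        = rH.R t u - r *\<^sub>R H.R t u + S (t - u) (rH.R u s - r *\<^sub>R H.R u s)"
      using p H.R_chain [OF p] rH.R_chain [OF p] by (simp add: S_diff S_scale scaleR_add_right)
  qed (use H.R_mem rH.R_mem lin in \<open>auto simp: H.R_def rH.R_def\<close>)
  then show ?thesis by (simp add: H.R_def rH.R_def)
qed

definition sewing_const :: "real \<Rightarrow> real \<Rightarrow> real" where
  "sewing_const C \<eta> = log_const T M * (2 * growth_const T C \<eta> + 1)"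

lemma sewing_const_pos: "0 < sewing_const C \<eta>"
  using M_ge_1 by (simp add: sewing_const_def log_const_def growth_const_def add_pos_pos)

lemma single_defect:
  assumes "0 < C" "0 < \<eta>" "0 < C_H" and H: "H \<in> ZC1 T S V N" and rule: "splitting_rule T S V \<sigma> H"
    and est: "critical_estimate T S N C_H C \<eta> \<sigma> H" and rescont: "residual_continuity T S N \<sigma> H"
  shows "\<exists>g. extends_residual T S V N \<sigma> H g \<and> (\<forall>g'. extends_residual T S V N \<sigma> H g' \<longrightarrow> g' = g) \<and>
    norm_log T N g \<le> ennreal (sewing_const C \<eta>) * (norm3 T V N H + ennreal C_H)"
proof -
  interpret selected_residual V N T S M H \<sigma> using H rule by unfold_locales
  define K where "K = enn2real (norm3 T V N H)"
  have K: "0 \<le> K" "norm3 T V N H = ennreal K"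
    using ZC1_props(2) [OF H] by (simp_all add: K_def)
  obtain g where g: "extends_residual T S V N \<sigma> H g"
    and log: "\<And>t s. 0 \<le> s \<Longrightarrow> s < t \<Longrightarrow> t \<le> T \<Longrightarrow> N (g (t, s))
      \<le> sewing_const C \<eta> * (C_H + K) * ((t - s) * (1 + \<bar>ln (t - s)\<bar>))"
    using critical_sewing [OF est _ _ _ rescont] assms unfolding sewing_const_def K_def
    by (metis less_imp_le)
  have "norm_log T N g \<le> ennreal (sewing_const C \<eta> * (C_H + K))"
    using log sewing_const_pos [of C \<eta>] assms K by (intro norm_log_leI) auto
  also have "\<dots> = ennreal (sewing_const C \<eta>) * (norm3 T V N H + ennreal C_H)"
    using assms K sewing_const_pos [of C \<eta>]
    by (simp add: ennreal_mult' add.commute flip: ennreal_plus)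
  finally show ?thesis using g extends_residual_unique by blast
qed

text \<open>
  On a selection domain \<open>C\<^sub>H\<close> is absorbed by the norm of \<open>H\<close>. Both sides of a linearity relation for
  \<open>\<Lambda>\<close> extend the same residual, so they agree, and linearity turns the bound into continuity.
\<close>

lemma selection_operator:
  assumes pos: "0 < C" "0 < \<eta>" "0 < C_s" and dom: "selection_domain T S V N C \<eta> C_s \<sigma> D"
  defines "c \<equiv> sewing_const C \<eta> * (C_s + 1)"
  shows "\<exists>\<Lambda>.
    (\<forall>H\<in>D. extends_residual T S V N (\<sigma> H) H (\<Lambda> H)) \<and>
    (\<forall>\<Lambda>'. (\<forall>H\<in>D. extends_residual T S V N (\<sigma> H) H (\<Lambda>' H)) \<longrightarrow> (\<forall>H\<in>D. \<Lambda>' H = \<Lambda> H)) \<and>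
    continuous_linear_selection T V N D \<Lambda> \<and>
    (\<forall>H\<in>D. \<forall>p\<in>Delta3 T. hdelta2 S (\<Lambda> H) p = H p) \<and>
    (\<forall>H\<in>D. norm_log T N (\<Lambda> H) \<le> ennreal c * norm3 T V N H) \<and>
    (\<forall>\<epsilon>. 0 < \<epsilon> \<and> \<epsilon> < 1 \<longrightarrow> (\<forall>H\<in>D. norm2 T N (1 - \<epsilon>) (\<Lambda> H)
      \<le> ennreal (c * (T powr \<epsilon> + 1 / \<epsilon> + T * T powr \<epsilon>)) * norm3 T V N H))"
proof -
  have D: "H \<in> ZC1 T S V N" "splitting_rule T S V (\<sigma> H) H" "residual_continuity T S N (\<sigma> H) H"
    "\<exists>C_H\<ge>0. ennreal C_H \<le> ennreal C_s * norm3 T V N H \<and> critical_estimate T S N C_H C \<eta> (\<sigma> H) H"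
    if "H \<in> D" for H
    using dom that unfolding selection_domain_def by blast+
  have D_add: "(\<lambda>p. H p + K p) \<in> D" if "H \<in> D" "K \<in> D" for H K
    using dom that unfolding selection_domain_def by blast
  have D_scale: "(\<lambda>p. r *\<^sub>R H p) \<in> D" if "H \<in> D" for H r
    using dom that unfolding selection_domain_def by blast
  have lin: "linear_rule T S \<sigma> D"
    using dom unfolding selection_domain_def by blast
  have lin_add: "sel_resid T S (\<sigma> (\<lambda>p. H p + K p)) (\<lambda>p. H p + K p) u v
      = sel_resid T S (\<sigma> H) H u v + sel_resid T S (\<sigma> K) K u v"
    if "H \<in> D" "K \<in> D" "(v, u) \<in> dyadic_intervals T" for H K u v
    using bspec [OF bspec [OF bspec [OF conjunct1 [OF lin [unfolded linear_rule_def]] that(1)] that(2)] that(3)]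
    by simp
  have lin_scale: "sel_resid T S (\<sigma> (\<lambda>p. r *\<^sub>R H p)) (\<lambda>p. r *\<^sub>R H p) u v = r *\<^sub>R sel_resid T S (\<sigma> H) H u v"
    if "H \<in> D" "(v, u) \<in> dyadic_intervals T" for H r u v
    using bspec [OF spec [OF bspec [OF conjunct2 [OF lin [unfolded linear_rule_def]] that(1)], of r] that(2)]
    by simp
  have c_pos: "0 < c" using sewing_const_pos pos by (simp add: c_def)
  define k where "k H = enn2real (norm3 T V N H)" for H
  have k: "0 \<le> k H" "norm3 T V N H = ennreal (k H)" if "H \<in> D" for H
    using ZC1_props(2) [OF D(1) [OF that]] by (simp_all add: k_def)
  have "\<exists>g. extends_residual T S V N (\<sigma> H) H g \<and>
      (\<forall>t s. 0 \<le> s \<longrightarrow> s < t \<longrightarrow> t \<le> T \<longrightarrow> N (g (t, s)) \<le> c * k H * ((t - s) * (1 + \<bar>ln (t - s)\<bar>))) \<and>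
      (\<forall>p\<in>Delta3 T. hdelta2 S g p = H p)" if HD: "H \<in> D" for H
  proof -
    interpret selected_residual V N T S M H "\<sigma> H" using D [OF HD] by unfold_locales
    obtain C_H where C_H: "0 \<le> C_H" "ennreal C_H \<le> ennreal C_s * norm3 T V N H"
      and est: "critical_estimate T S N C_H C \<eta> (\<sigma> H) H"
      using D(4) [OF HD] by blast
    obtain g where g: "extends_residual T S V N (\<sigma> H) H g"
      and log: "\<And>t s. 0 \<le> s \<Longrightarrow> s < t \<Longrightarrow> t \<le> T \<Longrightarrow> N (g (t, s))
        \<le> sewing_const C \<eta> * (C_H + k H) * ((t - s) * (1 + \<bar>ln (t - s)\<bar>))"
      and \<delta>: "\<And>p. p \<in> Delta3 T \<Longrightarrow> hdelta2 S g p = H p"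
      using critical_sewing [OF est _ C_H(1) pos(2) D(3) [OF HD]] pos unfolding sewing_const_def k_def
      by (metis less_imp_le)
    have "ennreal C_H \<le> ennreal (C_s * k H)"
      using C_H(2) pos k [OF HD] by (simp add: ennreal_mult')
    then have "C_H \<le> C_s * k H" using pos k [OF HD] by (simp add: ennreal_le_iff)
    then have CK: "sewing_const C \<eta> * (C_H + k H) \<le> c * k H"
      unfolding c_def mult.assoc using sewing_const_pos
      by (intro mult_left_mono) (auto simp: algebra_simps less_imp_le)
    have "N (g (t, s)) \<le> c * k H * ((t - s) * (1 + \<bar>ln (t - s)\<bar>))" if "0 \<le> s" "s < t" "t \<le> T" for t s
      using log [OF that] by (rule order_trans) (use that in \<open>intro mult_right_mono CK mult_nonneg_nonneg; simp\<close>)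
    with g \<delta> show ?thesis by blast
  qed
  then obtain \<Lambda> where ext: "\<And>H. H \<in> D \<Longrightarrow> extends_residual T S V N (\<sigma> H) H (\<Lambda> H)"
    and log: "\<And>H t s. H \<in> D \<Longrightarrow> 0 \<le> s \<Longrightarrow> s < t \<Longrightarrow> t \<le> T
      \<Longrightarrow> N (\<Lambda> H (t, s)) \<le> c * k H * ((t - s) * (1 + \<bar>ln (t - s)\<bar>))"
    and \<delta>: "\<And>H p. H \<in> D \<Longrightarrow> p \<in> Delta3 T \<Longrightarrow> hdelta2 S (\<Lambda> H) p = H p"
    by metis
  have bound: "norm_log T N (\<Lambda> H) \<le> ennreal c * norm3 T V N H" if H: "H \<in> D" for H
  proof -
    have "norm_log T N (\<Lambda> H) \<le> ennreal (c * k H)"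
      using log [OF H] c_pos k [OF H] by (intro norm_log_leI) auto
    then show ?thesis using c_pos k [OF H] by (simp add: ennreal_mult')
  qed
  have bound2: "norm2 T N (1 - \<epsilon>) (\<Lambda> H) \<le> ennreal (c * (T powr \<epsilon> + 1 / \<epsilon> + T * T powr \<epsilon>)) * norm3 T V N H"
    if H: "H \<in> D" and \<epsilon>: "0 < \<epsilon>" for H \<epsilon>
  proof -
    have "norm2 T N (1 - \<epsilon>) (\<Lambda> H) \<le> ennreal (c * k H * (T powr \<epsilon> + 1 / \<epsilon> + T * T powr \<epsilon>))"
      using log [OF H] c_pos k [OF H] \<epsilon> by (intro norm2_leI) auto
    also have "c * k H * (T powr \<epsilon> + 1 / \<epsilon> + T * T powr \<epsilon>) = c * (T powr \<epsilon> + 1 / \<epsilon> + T * T powr \<epsilon>) * k H"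
      by (simp add: algebra_simps)
    also have "ennreal \<dots> = ennreal (c * (T powr \<epsilon> + 1 / \<epsilon> + T * T powr \<epsilon>)) * norm3 T V N H"
      using k [OF H] by (simp add: ennreal_mult'')
    finally show ?thesis .
  qed
  have cont: "\<Lambda> H \<in> cont_maps (Delta2 T) V N" if "H \<in> D" for H
    using ext [OF that] by (simp add: extends_residual_def)
  have add: "\<Lambda> (\<lambda>p. H p + K p) = (\<lambda>q. \<Lambda> H q + \<Lambda> K q)" if H: "H \<in> D" and K: "K \<in> D" for H K
  proof (rule extends_residual_unique [OF ext [OF D_add [OF H K]]])
    have "sel_resid T S (\<sigma> (\<lambda>p. H p + K p)) (\<lambda>p. H p + K p) t s
        = sel_resid T S (\<sigma> H) H t s + sel_resid T S (\<sigma> K) K t s"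
      if "t \<in> dyadic_points T" "s \<in> dyadic_points T" "s \<le> t" for t s
      by (rule sel_resid_add [OF D(1) [OF H] D(1) [OF K] D(1) [OF D_add [OF H K]]
            D(2) [OF H] D(2) [OF K] D(2) [OF D_add [OF H K]] lin_add [OF H K] that])
    then show "extends_residual T S V N (\<sigma> (\<lambda>p. H p + K p)) (\<lambda>p. H p + K p) (\<lambda>q. \<Lambda> H q + \<Lambda> K q)"
      using ext [OF H] ext [OF K] by (auto simp: extends_residual_def intro: cont_maps_add)
  qed
  have scale: "\<Lambda> (\<lambda>p. r *\<^sub>R H p) = (\<lambda>q. r *\<^sub>R \<Lambda> H q)" if H: "H \<in> D" for H r
  proof (rule extends_residual_unique [OF ext [OF D_scale [OF H]]])
    have "sel_resid T S (\<sigma> (\<lambda>p. r *\<^sub>R H p)) (\<lambda>p. r *\<^sub>R H p) t s = r *\<^sub>R sel_resid T S (\<sigma> H) H t s"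
      if "t \<in> dyadic_points T" "s \<in> dyadic_points T" "s \<le> t" for t s
      by (rule sel_resid_scale [OF D(1) [OF H] D(1) [OF D_scale [OF H]]
            D(2) [OF H] D(2) [OF D_scale [OF H]] lin_scale [OF H] that])
    then show "extends_residual T S V N (\<sigma> (\<lambda>p. r *\<^sub>R H p)) (\<lambda>p. r *\<^sub>R H p) (\<lambda>q. r *\<^sub>R \<Lambda> H q)"
      using ext [OF H] by (auto simp: extends_residual_def intro: cont_maps_scale)
  qed
  have "continuous_linear_selection T V N D \<Lambda>"
    unfolding continuous_linear_selection_def
  proof (intro conjI ballI allI impI subsetI)
    fix g assume "g \<in> \<Lambda> ` D"
    then obtain H where H: "H \<in> D" "g = \<Lambda> H" by blast
    have "norm_log T N (\<Lambda> H) < \<infinity>"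
      by (rule le_less_trans [OF bound [OF H(1)]]) (simp add: k [OF H(1)] ennreal_mult_less_top)
    then show "g \<in> C1_log T V N" using cont H by (simp add: C1_log_def)
  next
    fix H and e :: ennreal assume H: "H \<in> D" and e: "0 < e"
    have "norm_log T N (\<lambda>q. \<Lambda> K q - \<Lambda> H q) < e"
      if K: "K \<in> D" and small: "norm3 T V N (\<lambda>p. K p - H p) < e / ennreal c" for K
    proof -
      have H': "(\<lambda>p. (-1) *\<^sub>R H p) \<in> D" using H by (rule D_scale)
      have diff: "(\<lambda>p. K p - H p) \<in> D" using D_add [OF K H'] by simp
      have "(\<lambda>q. \<Lambda> K q - \<Lambda> H q) = \<Lambda> (\<lambda>p. K p - H p)"
        using add [OF K H'] scale [OF H, of "-1"] by simp
      then have "norm_log T N (\<lambda>q. \<Lambda> K q - \<Lambda> H q) \<le> ennreal c * norm3 T V N (\<lambda>p. K p - H p)"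
        using bound [OF diff] by simp
      also have "\<dots> < ennreal c * (e / ennreal c)"
        using small c_pos by (intro ennreal_mult_strict_left_mono) auto
      also have "\<dots> = e"
        using c_pos by (simp add: ennreal_times_divide ennreal_mult_divide_eq mult.commute)
      finally show ?thesis .
    qed
    moreover have "0 < e / ennreal c"
      using e by (simp add: zero_less_iff_neq_zero ennreal_divide_eq_0_iff)
    ultimately show "\<exists>d>0. \<forall>K\<in>D. norm3 T V N (\<lambda>p. K p - H p) < d
        \<longrightarrow> norm_log T N (\<lambda>q. \<Lambda> K q - \<Lambda> H q) < e"
      by blast
  qed (auto simp: add scale)
  then show ?thesis
    using ext \<delta> bound bound2 extends_residual_unique by blast
qed

end

theorem theorem6p7:
  fixes B :: "real \<Rightarrow> 'a::real_vector set" and nrm :: "real \<Rightarrow> 'a \<Rightarrow> real"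
    and S :: "real \<Rightarrow> 'a \<Rightarrow> 'a" and T \<alpha> :: real
  assumes "0 < T"
    and "banach_scale B nrm"
    and "analytic_semigroup_on_scale B nrm T S"
  shows
    "(\<forall>C_star \<eta> C_s :: real. \<forall>\<sigma> :: (real \<times> real \<times> real \<Rightarrow> 'a) \<Rightarrow> 'a splitting.
        0 < C_star \<and> 0 < \<eta> \<and> 0 < C_s \<longrightarrow>
        (\<exists>C>0. \<exists>C\<^sub>\<epsilon> :: real \<Rightarrow> real. (\<forall>\<epsilon>. 0 < C\<^sub>\<epsilon> \<epsilon>) \<and>
          (\<forall>D. selection_domain T S (B \<alpha>) (nrm \<alpha>) C_star \<eta> C_s \<sigma> D \<longrightarrow>
            (\<exists>\<Lambda>.
              (\<forall>H\<in>D. extends_residual T S (B \<alpha>) (nrm \<alpha>) (\<sigma> H) H (\<Lambda> H)) \<and>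
              (\<forall>\<Lambda>'. (\<forall>H\<in>D. extends_residual T S (B \<alpha>) (nrm \<alpha>) (\<sigma> H) H (\<Lambda>' H))
                 \<longrightarrow> (\<forall>H\<in>D. \<Lambda>' H = \<Lambda> H)) \<and>
              continuous_linear_selection T (B \<alpha>) (nrm \<alpha>) D \<Lambda> \<and>
              (\<forall>H\<in>D. \<forall>p\<in>Delta3 T. hdelta2 S (\<Lambda> H) p = H p) \<and>
              (\<forall>H\<in>D. norm_log T (nrm \<alpha>) (\<Lambda> H) \<le> ennreal C * norm3 T (B \<alpha>) (nrm \<alpha>) H) \<and>
              (\<forall>\<epsilon>. 0 < \<epsilon> \<and> \<epsilon> < 1 \<longrightarrow>
                 (\<forall>H\<in>D. norm2 T (nrm \<alpha>) (1 - \<epsilon>) (\<Lambda> H)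
                    \<le> ennreal (C\<^sub>\<epsilon> \<epsilon>) * norm3 T (B \<alpha>) (nrm \<alpha>) H))))))
     \<and>
     (\<forall>C_star \<eta> :: real. 0 < C_star \<and> 0 < \<eta> \<longrightarrow>
        (\<exists>C>0. \<forall>H\<in>ZC1 T S (B \<alpha>) (nrm \<alpha>). \<forall>\<sigma> :: 'a splitting. \<forall>C_H>0.
           splitting_rule T S (B \<alpha>) \<sigma> H \<and>
           critical_estimate T S (nrm \<alpha>) C_H C_star \<eta> \<sigma> H \<and>
           residual_continuity T S (nrm \<alpha>) \<sigma> H \<longrightarrow>
           (\<exists>g. extends_residual T S (B \<alpha>) (nrm \<alpha>) \<sigma> H g \<and>
              (\<forall>g'. extends_residual T S (B \<alpha>) (nrm \<alpha>) \<sigma> H g' \<longrightarrow> g' = g) \<and>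
              norm_log T (nrm \<alpha>) g \<le> ennreal C * (norm3 T (B \<alpha>) (nrm \<alpha>) H + ennreal C_H))))"
proof -
  have banach: "banach_on (B \<alpha>) (nrm \<alpha>)"
    using assms(2) by (simp add: banach_scale_def)
  have semigroup: "strongly_continuous_semigroup_on (B \<alpha>) (nrm \<alpha>) S"
    using assms(3) by (simp add: analytic_semigroup_on_scale_def analytic_semigroup_on_def)
  obtain M where M: "M \<ge> 1" "\<And>t x. 0 \<le> t \<Longrightarrow> t \<le> T \<Longrightarrow> x \<in> B \<alpha> \<Longrightarrow> nrm \<alpha> (S t x) \<le> M * nrm \<alpha> x"
    using semigroup_locally_bounded [OF banach semigroup] by metis
  interpret semigroup_interval "B \<alpha>" "nrm \<alpha>" T S M
    using assms(1) banach semigroup M by unfold_locales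
  show ?thesis
  proof (intro conjI allI impI; elim conjE)
    fix C_star \<eta> C_s :: real and \<sigma> :: "(real \<times> real \<times> real \<Rightarrow> 'a) \<Rightarrow> 'a splitting"
    assume pos: "0 < C_star" "0 < \<eta>" "0 < C_s"
    define c where "c = sewing_const C_star \<eta> * (C_s + 1)"
    have c: "0 < c" using sewing_const_pos pos by (simp add: c_def)
    \<comment> \<open>For \<open>\<epsilon> \<le> 0\<close> the formula can be negative, and any positive value serves.\<close>
    define c\<epsilon> where "c\<epsilon> \<epsilon> = (if 0 < \<epsilon> then c * (T powr \<epsilon> + 1 / \<epsilon> + T * T powr \<epsilon>) else 1)" for \<epsilon>
    have c\<epsilon>: "0 < c\<epsilon> \<epsilon>" for \<epsilon>
      using c assms(1) by (auto simp: c\<epsilon>_def intro!: mult_pos_pos add_pos_pos)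
    have c\<epsilon>_eq: "c\<epsilon> \<epsilon> = c * (T powr \<epsilon> + 1 / \<epsilon> + T * T powr \<epsilon>)" if "0 < \<epsilon>" for \<epsilon>
      using that by (simp add: c\<epsilon>_def)
    show "\<exists>C>0. \<exists>C\<^sub>\<epsilon> :: real \<Rightarrow> real. (\<forall>\<epsilon>. 0 < C\<^sub>\<epsilon> \<epsilon>) \<and>
          (\<forall>D. selection_domain T S (B \<alpha>) (nrm \<alpha>) C_star \<eta> C_s \<sigma> D \<longrightarrow>
            (\<exists>\<Lambda>.
              (\<forall>H\<in>D. extends_residual T S (B \<alpha>) (nrm \<alpha>) (\<sigma> H) H (\<Lambda> H)) \<and>
              (\<forall>\<Lambda>'. (\<forall>H\<in>D. extends_residual T S (B \<alpha>) (nrm \<alpha>) (\<sigma> H) H (\<Lambda>' H))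
                 \<longrightarrow> (\<forall>H\<in>D. \<Lambda>' H = \<Lambda> H)) \<and>
              continuous_linear_selection T (B \<alpha>) (nrm \<alpha>) D \<Lambda> \<and>
              (\<forall>H\<in>D. \<forall>p\<in>Delta3 T. hdelta2 S (\<Lambda> H) p = H p) \<and>
              (\<forall>H\<in>D. norm_log T (nrm \<alpha>) (\<Lambda> H) \<le> ennreal C * norm3 T (B \<alpha>) (nrm \<alpha>) H) \<and>
              (\<forall>\<epsilon>. 0 < \<epsilon> \<and> \<epsilon> < 1 \<longrightarrow>
                 (\<forall>H\<in>D. norm2 T (nrm \<alpha>) (1 - \<epsilon>) (\<Lambda> H)
                    \<le> ennreal (C\<^sub>\<epsilon> \<epsilon>) * norm3 T (B \<alpha>) (nrm \<alpha>) H))))"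
      using selection_operator [OF pos, folded c_def] c c\<epsilon>
      by (intro exI [of _ c] conjI exI [of _ c\<epsilon>] allI impI) (simp_all add: c\<epsilon>_eq)
  next
    fix C_star \<eta> :: real
    assume pos: "0 < C_star" "0 < \<eta>"
    show "\<exists>C>0. \<forall>H\<in>ZC1 T S (B \<alpha>) (nrm \<alpha>). \<forall>\<sigma> :: 'a splitting. \<forall>C_H>0.
           splitting_rule T S (B \<alpha>) \<sigma> H \<and>
           critical_estimate T S (nrm \<alpha>) C_H C_star \<eta> \<sigma> H \<and>
           residual_continuity T S (nrm \<alpha>) \<sigma> H \<longrightarrow>
           (\<exists>g. extends_residual T S (B \<alpha>) (nrm \<alpha>) \<sigma> H g \<and>
              (\<forall>g'. extends_residual T S (B \<alpha>) (nrm \<alpha>) \<sigma> H g' \<longrightarrow> g' = g) \<and>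
              norm_log T (nrm \<alpha>) g \<le> ennreal C * (norm3 T (B \<alpha>) (nrm \<alpha>) H + ennreal C_H))"
      by (intro exI [of _ "sewing_const C_star \<eta>"] conjI sewing_const_pos ballI allI impI;
          elim conjE; rule single_defect [OF pos])
  qed
qed

end
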